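(* Let $\sigma\in\mathbb R^+\setminus\mathbb Q$ have simple continued fraction expansion $[c_0,c_1,\ldots]$, let $k_1\ge 0$ be an integer, and let $$(k_i)_{i=1}^\infty=(k_1,c_0,\underbrace{0,\ldots,0}_{c_1-1},c_2,\underbrace{0,\ldots,0}_{c_3-1},c_4,\underbrace{0,\ldots,0}_{c_5-1},c_6,\ldots).$$ Let $\Lambda$ be the category of paths associated to $(k_i)$ and $G$ the associated groupoid. Then there exists an invariant Borel probability measure on $G^{(0)}$.
   Context: Category $\Lambda$. Given nonnegative integers $k_1,k_2,\ldots$ with $k_i>0$ for infinitely many $i$, $\Lambda$ is the small category with units (objects) $v_1,v_2,\ldots$, generated by edges $\alpha_i$, $\beta_i$, $\gamma_i^{(j)}$ ($i\ge1$, $1\le j\le k_i$), each having range $v_i$ and source $v_{i+1}$, subject only to the relations $\alpha_i\beta_{i+1}=\beta_i\alpha_{i+1}$ for all $i\ge1$. A product $\mu\nu$ is defined iff $s(\mu)=r(\nu)$; $v\Lambda=\{\lambda: r(\lambda)=v\}$. Directed hereditary sets. $[\nu]=\{\mu\in\Lambda:\nu\in\mu\Lambda\}$ where $\mu\Lambda=\{\mu\eta:r(\eta)=s(\mu)\}$. A subset $x\subseteq\Lambda$ is directed if $x\cap\mu\Lambda\cap\nu\Lambda\ne\varnothing$ for all $\mu,\nu\in x$, and hereditary if $[\mu]\subseteq x$ for all $\mu\in x$. $\Lambda^*$ is the set of nonempty directed hereditary subsets; all elements of $x\in\Lambda^*$ have the same range $r(x)$. $Z(\mu)=\{x\in\Lambda^*:\mu\in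 x\}$. $\Lambda^*$ has the locally compact Hausdorff topology with base $\{Z(\lambda)\setminus\bigcup_{i=1}^kZ(\mu_i)\}$. $\Lambda^{**}$ is the set of maximal elements of $\Lambda^*$ under inclusion, $\partial\Lambda=\overline{\Lambda^{**}}$, $v\partial\Lambda=\{x\in\partial\Lambda:r(x)=v\}$. For $r(x)=s(\mu)$, $\mu x=\bigcup_{\nu\in x}[\mu\nu]$. Groupoid $G$. Put $X=v_1\partial\Lambda$. $G$ is the set of equivalence classes $[\mu,\nu,x]$ of triples with $\mu,\nu\in v_1\Lambda$, $s(\mu)=s(\nu)$, $x\in s(\mu)\partial\Lambda$, for the equivalence relation generated by $(\mu,\nu,\eta x)\sim(\mu\eta,\nu\eta,x)$, with $s([\mu,\nu,x])=\nu x$, $r([\mu,\nu,x])=\mu x$, $[\mu,\nu,x]^{-1}=[\nu,\mu,x]$, $[\mu,\nu,x][\nu,\eta,x]=[\mu,\eta,x]$. Its unit space $G^{(0)}$ is identified with $X$ (compact), and the sets $[\mu,\nu,E]=\{[\mu,\nu,x]:x\in E\}$, $E\subseteq s(\mu)\partial\Lambda$ compact open, form a base of its topology; $G$ is an ample Hausdorff étale groupoid. A measure $\mu$ on the unit space of an étale groupoid $\Gamma$ is invariant if $\mu(s(E))=\mu(r(E))$ for every open bisection $E\subseteq\Gamma$. The continued fraction is simple if $c_0\in\mathbb Z$ and $c_i$ is a positive integer for $i\ge1$. *)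

theory Defs
  imports "HOL-Probability.Probability"
begin

fun finite_cfrac :: "int list \<Rightarrow> real" where
  "finite_cfrac [] = 0"
| "finite_cfrac [a] = of_int a"
| "finite_cfrac (a # b # as) = of_int a + 1 / finite_cfrac (b # as)"

definition simple_cfrac_expansion :: "(nat \<Rightarrow> int) \<Rightarrow> real \<Rightarrow> bool" where
  "simple_cfrac_expansion c \<sigma> \<longleftrightarrow>
     (\<forall>i\<ge>1. c i > 0) \<and> (\<lambda>n. finite_cfrac (map c [0..<Suc n])) \<longlonglongrightarrow> \<sigma>"

text \<open>
  The sequence \<open>(k\<^sub>1, c\<^sub>0, 0, \<dots>, 0, c\<^sub>2, 0, \<dots>, 0, c\<^sub>4, \<dots>)\<close> is \<open>k\<^sub>1\<close> followed by the
  concatenation of the blocks \<open>c\<^sub>2\<^sub>m, 0, \<dots>, 0\<close> with \<open>c\<^sub>2\<^sub>m\<^sub>+\<^sub>1 - 1\<close> zeros. All blocks are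
  nonempty, so the first \<open>i\<close> blocks suffice to read off \<open>k\<^sub>i\<close>. Indices start at 1; the value
  at index 0 is never used.
\<close>

definition kblock :: "(nat \<Rightarrow> int) \<Rightarrow> nat \<Rightarrow> nat list" where
  "kblock c m = nat (c (2 * m)) # replicate (nat (c (2 * m + 1) - 1)) 0"

definition kseq :: "nat \<Rightarrow> (nat \<Rightarrow> int) \<Rightarrow> nat \<Rightarrow> nat" where
  "kseq k1 c i = (k1 # concat (map (kblock c) [0..<i])) ! (i - 1)"

text \<open>
  Every edge \<open>\<alpha>\<^sub>i\<close>, \<open>\<beta>\<^sub>i\<close>, \<open>\<gamma>\<^sub>i\<^sup>(\<^sup>j\<^sup>)\<close> runs from \<open>v\<^sub>i\<^sub>+\<^sub>1\<close> (source) to \<open>v\<^sub>i\<close> (range), so a path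
  in the free category is determined by the index \<open>n\<close> of its range \<open>v\<^sub>n\<close> and a word of
  letters: in \<open>(n, w)\<close> the letter \<open>w ! p\<close> denotes the edge of that kind with subscript
  \<open>n + p\<close>. In particular \<open>(n, [])\<close> is the unit \<open>v\<^sub>n\<close>. The bound \<open>1 \<le> j \<le> k\<^sub>i\<close> on the edges
  \<open>\<gamma>\<^sub>i\<^sup>(\<^sup>j\<^sup>)\<close>, and \<open>n \<ge> 1\<close>, are imposed afterwards, in \<open>\<Lambda>\<close>; the relations do not involve
  the \<open>\<gamma>\<close>'s.
\<close>

datatype letter = Alpha | Beta | Gam nat

inductive commute :: "nat \<times> letter list \<Rightarrow> nat \<times> letter list \<Rightarrow> bool" where
  "commute (n, u @ [Alpha, Beta] @ w) (n, u @ [Beta, Alpha] @ w)"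

quotient_type path = "nat \<times> letter list" / "equivclp commute"
  by (rule equivp_evquivclp)

lemma equivclp_commute_fst_length:
  assumes "equivclp commute p q"
  shows "fst p = fst q \<and> length (snd p) = length (snd q)"
  using assms by (induction rule: equivclp_induct) (auto elim!: commute.cases)

lemma commute_append:
  assumes "commute (n, u) (m, v)"
  shows "commute (i, t @ u @ w) (i, t @ v @ w)"
  using assms
proof (cases rule: commute.cases)
  case (1 u' w')
  then show ?thesis
    using commute.intros[of i "t @ u'" "w' @ w"] by simp
qed

lemma equivclp_commute_append:
  assumes "equivclp commute p q"
  shows "equivclp commute (i, t @ snd p @ w) (i, t @ snd q @ w)"
  using assms
proof (induction rule: equivclp_induct)
  case base
  show ?case by (rule equivclp_refl)
next
  case (step y z)
  have "commute (i, t @ snd y @ w) (i, t @ snd z @ w) \<or>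
        commute (i, t @ snd z @ w) (i, t @ snd y @ w)"
    using step.hyps(2) commute_append by (metis prod.collapse)
  then have "equivclp commute (i, t @ snd y @ w) (i, t @ snd z @ w)"
    by (meson converse_r_into_equivclp r_into_equivclp)
  with step.IH show ?case by (rule equivclp_trans)
qed

text \<open>The vertex \<open>v\<^sub>n\<close> is represented by its index \<open>n\<close>.\<close>

lift_definition unit_path :: "nat \<Rightarrow> path" is "\<lambda>n. (n, [])" .

lift_definition rng :: "path \<Rightarrow> nat" is fst
  by (simp add: equivclp_commute_fst_length)

lift_definition src :: "path \<Rightarrow> nat" is "\<lambda>p. fst p + length (snd p)"
  using equivclp_commute_fst_length by auto

text \<open>The product of the category; meaningful only if \<open>src \<mu> = rng \<nu>\<close>.\<close>

lift_definition pcomp :: "path \<Rightarrow> path \<Rightarrow> path" is "\<lambda>p q. (fst p, snd p @ snd q)"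
proof -
  fix p p' q q'
  assume p: "equivclp commute p p'" and q: "equivclp commute q q'"
  have "equivclp commute (fst p, snd p @ snd q) (fst p, snd p' @ snd q)"
    using equivclp_commute_append[OF p, of "fst p" "[]" "snd q"] by simp
  moreover have "equivclp commute (fst p, snd p' @ snd q) (fst p, snd p' @ snd q')"
    using equivclp_commute_append[OF q, of "fst p" "snd p'" "[]"] by simp
  ultimately show "equivclp commute (fst p, snd p @ snd q) (fst p', snd p' @ snd q')"
    using equivclp_commute_fst_length[OF p] equivclp_trans by metis
qed

definition edge_path :: "(nat \<Rightarrow> nat) \<Rightarrow> nat \<times> letter list \<Rightarrow> bool" where
  "edge_path k p \<longleftrightarrow> fst p \<ge> 1 \<and>
     (\<forall>q<length (snd p). \<forall>j. snd p ! q = Gam j \<longrightarrow> 1 \<le> j \<and> j \<le> k (fst p + q))"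

definition Lam :: "(nat \<Rightarrow> nat) \<Rightarrow> path set" where
  "Lam k = abs_path ` Collect (edge_path k)"

definition exts :: "(nat \<Rightarrow> nat) \<Rightarrow> path \<Rightarrow> path set" where
  "exts k \<mu> = {pcomp \<mu> \<eta> | \<eta>. \<eta> \<in> Lam k \<and> rng \<eta> = src \<mu>}"

definition initial_segs :: "(nat \<Rightarrow> nat) \<Rightarrow> path \<Rightarrow> path set" where
  "initial_segs k \<nu> = {\<mu> \<in> Lam k. \<nu> \<in> exts k \<mu>}"

definition directed_set :: "(nat \<Rightarrow> nat) \<Rightarrow> path set \<Rightarrow> bool" where
  "directed_set k x \<longleftrightarrow> (\<forall>\<mu>\<in>x. \<forall>\<nu>\<in>x. x \<inter> exts k \<mu> \<inter> exts k \<nu> \<noteq> {})"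

definition hereditary_set :: "(nat \<Rightarrow> nat) \<Rightarrow> path set \<Rightarrow> bool" where
  "hereditary_set k x \<longleftrightarrow> (\<forall>\<mu>\<in>x. initial_segs k \<mu> \<subseteq> x)"

definition Lam_star :: "(nat \<Rightarrow> nat) \<Rightarrow> path set set" where
  "Lam_star k = {x. x \<subseteq> Lam k \<and> x \<noteq> {} \<and> directed_set k x \<and> hereditary_set k x}"

definition rng_of :: "path set \<Rightarrow> nat" where
  "rng_of x = (THE n. \<forall>\<mu>\<in>x. rng \<mu> = n)"

definition Zset :: "(nat \<Rightarrow> nat) \<Rightarrow> path \<Rightarrow> path set set" where
  "Zset k \<mu> = {x \<in> Lam_star k. \<mu> \<in> x}"

definition Lam_star_top :: "(nat \<Rightarrow> nat) \<Rightarrow> path set topology" where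
  "Lam_star_top k = topology_generated_by
     {Zset k \<mu> - (\<Union>\<nu>\<in>F. Zset k \<nu>) | \<mu> F. \<mu> \<in> Lam k \<and> finite F \<and> F \<subseteq> Lam k}"

definition Lam_star_star :: "(nat \<Rightarrow> nat) \<Rightarrow> path set set" where
  "Lam_star_star k = {x \<in> Lam_star k. \<forall>y\<in>Lam_star k. x \<subseteq> y \<longrightarrow> y = x}"

definition bdry :: "(nat \<Rightarrow> nat) \<Rightarrow> path set set" where
  "bdry k = Lam_star_top k closure_of Lam_star_star k"

definition bdry_at :: "(nat \<Rightarrow> nat) \<Rightarrow> nat \<Rightarrow> path set set" where
  "bdry_at k n = {x \<in> bdry k. rng_of x = n}"

definition bdry_at_top :: "(nat \<Rightarrow> nat) \<Rightarrow> nat \<Rightarrow> path set topology" where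
  "bdry_at_top k n = subtopology (Lam_star_top k) (bdry_at k n)"

definition act :: "(nat \<Rightarrow> nat) \<Rightarrow> path \<Rightarrow> path set \<Rightarrow> path set" where
  "act k \<mu> x = (\<Union>\<nu>\<in>x. initial_segs k (pcomp \<mu> \<nu>))"

text \<open>
  The unit space is a separate topological space, identified with a subset of the arrows
  by \<open>unit_arrow\<close>; range and source take values in it. The set of arrows is the
  \<open>topspace\<close> of \<open>arrows\<close>.
\<close>

record ('g, 'x) top_groupoid =
  arrows :: "'g topology"
  unit_space :: "'x topology"
  unit_arrow :: "'x \<Rightarrow> 'g"
  range_map :: "'g \<Rightarrow> 'x"
  source_map :: "'g \<Rightarrow> 'x"
  inv_arrow :: "'g \<Rightarrow> 'g"
  mult_arrow :: "'g \<Rightarrow> 'g \<Rightarrow> 'g"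

definition open_bisection :: "('g, 'x) top_groupoid \<Rightarrow> 'g set \<Rightarrow> bool" where
  "open_bisection \<G> E \<longleftrightarrow>
     openin (arrows \<G>) E \<and> inj_on (range_map \<G>) E \<and> inj_on (source_map \<G>) E"

definition borel_algebra :: "'x topology \<Rightarrow> 'x measure" where
  "borel_algebra T = sigma (topspace T) {U. openin T U}"

text \<open>
  In an etale groupoid the range and source of an open set are open, hence measurable.
\<close>

definition invariant_measure :: "('g, 'x) top_groupoid \<Rightarrow> 'x measure \<Rightarrow> bool" where
  "invariant_measure \<G> M \<longleftrightarrow>
     sets M = sets (borel_algebra (unit_space \<G>)) \<and>
     (\<forall>E. open_bisection \<G> E \<longrightarrow>
        emeasure M (source_map \<G> ` E) = emeasure M (range_map \<G> ` E))"

type_synonym triple = "path \<times> path \<times> path set"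

definition triples :: "(nat \<Rightarrow> nat) \<Rightarrow> triple set" where
  "triples k = {(\<mu>, \<nu>, x). \<mu> \<in> Lam k \<and> \<nu> \<in> Lam k \<and> rng \<mu> = 1 \<and> rng \<nu> = 1 \<and>
     src \<mu> = src \<nu> \<and> x \<in> bdry_at k (src \<mu>)}"

inductive shift :: "(nat \<Rightarrow> nat) \<Rightarrow> triple \<Rightarrow> triple \<Rightarrow> bool" for k where
  "\<lbrakk>(\<mu>, \<nu>, act k \<eta> x) \<in> triples k; (pcomp \<mu> \<eta>, pcomp \<nu> \<eta>, x) \<in> triples k;
    \<eta> \<in> Lam k; rng \<eta> = src \<mu>\<rbrakk>
   \<Longrightarrow> shift k (\<mu>, \<nu>, act k \<eta> x) (pcomp \<mu> \<eta>, pcomp \<nu> \<eta>, x)"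

definition germ :: "(nat \<Rightarrow> nat) \<Rightarrow> path \<Rightarrow> path \<Rightarrow> path set \<Rightarrow> triple set" where
  "germ k \<mu> \<nu> x = {t. equivclp (shift k) (\<mu>, \<nu>, x) t}"

definition germ_source :: "(nat \<Rightarrow> nat) \<Rightarrow> triple set \<Rightarrow> path set" where
  "germ_source k g = (THE y. \<exists>\<mu> \<nu> x. (\<mu>, \<nu>, x) \<in> triples k \<and> g = germ k \<mu> \<nu> x \<and> y = act k \<nu> x)"

definition germ_range :: "(nat \<Rightarrow> nat) \<Rightarrow> triple set \<Rightarrow> path set" where
  "germ_range k g = (THE y. \<exists>\<mu> \<nu> x. (\<mu>, \<nu>, x) \<in> triples k \<and> g = germ k \<mu> \<nu> x \<and> y = act k \<mu> x)"

definition germ_inv :: "(nat \<Rightarrow> nat) \<Rightarrow> triple set \<Rightarrow> triple set" where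
  "germ_inv k g = (THE h. \<exists>\<mu> \<nu> x. (\<mu>, \<nu>, x) \<in> triples k \<and> g = germ k \<mu> \<nu> x \<and> h = germ k \<nu> \<mu> x)"

definition germ_mult :: "(nat \<Rightarrow> nat) \<Rightarrow> triple set \<Rightarrow> triple set \<Rightarrow> triple set" where
  "germ_mult k g h = (THE f. \<exists>\<mu> \<nu> \<eta> x. (\<mu>, \<nu>, x) \<in> triples k \<and> (\<nu>, \<eta>, x) \<in> triples k \<and>
     g = germ k \<mu> \<nu> x \<and> h = germ k \<nu> \<eta> x \<and> f = germ k \<mu> \<eta> x)"

definition germ_top :: "(nat \<Rightarrow> nat) \<Rightarrow> triple set topology" where
  "germ_top k = topology_generated_by
     {germ k \<mu> \<nu> ` E | \<mu> \<nu> E. \<mu> \<in> Lam k \<and> \<nu> \<in> Lam k \<and> rng \<mu> = 1 \<and> rng \<nu> = 1 \<and> src \<mu> = src \<nu> \<and>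
        openin (bdry_at_top k (src \<mu>)) E \<and> compactin (bdry_at_top k (src \<mu>)) E}"

definition path_groupoid :: "(nat \<Rightarrow> nat) \<Rightarrow> (triple set, path set) top_groupoid" where
  "path_groupoid k = \<lparr>
     arrows = germ_top k,
     unit_space = bdry_at_top k 1,
     unit_arrow = germ k (unit_path 1) (unit_path 1),
     range_map = germ_range k,
     source_map = germ_source k,
     inv_arrow = germ_inv k,
     mult_arrow = germ_mult k\<rparr>"

end

theory Submission
  imports Defs "HOL-Library.Sublist"
begin

text \<open>
  An invariant measure is determined by numbers \<open>t\<^sub>n\<close>, the mass of every cylinder \<open>Z(\<mu>)\<close> with
  \<open>s(\<mu>) = v\<^sub>n\<close>. Splitting a cylinder by the first edge, where \<open>Z(\<alpha>\<^sub>n)\<close> and \<open>Z(\<beta>\<^sub>n)\<close> overlap in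
  \<open>Z(\<alpha>\<^sub>n\<beta>\<^sub>n\<^sub>+\<^sub>1)\<close>, gives \<open>t\<^sub>n = (2 + k\<^sub>n) t\<^sub>n\<^sub>+\<^sub>1 - t\<^sub>n\<^sub>+\<^sub>2\<close>. This recursion has a positive decreasing
  solution with \<open>t\<^sub>1 = 1\<close>, whose successive ratios are values of continued fractions, and
  \<open>t\<^sub>n \<rightarrow> 0\<close> because \<open>k\<^sub>n > 0\<close> infinitely often. The measure is the image of Lebesgue measure on \<open>[0, 1)\<close>
  under a symbolic coding by paths in which the ambiguity \<open>\<alpha>\<beta> = \<beta>\<alpha>\<close> is resolved by always reading the
  \<open>\<alpha>\<close> first. Then \<open>\<beta>\<close>-cylinders might get the wrong mass, but the error at level \<open>n\<close> equals
  an error at any later level \<open>m\<close>, which is at most \<open>t\<^sub>m\<close>.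
\<close>

section \<open>Paths as pairs of words\<close>

text \<open>Since \<alpha>\<beta> = \<beta>\<alpha>, cylinders of different paths of equal length
  can overlap, so prescribing values on cylinders would leave consistency and countable additivity
  to be proved. An image of Lebesgue measure is a measure from the start, and only its values on
  cylinders remain to be computed. Overlaps are controlled by recording a path as two words: paths
  with a common extension have a least one, so two cylinders meet in a cylinder or not at all, and a
  finite measure is determined by its values on cylinders. The \<beta>-block is short by the points
  that would continue with \<alpha>, while \<beta> also hides behind an \<alpha> whose continuation
  contains \<beta>. The error is therefore the difference of a \<beta>-cylinder and an
  \<alpha>-cylinder one level later, which is again an error of the same kind. An open bisection
  splits into countably many disjoint pieces, each given by one pair of paths, which reduces
  invariance to single pairs.\<close>

lemma equivclp_commute_Cons:
  assumes "equivclp commute (n, u) (n, v)"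
  shows "equivclp commute (m, l # u) (m, l # v)"
  using equivclp_commute_append[OF assms, of m "[l]" "[]"] by simp

lemma equivclp_commute_swap:
  "equivclp commute (n, Alpha # Beta # w) (n, Beta # Alpha # w)"
  "equivclp commute (n, Beta # Alpha # w) (n, Alpha # Beta # w)"
  using commute.intros[of n "[]" w] by (auto intro: r_into_equivclp converse_r_into_equivclp)

text \<open>The second assumption means that only copies of \<open>l'\<close> precede the first
  \<open>l\<close> in \<open>w\<close>, and \<open>l\<close> commutes past each of them.\<close>

lemma commute_to_front:
  assumes "l = Alpha \<and> l' = Beta \<or> l = Beta \<and> l' = Alpha" and "removeAll l' w = l # p"
  shows "\<exists>w'. equivclp commute (n, w) (n, l # w')"
  using assms(2)
proof (induction w arbitrary: n)
  case (Cons a w)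
  show ?case
  proof (cases "a = l'")
    case True
    with Cons obtain w' where "equivclp commute (n, w) (n, l # w')"
      by auto
    from equivclp_commute_Cons[OF this, of n a]
    have "equivclp commute (n, a # w) (n, a # l # w')" .
    moreover have "equivclp commute (n, a # l # w') (n, l # a # w')"
      using assms(1) True equivclp_commute_swap by auto
    ultimately show ?thesis by (meson equivclp_trans)
  next
    case False
    with Cons.prems have "a = l" by auto
    then show ?thesis by (auto intro: equivclp_refl)
  qed
qed simp

lemma equivclp_commute_removeAll:
  assumes "equivclp commute p q"
  shows "removeAll Alpha (snd p) = removeAll Alpha (snd q)"
    and "removeAll Beta (snd p) = removeAll Beta (snd q)"
  using assms by (induction rule: equivclp_induct) (auto elim!: commute.cases)

text \<open>The word \<open>u\<close> is peeled off from the front: its first letter can be brought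
  to the front of \<open>w\<close>, and cancelling it preserves both prefix conditions.\<close>

lemma commute_divide:
  assumes "prefix (removeAll Beta u) (removeAll Beta w)"
    and "prefix (removeAll Alpha u) (removeAll Alpha w)"
  shows "\<exists>v. equivclp commute (n, w) (n, u @ v)"
  using assms
proof (induction u arbitrary: w n)
  case (Cons a u)
  have "\<exists>w'. equivclp commute (n, w) (n, a # w')"
  proof (cases a)
    case Alpha
    with Cons.prems(1) obtain p where "removeAll Beta w = Alpha # p"
      by (auto simp: prefix_def)
    with Alpha commute_to_front[of Alpha Beta] show ?thesis by auto
  next
    case Beta
    with Cons.prems(2) obtain p where "removeAll Alpha w = Beta # p"
      by (auto simp: prefix_def)
    with Beta commute_to_front[of Beta Alpha] show ?thesis by auto
  next
    case (Gam j)
    with Cons.prems obtain p q where "removeAll Alpha w = Gam j # p" "removeAll Beta w = Gam j # q"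
      by (auto simp: prefix_def)
    then obtain w' where "w = Gam j # w'"
      \<comment> \<open>A leading \<open>Alpha\<close> would survive in
        \<open>removeAll Beta w\<close> and a leading \<open>Beta\<close> in
        \<open>removeAll Alpha w\<close>, so the \<gamma> already stands first.\<close>
      by (cases w) (auto split: if_splits)
    with Gam show ?thesis by (auto intro: equivclp_refl)
  qed
  then obtain w' where w': "equivclp commute (n, w) (n, a # w')" by blast
  have "prefix (removeAll Beta u) (removeAll Beta w')" "prefix (removeAll Alpha u) (removeAll Alpha w')"
    using Cons.prems equivclp_commute_removeAll[OF w'] by (auto split: if_splits)
  from Cons.IH[OF this] obtain v where "equivclp commute (n, w') (n, u @ v)" by blast
  from equivclp_trans[OF w' equivclp_commute_Cons[OF this]] show ?case by auto
qed (auto intro: equivclp_refl)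

lift_definition alphas :: "path \<Rightarrow> letter list" is "\<lambda>p. removeAll Beta (snd p)"
  by (rule equivclp_commute_removeAll)

lift_definition betas :: "path \<Rightarrow> letter list" is "\<lambda>p. removeAll Alpha (snd p)"
  by (rule equivclp_commute_removeAll)

text \<open>
  A path is determined by its range and the two words obtained by deleting all \<open>\<beta>\<close>'s and all
  \<open>\<alpha>\<close>'s, and divisibility is the prefix order on both of them.
\<close>

definition divides :: "path \<Rightarrow> path \<Rightarrow> bool" (infix "\<preceq>" 50) where
  "\<mu> \<preceq> \<nu> \<longleftrightarrow> rng \<mu> = rng \<nu> \<and> prefix (alphas \<mu>) (alphas \<nu>) \<and> prefix (betas \<mu>) (betas \<nu>)"

lemma path_exhaust [cases type: path]:
  obtains n w where "\<mu> = abs_path (n, w)"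
  by (metis Quotient_path Quotient_abs_rep surj_pair)

lemma path_abs_simps [simp]:
  "rng (abs_path (n, w)) = n"
  "src (abs_path (n, w)) = n + length w"
  "alphas (abs_path (n, w)) = removeAll Beta w"
  "betas (abs_path (n, w)) = removeAll Alpha w"
  "pcomp (abs_path (n, w)) (abs_path (m, v)) = abs_path (n, w @ v)"
  by (simp_all add: rng.abs_eq src.abs_eq alphas.abs_eq betas.abs_eq pcomp.abs_eq)

lemma unit_path_abs: "unit_path n = abs_path (n, [])"
  by (simp add: unit_path.abs_eq)

lemma unit_path_simps [simp]:
  "rng (unit_path n) = n" "src (unit_path n) = n" "alphas (unit_path n) = []" "betas (unit_path n) = []"
  by (simp_all add: unit_path_abs)

lemma abs_path_eq_iff: "abs_path p = abs_path q \<longleftrightarrow> equivclp commute p q"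
  using path.abs_eq_iff by simp

lemma rng_le_src: "rng \<mu> \<le> src \<mu>"
  by (cases \<mu>) simp

lemma pcomp_simps [simp]:
  "rng (pcomp \<mu> \<nu>) = rng \<mu>"
  "alphas (pcomp \<mu> \<nu>) = alphas \<mu> @ alphas \<nu>"
  "betas (pcomp \<mu> \<nu>) = betas \<mu> @ betas \<nu>"
  "rng \<nu> = src \<mu> \<Longrightarrow> src (pcomp \<mu> \<nu>) = src \<nu>"
  by (cases \<mu>; cases \<nu>; simp)+

lemma pcomp_assoc: "pcomp (pcomp \<mu> \<nu>) \<eta> = pcomp \<mu> (pcomp \<nu> \<eta>)"
  by (cases \<mu>; cases \<nu>; cases \<eta>) simp

lemma pcomp_unit [simp]:
  "pcomp \<mu> (unit_path n) = \<mu>" "n = rng \<mu> \<Longrightarrow> pcomp (unit_path n) \<mu> = \<mu>"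
  by (cases \<mu>; simp add: unit_path_abs)+

text \<open>The bridge between the order on words, in which divisibility is computed, and
  factorisation in the category, in which \<open>exts\<close> is defined.\<close>

lemma divides_iff: "\<mu> \<preceq> \<nu> \<longleftrightarrow> (\<exists>\<eta>. rng \<eta> = src \<mu> \<and> \<nu> = pcomp \<mu> \<eta>)"
proof
  assume *: "\<mu> \<preceq> \<nu>"
  obtain n u where u: "\<mu> = abs_path (n, u)" by (cases \<mu>)
  obtain m w where w: "\<nu> = abs_path (m, w)" by (cases \<nu>)
  from * u w have [simp]: "m = n" by (simp add: divides_def)
  obtain v where "equivclp commute (n, w) (n, u @ v)"
    using commute_divide[of u w n] * u w unfolding divides_def by auto
  then have "\<nu> = pcomp \<mu> (abs_path (n + length u, v))"
    using u w by (simp add: abs_path_eq_iff)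
  then show "\<exists>\<eta>. rng \<eta> = src \<mu> \<and> \<nu> = pcomp \<mu> \<eta>"
    using u by (intro exI[of _ "abs_path (n + length u, v)"]) simp
qed (auto simp: divides_def)

lemma divides_pcomp: "\<mu> \<preceq> pcomp \<mu> \<eta>"
  by (simp add: divides_def)

lemma divides_refl [simp]: "\<mu> \<preceq> \<mu>"
  by (simp add: divides_def)

lemma divides_trans [trans]: "\<mu> \<preceq> \<nu> \<Longrightarrow> \<nu> \<preceq> \<eta> \<Longrightarrow> \<mu> \<preceq> \<eta>"
  by (auto simp: divides_def intro: prefix_order.trans)

lemma divides_pcomp_cancel [simp]:
  "rng \<nu> = rng \<eta> \<Longrightarrow> pcomp \<mu> \<nu> \<preceq> pcomp \<mu> \<eta> \<longleftrightarrow> \<nu> \<preceq> \<eta>"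
  by (simp add: divides_def)

lemma unit_divides [simp]: "unit_path n \<preceq> \<mu> \<longleftrightarrow> n = rng \<mu>"
  by (auto simp: divides_def)

lemma path_trivial: "src \<mu> = rng \<mu> \<Longrightarrow> \<mu> = unit_path (rng \<mu>)"
  by (cases \<mu>) (simp add: unit_path_abs)

lemma divides_src_le: "\<mu> \<preceq> \<nu> \<Longrightarrow> src \<mu> \<le> src \<nu>"
  by (metis divides_iff pcomp_simps(4) rng_le_src)

text \<open>The part shared by the two words of a path. It is the only coupling between them, and so
  decides which combinations of words can occur.\<close>

definition gammas :: "letter list \<Rightarrow> letter list" where
  "gammas w = removeAll Alpha (removeAll Beta w)"

lemma gammas_append [simp]: "gammas (u @ v) = gammas u @ gammas v"
  by (simp add: gammas_def)

lemma gammas_alphas_betas: "gammas (alphas \<mu>) = gammas (betas \<mu>)"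
  by (cases \<mu>) (simp add: gammas_def, simp add: removeAll_filter_not_eq conj_commute)

lemma Beta_notin_alphas: "Beta \<notin> set (alphas \<mu>)"
  by (cases \<mu>) simp

lemma gammas_prefix: "prefix u v \<Longrightarrow> prefix (gammas u) (gammas v)"
  by (auto simp: prefix_def)

text \<open>
  In the mixed case the words of \<open>\<gamma>\<close>'s agree, so \<open>\<nu>\<close> exceeds \<open>\<mu>\<close> only by a power of \<open>\<alpha>\<close>.
\<close>

lemma lcm_mixed:
  assumes "rng \<mu> = rng \<nu>" "prefix (alphas \<mu>) (alphas \<nu>)" "prefix (betas \<nu>) (betas \<mu>)"
  shows "\<exists>\<kappa>. rng \<kappa> = rng \<mu> \<and> alphas \<kappa> = alphas \<nu> \<and> betas \<kappa> = betas \<mu>"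
proof -
  obtain r where r: "alphas \<nu> = alphas \<mu> @ r" using assms(2) by (auto simp: prefix_def)
  have "prefix (gammas (alphas \<nu>)) (gammas (alphas \<mu>))"
    using gammas_prefix[OF assms(3)] by (simp add: gammas_alphas_betas)
  with r have "gammas r = []" by simp
  moreover have "Beta \<notin> set r" using Beta_notin_alphas[of \<nu>] r by simp
  ultimately have "removeAll Beta r = r" "removeAll Alpha r = []"
    by (simp_all add: gammas_def removeAll_id)
  then have "rng (pcomp \<mu> (abs_path (src \<mu>, r))) = rng \<mu> \<and>
     alphas (pcomp \<mu> (abs_path (src \<mu>, r))) = alphas \<nu> \<and>
     betas (pcomp \<mu> (abs_path (src \<mu>, r))) = betas \<mu>"
    using r by simp
  then show ?thesis by blast
qed

text \<open>Prefixes of a common word are comparable, so in each of the two coordinates one word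
  extends the other. The least common multiple takes the longer word in each coordinate.\<close>

lemma lcm_exists:
  assumes "\<mu> \<preceq> \<xi>" "\<nu> \<preceq> \<xi>"
  obtains \<kappa> where "\<mu> \<preceq> \<kappa>" "\<nu> \<preceq> \<kappa>" "\<And>\<zeta>. \<mu> \<preceq> \<zeta> \<Longrightarrow> \<nu> \<preceq> \<zeta> \<Longrightarrow> \<kappa> \<preceq> \<zeta>"
proof -
  have r: "rng \<mu> = rng \<nu>" using assms by (simp add: divides_def)
  have a: "prefix (alphas \<mu>) (alphas \<nu>) \<or> prefix (alphas \<nu>) (alphas \<mu>)"
    and b: "prefix (betas \<mu>) (betas \<nu>) \<or> prefix (betas \<nu>) (betas \<mu>)"
    using assms prefix_same_cases by (auto simp: divides_def)
  then consider "\<mu> \<preceq> \<nu>" | "\<nu> \<preceq> \<mu>"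
    | "prefix (alphas \<mu>) (alphas \<nu>)" "prefix (betas \<nu>) (betas \<mu>)"
    | "prefix (alphas \<nu>) (alphas \<mu>)" "prefix (betas \<mu>) (betas \<nu>)"
    using r by (auto simp: divides_def)
  then show ?thesis
  proof cases
    case 1
    then show ?thesis using that[of \<nu>] by simp
  next
    case 2
    then show ?thesis using that[of \<mu>] by simp
  next
    case 3
    from lcm_mixed[OF r this] obtain \<kappa> where
      "rng \<kappa> = rng \<mu>" "alphas \<kappa> = alphas \<nu>" "betas \<kappa> = betas \<mu>" by blast
    with 3 r show ?thesis by (intro that[of \<kappa>]) (auto simp: divides_def)
  next
    case 4
    from lcm_mixed[OF r[symmetric] this] obtain \<kappa> where
      "rng \<kappa> = rng \<nu>" "alphas \<kappa> = alphas \<mu>" "betas \<kappa> = betas \<nu>" by blast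
    with 4 r show ?thesis by (intro that[of \<kappa>]) (auto simp: divides_def)
  qed
qed

text \<open>\<open>\<theta>\<close> is the least common multiple of \<open>\<mu>\<close> and
  \<open>\<eta>\<close> with \<open>\<eta>\<close> cancelled. It turns a condition on
  \<open>\<eta>\<nu>\<close> into one on \<open>\<nu>\<close>.\<close>

lemma quotient_exists:
  assumes "\<mu> \<preceq> pcomp \<eta> \<zeta>" "rng \<zeta> = src \<eta>"
  obtains \<theta> where "rng \<theta> = src \<eta>"
    "\<And>\<nu>. rng \<nu> = src \<eta> \<Longrightarrow> \<mu> \<preceq> pcomp \<eta> \<nu> \<longleftrightarrow> \<theta> \<preceq> \<nu>"
    "\<And>\<xi>. \<mu> \<preceq> \<xi> \<and> \<eta> \<preceq> \<xi> \<longleftrightarrow> pcomp \<eta> \<theta> \<preceq> \<xi>"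
proof -
  obtain \<kappa> where k: "\<mu> \<preceq> \<kappa>" "\<eta> \<preceq> \<kappa>" "\<And>\<zeta>. \<mu> \<preceq> \<zeta> \<Longrightarrow> \<eta> \<preceq> \<zeta> \<Longrightarrow> \<kappa> \<preceq> \<zeta>"
    using lcm_exists[OF assms(1) divides_pcomp] by metis
  then obtain \<theta> where t: "rng \<theta> = src \<eta>" "\<kappa> = pcomp \<eta> \<theta>" by (auto simp: divides_iff)
  have *: "\<mu> \<preceq> \<xi> \<and> \<eta> \<preceq> \<xi> \<longleftrightarrow> pcomp \<eta> \<theta> \<preceq> \<xi>" for \<xi>
    using k t by (metis divides_trans)
  have "\<mu> \<preceq> pcomp \<eta> \<nu> \<longleftrightarrow> \<theta> \<preceq> \<nu>" if "rng \<nu> = src \<eta>" for \<nu>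
    using *[of "pcomp \<eta> \<nu>"] that t by (auto simp: divides_pcomp)
  with t * show ?thesis by (intro that[of \<theta>]) auto
qed

text \<open>A \<gamma> is a barrier because it occupies both words. A factor of \<open>\<xi>\<close>
  that passes it in one coordinate has more \<gamma>'s than \<open>\<mu>\<close>, hence passes it in
  the other coordinate too and is longer than \<open>\<mu>\<close>.\<close>

lemma divides_below_gamma:
  assumes "\<nu> \<preceq> \<xi>" "pcomp \<mu> (abs_path (src \<mu>, [Gam j])) \<preceq> \<xi>" "src \<nu> \<le> src \<mu>"
  shows "\<nu> \<preceq> \<mu>"
proof (rule ccontr)
  let ?g = "pcomp \<mu> (abs_path (src \<mu>, [Gam j]))"
  assume n: "\<not> \<nu> \<preceq> \<mu>"
  have r: "rng \<mu> = rng \<nu>" using assms by (simp add: divides_def)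
  have a: "prefix (alphas \<nu>) (alphas \<mu>) \<or> prefix (alphas \<mu> @ [Gam j]) (alphas \<nu>)"
    using assms(1,2) prefix_same_cases[of "alphas \<nu>" "alphas \<xi>" "alphas \<mu> @ [Gam j]"]
    by (auto simp: divides_def)
  have b: "prefix (betas \<nu>) (betas \<mu>) \<or> prefix (betas \<mu> @ [Gam j]) (betas \<nu>)"
    using assms(1,2) prefix_same_cases[of "betas \<nu>" "betas \<xi>" "betas \<mu> @ [Gam j]"]
    by (auto simp: divides_def)
  have "\<not> (prefix (alphas \<nu>) (alphas \<mu>) \<and> prefix (betas \<mu> @ [Gam j]) (betas \<nu>))"
  proof
    assume "prefix (alphas \<nu>) (alphas \<mu>) \<and> prefix (betas \<mu> @ [Gam j]) (betas \<nu>)"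
    then have "length (gammas (alphas \<nu>)) \<le> length (gammas (alphas \<mu>))"
      "length (gammas (betas \<mu>)) < length (gammas (betas \<nu>))"
      by (auto simp: prefix_def gammas_def)
    then show False by (simp add: gammas_alphas_betas)
  qed
  moreover have "\<not> (prefix (betas \<nu>) (betas \<mu>) \<and> prefix (alphas \<mu> @ [Gam j]) (alphas \<nu>))"
  proof
    assume "prefix (betas \<nu>) (betas \<mu>) \<and> prefix (alphas \<mu> @ [Gam j]) (alphas \<nu>)"
    then have "length (gammas (betas \<nu>)) \<le> length (gammas (betas \<mu>))"
      "length (gammas (alphas \<mu>)) < length (gammas (alphas \<nu>))"
      by (auto simp: prefix_def gammas_def)
    then show False by (simp add: gammas_alphas_betas)
  qed
  ultimately have "?g \<preceq> \<nu>" using a b n r by (auto simp: divides_def)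
  from divides_src_le[OF this] assms(3) show False by simp
qed

section \<open>Countability of paths, and paths inside \<open>Lam\<close>\<close>

instance letter :: countable
  by countable_datatype

instance path :: countable
proof
  have "UNIV = range abs_path" by (metis path_exhaust rangeI UNIV_eq_I)
  moreover have "countable (range abs_path)" by (rule countable_image, rule countableI_type)
  ultimately have "countable (UNIV :: path set)" by (rule ssubst)
  then show "\<exists>to_nat :: path \<Rightarrow> nat. inj to_nat" by (rule countableE) blast
qed

lemma edge_path_append:
  "edge_path k (n, u @ w) \<longleftrightarrow> edge_path k (n, u) \<and> edge_path k (n + length u, w)"
proof (induction w rule: rev_induct)
  case (snoc a w)
  have *: "edge_path k (n, w @ [a]) \<longleftrightarrow>
     edge_path k (n, w) \<and> (\<forall>j. a = Gam j \<longrightarrow> 1 \<le> j \<and> j \<le> k (n + length w))" for n w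
    by (auto simp: edge_path_def nth_append less_Suc_eq all_conj_distrib)
  show ?case using snoc *[of n "u @ w"] *[of "n + length u" w] by (simp add: add.assoc)
qed (auto simp: edge_path_def)

text \<open>The bound on a \<gamma> depends on its position in the word, and exchanging an adjacent
  \<alpha> and \<beta> moves no \<gamma>.\<close>

lemma edge_path_cong:
  assumes "equivclp commute p q"
  shows "edge_path k p \<longleftrightarrow> edge_path k q"
  using assms
proof (induction rule: equivclp_induct)
  case (step y z)
  have "edge_path k y \<longleftrightarrow> edge_path k z" if "commute y z" for y z
    using that
  proof cases
    case (1 n u w)
    have "edge_path k (m, [Alpha, Beta]) \<longleftrightarrow> edge_path k (m, [Beta, Alpha])" for m
      by (auto simp: edge_path_def less_Suc_eq nth_Cons')
    with 1 show ?thesis by (simp only: edge_path_append) simp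
  qed
  with step show ?case by blast
qed simp

lemma abs_path_in_Lam [simp]: "abs_path p \<in> Lam k \<longleftrightarrow> edge_path k p"
  unfolding Lam_def image_iff abs_path_eq_iff Bex_def mem_Collect_eq
  using edge_path_cong[of p _ k] equivclp_refl[of commute p] by blast

lemma unit_path_in_Lam [simp]: "unit_path n \<in> Lam k \<longleftrightarrow> 1 \<le> n"
  by (simp add: unit_path_abs edge_path_def)

lemma rng_Lam: "\<mu> \<in> Lam k \<Longrightarrow> 1 \<le> rng \<mu>"
  by (cases \<mu>) (simp add: edge_path_def)

lemma pcomp_in_Lam [simp]:
  "rng \<nu> = src \<mu> \<Longrightarrow> pcomp \<mu> \<nu> \<in> Lam k \<longleftrightarrow> \<mu> \<in> Lam k \<and> \<nu> \<in> Lam k"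
  by (cases \<mu>; cases \<nu>) (simp add: edge_path_append)

lemma divides_in_Lam: "\<mu> \<preceq> \<nu> \<Longrightarrow> \<nu> \<in> Lam k \<Longrightarrow> \<mu> \<in> Lam k"
  by (auto simp: divides_iff)

lemma in_exts: "\<nu> \<in> Lam k \<Longrightarrow> \<nu> \<in> exts k \<mu> \<longleftrightarrow> \<mu> \<preceq> \<nu>"
  by (auto simp: exts_def divides_iff)

lemma initial_segs_eq: "\<nu> \<in> Lam k \<Longrightarrow> initial_segs k \<nu> = {\<mu>. \<mu> \<preceq> \<nu>}"
  by (auto simp: initial_segs_def in_exts divides_in_Lam)

section \<open>The boundary\<close>

text \<open>The assumption enters twice: in \<open>bdry_eq\<close> it supplies the \<gamma>'s that
  keep a maximal element away from a given finite set of paths, and in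
  \<open>weight_tendsto_0\<close> it forces the weights down to 0.\<close>

locale path_category =
  fixes k :: "nat \<Rightarrow> nat"
  assumes gammas_unbounded: "\<exists>i\<ge>n. 0 < k i"
begin

lemma Lam_star_iff:
  "x \<in> Lam_star k \<longleftrightarrow> x \<subseteq> Lam k \<and> x \<noteq> {} \<and>
     (\<forall>\<mu>\<in>x. \<forall>\<nu>\<in>x. \<exists>\<xi>\<in>x. \<mu> \<preceq> \<xi> \<and> \<nu> \<preceq> \<xi>) \<and> (\<forall>\<mu>\<in>x. \<forall>\<nu>. \<nu> \<preceq> \<mu> \<longrightarrow> \<nu> \<in> x)"
proof (cases "x \<subseteq> Lam k")
  case True
  have "directed_set k x \<longleftrightarrow> (\<forall>\<mu>\<in>x. \<forall>\<nu>\<in>x. \<exists>\<xi>\<in>x. \<mu> \<preceq> \<xi> \<and> \<nu> \<preceq> \<xi>)"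
    unfolding directed_set_def disjoint_iff using True in_exts by blast
  moreover have "hereditary_set k x \<longleftrightarrow> (\<forall>\<mu>\<in>x. \<forall>\<nu>. \<nu> \<preceq> \<mu> \<longrightarrow> \<nu> \<in> x)"
    unfolding hereditary_set_def using True initial_segs_eq by blast
  ultimately show ?thesis by (simp add: Lam_star_def)
qed (simp add: Lam_star_def)

lemma Lam_star_in_Lam: "x \<in> Lam_star k \<Longrightarrow> \<mu> \<in> x \<Longrightarrow> \<mu> \<in> Lam k"
  by (auto simp: Lam_star_iff)

lemma Lam_star_directed:
  assumes "x \<in> Lam_star k" "\<mu> \<in> x" "\<nu> \<in> x"
  obtains \<xi> where "\<xi> \<in> x" "\<mu> \<preceq> \<xi>" "\<nu> \<preceq> \<xi>"
proof -
  have "\<exists>\<xi>\<in>x. \<mu> \<preceq> \<xi> \<and> \<nu> \<preceq> \<xi>" using assms by (simp add: Lam_star_iff)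
  with that show ?thesis by blast
qed

lemma Lam_star_hereditary: "x \<in> Lam_star k \<Longrightarrow> \<mu> \<in> x \<Longrightarrow> \<nu> \<preceq> \<mu> \<Longrightarrow> \<nu> \<in> x"
  by (auto simp: Lam_star_iff)

lemma rng_of_eq:
  assumes "x \<in> Lam_star k" "\<mu> \<in> x"
  shows "rng_of x = rng \<mu>"
  unfolding rng_of_def
proof (rule the_equality)
  show "\<forall>\<nu>\<in>x. rng \<nu> = rng \<mu>"
    using Lam_star_directed[OF assms] by (metis divides_def)
qed (use assms in auto)

lemma Lam_star_nonempty: "x \<in> Lam_star k \<Longrightarrow> \<exists>\<mu>. \<mu> \<in> x"
  by (auto simp: Lam_star_iff)

lemma unit_in_Lam_star: "x \<in> Lam_star k \<Longrightarrow> unit_path (rng_of x) \<in> x"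
  by (metis Lam_star_nonempty Lam_star_hereditary rng_of_eq unit_divides)

lemma down_in_Lam_star: "\<mu> \<in> Lam k \<Longrightarrow> {\<nu>. \<nu> \<preceq> \<mu>} \<in> Lam_star k"
  by (auto simp: Lam_star_iff divides_in_Lam intro: divides_trans divides_refl)

text \<open>These are the infinite paths; by \<open>bdry_eq\<close> they are exactly the boundary
  points.\<close>

definition unbounded :: "path set \<Rightarrow> bool" where
  "unbounded x \<longleftrightarrow> (\<forall>N. \<exists>\<mu>\<in>x. N \<le> src \<mu>)"

lemma maximal_extension:
  assumes "x \<in> Lam_star k"
  obtains y where "y \<in> Lam_star_star k" "x \<subseteq> y"
proof -
  let ?A = "{y \<in> Lam_star k. x \<subseteq> y}"
  have "\<exists>M\<in>?A. \<forall>X\<in>?A. M \<subseteq> X \<longrightarrow> X = M"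
  proof (rule subset_Zorn_nonempty)
    show "?A \<noteq> {}" using assms by blast
    fix C assume C: "C \<noteq> {}" "subset.chain ?A C"
    then have sub: "y \<in> Lam_star k \<and> x \<subseteq> y" if "y \<in> C" for y
      using that by (auto simp: subset.chain_def)
    have "\<exists>\<xi>\<in>\<Union>C. \<mu> \<preceq> \<xi> \<and> \<nu> \<preceq> \<xi>" if mn: "\<mu> \<in> \<Union>C" "\<nu> \<in> \<Union>C" for \<mu> \<nu>
    proof -
      obtain y z where yz: "y \<in> C" "\<mu> \<in> y" "z \<in> C" "\<nu> \<in> z" using mn by blast
      with C(2) have "y \<subseteq> z \<or> z \<subseteq> y" by (auto simp: subset_chain_def)
      then obtain w where w: "w \<in> C" "\<mu> \<in> w" "\<nu> \<in> w"
      proof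
        assume "y \<subseteq> z"
        with yz show ?thesis by (intro that[of z]) auto
      next
        assume "z \<subseteq> y"
        with yz show ?thesis by (intro that[of y]) auto
      qed
      obtain \<xi> where "\<xi> \<in> w" "\<mu> \<preceq> \<xi>" "\<nu> \<preceq> \<xi>"
        using Lam_star_directed[OF _ w(2,3)] sub[OF w(1)] by blast
      then show ?thesis using w(1) by (intro bexI[of _ \<xi>]) auto
    qed
    moreover have "\<forall>\<mu>\<in>\<Union>C. \<forall>\<nu>. \<nu> \<preceq> \<mu> \<longrightarrow> \<nu> \<in> \<Union>C"
      using sub Lam_star_hereditary by blast
    moreover have "\<Union>C \<subseteq> Lam k" "\<Union>C \<noteq> {}" "x \<subseteq> \<Union>C"
      using sub C(1) Lam_star_in_Lam Lam_star_nonempty by blast+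
    ultimately show "\<Union>C \<in> ?A" by (auto simp: Lam_star_iff)
  qed
  then obtain y where "y \<in> ?A" "\<forall>z\<in>?A. y \<subseteq> z \<longrightarrow> z = y" by blast
  then show ?thesis using that[of y] by (auto simp: Lam_star_star_def)
qed

text \<open>\<open>U\<close> contains the trace on \<open>X\<close> of a basic neighbourhood of
  \<open>x\<close>. \<open>F\<close> may contain paths outside \<open>Lam k\<close>: they lie in no
  point, and allowing them lets \<open>F\<close> be transported along paths without side
  conditions.\<close>

definition nbhd :: "path set set \<Rightarrow> path set set \<Rightarrow> path set \<Rightarrow> bool" where
  "nbhd X U x \<longleftrightarrow> (\<exists>\<mu> F. \<mu> \<in> x \<and> finite F \<and> F \<inter> x = {} \<and> (\<forall>y\<in>X. \<mu> \<in> y \<and> F \<inter> y = {} \<longrightarrow> y \<in> U))"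

lemma nbhdI:
  "\<mu> \<in> x \<Longrightarrow> finite F \<Longrightarrow> F \<inter> x = {} \<Longrightarrow> (\<And>y. y \<in> X \<Longrightarrow> \<mu> \<in> y \<Longrightarrow> F \<inter> y = {} \<Longrightarrow> y \<in> U) \<Longrightarrow> nbhd X U x"
  unfolding nbhd_def by (intro exI[of _ \<mu>] exI[of _ F]) simp

lemma nbhdE:
  assumes "nbhd X U x"
  obtains \<mu> F where "\<mu> \<in> x" "finite F" "F \<inter> x = {}" "\<And>y. y \<in> X \<Longrightarrow> \<mu> \<in> y \<Longrightarrow> F \<inter> y = {} \<Longrightarrow> y \<in> U"
proof -
  from assms obtain \<mu> F where "\<mu> \<in> x" "finite F" "F \<inter> x = {}" "\<forall>y\<in>X. \<mu> \<in> y \<and> F \<inter> y = {} \<longrightarrow> y \<in> U"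
    unfolding nbhd_def by (elim exE conjE)
  then show ?thesis using that[of \<mu> F] by simp
qed

lemma nbhd_mono: "nbhd X U x \<Longrightarrow> U \<subseteq> V \<Longrightarrow> nbhd X V x"
  unfolding nbhd_def by (meson subsetD)

lemma nbhd_Int:
  assumes "nbhd X U x" "nbhd X V x" "X \<subseteq> Lam_star k" "x \<in> X"
  shows "nbhd X (U \<inter> V) x"
proof -
  obtain \<mu> F where a: "\<mu> \<in> x" "finite F" "F \<inter> x = {}" "\<And>y. y \<in> X \<Longrightarrow> \<mu> \<in> y \<Longrightarrow> F \<inter> y = {} \<Longrightarrow> y \<in> U"
    by (rule nbhdE[OF assms(1)]) (rule that)
  obtain \<nu> H where b: "\<nu> \<in> x" "finite H" "H \<inter> x = {}" "\<And>y. y \<in> X \<Longrightarrow> \<nu> \<in> y \<Longrightarrow> H \<inter> y = {} \<Longrightarrow> y \<in> V"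
    by (rule nbhdE[OF assms(2)]) (rule that)
  obtain \<xi> where xi: "\<xi> \<in> x" "\<mu> \<preceq> \<xi>" "\<nu> \<preceq> \<xi>"
    using Lam_star_directed[OF _ a(1) b(1)] assms(3,4) by blast
  show ?thesis
  proof (rule nbhdI[of \<xi> x "F \<union> H"])
    fix y assume y: "y \<in> X" "\<xi> \<in> y" "(F \<union> H) \<inter> y = {}"
    then have "\<mu> \<in> y" "\<nu> \<in> y" using Lam_star_hereditary assms(3) xi by blast+
    with y show "y \<in> U \<inter> V" by (intro IntI a(4) b(4)) auto
  qed (use a b xi in auto)
qed

lemma openin_Lam_star_top:
  "openin (Lam_star_top k) U \<longleftrightarrow> U \<subseteq> Lam_star k \<and> (\<forall>x\<in>U. nbhd (Lam_star k) U x)"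
    (is "_ \<longleftrightarrow> ?R U")
proof
  let ?S = "{Zset k \<mu> - (\<Union>\<nu>\<in>F. Zset k \<nu>) | \<mu> F. \<mu> \<in> Lam k \<and> finite F \<and> F \<subseteq> Lam k}"
  show "?R U" if "openin (Lam_star_top k) U"
    using that unfolding Lam_star_top_def openin_topology_generated_by_iff
  proof (induction rule: generate_topology_on.induct)
    case (Int a b)
    then show ?case by (auto intro!: nbhd_Int)
  next
    case (UN K)
    have "nbhd (Lam_star k) (\<Union>K) x" if "V \<in> K" "x \<in> V" for x V
      using nbhd_mono[of "Lam_star k" V x "\<Union>K"] UN.IH that by blast
    moreover have "\<Union>K \<subseteq> Lam_star k" using UN.IH by blast
    ultimately show ?case by blast
  next
    case (Basis s)
    then obtain \<mu> F where s: "s = Zset k \<mu> - (\<Union>\<nu>\<in>F. Zset k \<nu>)" "finite F" by blast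
    then have "nbhd (Lam_star k) s x" if "x \<in> s" for x
      using that by (intro nbhdI[of \<mu> x F]) (auto simp: Zset_def)
    then show ?case using s by (auto simp: Zset_def)
  qed simp
  show "openin (Lam_star_top k) U" if *: "?R U"
  proof -
    have "U = \<Union>{B \<in> ?S. B \<subseteq> U}"
    proof
      show "U \<subseteq> \<Union>{B \<in> ?S. B \<subseteq> U}"
      proof
        fix x assume x: "x \<in> U"
        with * have xL: "x \<in> Lam_star k" and nb: "nbhd (Lam_star k) U x" by auto
        obtain \<mu> F where F: "\<mu> \<in> x" "finite F" "F \<inter> x = {}"
          "\<And>y. y \<in> Lam_star k \<Longrightarrow> \<mu> \<in> y \<Longrightarrow> F \<inter> y = {} \<Longrightarrow> y \<in> U"
          by (rule nbhdE[OF nb]) (rule that)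
        let ?B = "Zset k \<mu> - (\<Union>\<nu>\<in>F \<inter> Lam k. Zset k \<nu>)"
        have "\<mu> \<in> Lam k" using Lam_star_in_Lam xL F(1) .
        with F(2) have S: "?B \<in> ?S"
          by (intro CollectI exI[of _ \<mu>] exI[of _ "F \<inter> Lam k"]) simp
        have BU: "?B \<subseteq> U"
        proof
          fix y assume "y \<in> ?B"
          then have y: "y \<in> Lam_star k" "\<mu> \<in> y" "F \<inter> Lam k \<inter> y = {}"
            by (auto simp: Zset_def)
          moreover have "y \<subseteq> Lam k" using y(1) by (simp add: Lam_star_iff)
          ultimately show "y \<in> U" by (intro F(4)) auto
        qed
        have "x \<in> ?B"
          using xL F(1,3) by (auto simp: Zset_def)
        then show "x \<in> \<Union>{B \<in> ?S. B \<subseteq> U}" using S BU by (intro UnionI[of ?B]) simp_all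
      qed
    qed blast
    moreover have "generate_topology_on ?S (\<Union>{B \<in> ?S. B \<subseteq> U})"
      by (rule generate_topology_on.UN, rule generate_topology_on.Basis) (simp only: mem_Collect_eq)
    ultimately have "generate_topology_on ?S U" by (rule ssubst)
    then show ?thesis
      unfolding Lam_star_top_def openin_topology_generated_by_iff .
  qed
qed

lemma topspace_Lam_star_top: "topspace (Lam_star_top k) = Lam_star k"
proof
  show "topspace (Lam_star_top k) \<subseteq> Lam_star k"
    using openin_Lam_star_top by blast
  have "nbhd (Lam_star k) (Lam_star k) x" if x: "x \<in> Lam_star k" for x
    by (rule nbhdI[OF unit_in_Lam_star[OF x], of "{}"]) auto
  then have "openin (Lam_star_top k) (Lam_star k)"
    unfolding openin_Lam_star_top by blast
  then show "Lam_star k \<subseteq> topspace (Lam_star_top k)" by (rule openin_subset)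
qed

definition letters :: "nat \<Rightarrow> letter set" where
  "letters n = {Alpha, Beta} \<union> Gam ` {1..k n}"

definition edges :: "nat \<Rightarrow> path set" where
  "edges n = (\<lambda>l. abs_path (n, [l])) ` letters n"

lemma finite_edges: "finite (edges n)"
  by (simp add: edges_def letters_def)

lemma edges_subset: "1 \<le> n \<Longrightarrow> edges n \<subseteq> Lam k"
  by (auto simp: edges_def letters_def edge_path_def)

lemma rng_edges: "\<epsilon> \<in> edges n \<Longrightarrow> rng \<epsilon> = n" and src_edges: "\<epsilon> \<in> edges n \<Longrightarrow> src \<epsilon> = Suc n"
  by (auto simp: edges_def)

lemma edge_exists:
  assumes "\<mu> \<in> Lam k" "src \<mu> \<noteq> rng \<mu>"
  shows "\<exists>\<epsilon>\<in>edges (rng \<mu>). \<epsilon> \<preceq> \<mu>"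
proof -
  obtain n w where w: "\<mu> = abs_path (n, w)" by (cases \<mu>)
  with assms obtain l v where v: "w = l # v" by (cases w) auto
  have "l \<in> letters n"
    using assms(1) w v by (cases l) (auto simp: letters_def edge_path_def)
  then have "abs_path (n, [l]) \<in> edges (rng \<mu>)" by (auto simp: edges_def w)
  moreover have "abs_path (n, [l]) \<preceq> \<mu>" by (simp add: divides_def w v)
  ultimately show ?thesis by blast
qed

text \<open>Directedness merges \<open>\<mu>\<close> with a long member of \<open>x\<close>, and
  truncating what follows \<open>\<mu>\<close> reaches any prescribed level.\<close>

lemma extension_at_level:
  assumes "x \<in> Lam_star k" "unbounded x" "\<mu> \<in> x" "src \<mu> \<le> i"
  obtains \<kappa> where "\<kappa> \<in> x" "\<mu> \<preceq> \<kappa>" "src \<kappa> = i"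
proof -
  obtain \<nu> where nu: "\<nu> \<in> x" "i \<le> src \<nu>" using assms(2) unfolding unbounded_def by blast
  obtain \<xi> where xi: "\<xi> \<in> x" "\<mu> \<preceq> \<xi>" "\<nu> \<preceq> \<xi>" using Lam_star_directed[OF assms(1,3) nu(1)] .
  then obtain \<zeta> where z: "rng \<zeta> = src \<mu>" "\<xi> = pcomp \<mu> \<zeta>" by (auto simp: divides_iff)
  then obtain u where u: "\<zeta> = abs_path (src \<mu>, u)" by (cases \<zeta>) auto
  let ?\<eta> = "abs_path (src \<mu>, take (i - src \<mu>) u)"
  have "i \<le> src \<xi>" using nu(2) divides_src_le[OF xi(3)] by simp
  then have "src (pcomp \<mu> ?\<eta>) = i" using assms(4) z by (auto simp: u min_def)
  moreover have "?\<eta> \<preceq> \<zeta>"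
    unfolding divides_iff u
    by (rule exI[of _ "abs_path (src ?\<eta>, drop (i - src \<mu>) u)"]) simp
  then have "pcomp \<mu> ?\<eta> \<preceq> \<xi>" using z u by simp
  then have "pcomp \<mu> ?\<eta> \<in> x" using Lam_star_hereditary assms(1) xi(1) by blast
  ultimately show ?thesis using that divides_pcomp by blast
qed

text \<open>A bounded \<open>x\<close> has a longest member, and a neighbourhood that forbids its
  finitely many one-edge extensions contains no maximal element. Conversely, every basic
  neighbourhood of an unbounded \<open>x\<close> contains a maximal element, obtained by leaving
  \<open>x\<close> along a \<gamma> at a sufficiently high level.\<close>

lemma bdry_eq: "bdry k = {x \<in> Lam_star k. unbounded x}"
proof (intro equalityI subsetI)
  fix x assume x: "x \<in> bdry k"
  then have xL: "x \<in> Lam_star k"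
    by (auto simp: bdry_def in_closure_of topspace_Lam_star_top)
  have "unbounded x"
  proof (rule ccontr)
    assume "\<not> unbounded x"
    then obtain N where N: "\<And>\<mu>. \<mu> \<in> x \<Longrightarrow> src \<mu> < N"
      unfolding unbounded_def by (meson not_le)
    obtain \<mu>\<^sub>0 where "\<mu>\<^sub>0 \<in> x" using Lam_star_nonempty[OF xL] by blast
    then obtain \<mu> where mu: "\<mu> \<in> x" "\<And>\<nu>. \<nu> \<in> x \<Longrightarrow> src \<nu> \<le> src \<mu>"
      using ex_has_greatest_nat[of "\<lambda>\<mu>. \<mu> \<in> x" \<mu>\<^sub>0 src N] N less_imp_le by blast
    have mL: "\<mu> \<in> Lam k" using Lam_star_in_Lam xL mu(1) .
    then have s1: "1 \<le> src \<mu>" using rng_Lam[OF mL] rng_le_src[of \<mu>] by linarith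
    let ?F = "pcomp \<mu> ` edges (src \<mu>)"
    \<comment> \<open>Any \<open>y\<close> in this set consists of divisors of \<open>\<mu>\<close>
      only, since a longer member above \<open>\<mu>\<close> would begin, after
      \<open>\<mu>\<close>, with a forbidden edge.\<close>
    let ?U = "{y \<in> Lam_star k. \<mu> \<in> y \<and> ?F \<inter> y = {}}"
    have "pcomp \<mu> \<epsilon> \<notin> x" if "\<epsilon> \<in> edges (src \<mu>)" for \<epsilon>
      using mu(2)[of "pcomp \<mu> \<epsilon>"] rng_edges[OF that] src_edges[OF that] by auto
    then have xU: "x \<in> ?U" using xL mu(1) by auto
    have "nbhd (Lam_star k) ?U y" if "y \<in> ?U" for y
      using that by (intro nbhdI[of \<mu> y ?F]) (simp_all add: finite_edges)
    then have oU: "openin (Lam_star_top k) ?U"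
      unfolding openin_Lam_star_top by (simp only: Collect_subset ball_simps) simp
    have cl: "\<exists>y\<in>Lam_star_star k. y \<in> U" if "x \<in> U" "openin (Lam_star_top k) U" for U
      using x that unfolding bdry_def in_closure_of by (simp add: Bex_def)
    from cl[OF xU oU] obtain y where "y \<in> Lam_star_star k" "y \<in> ?U" by (rule bexE)
    then have y: "y \<in> Lam_star_star k" "\<mu> \<in> y" "?F \<inter> y = {}" by simp_all
    have yL: "y \<in> Lam_star k" and my: "\<mu> \<in> y" using y(1,2) by (auto simp: Lam_star_star_def)
    have y_sub: "\<nu> \<preceq> \<mu>" if ny: "\<nu> \<in> y" for \<nu>
    proof -
      obtain \<xi> where xi: "\<xi> \<in> y" "\<mu> \<preceq> \<xi>" "\<nu> \<preceq> \<xi>"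
        using Lam_star_directed[OF yL my ny] .
      then obtain \<zeta> where z: "rng \<zeta> = src \<mu>" "\<xi> = pcomp \<mu> \<zeta>" by (auto simp: divides_iff)
      have "src \<zeta> = rng \<zeta>"
      proof (rule ccontr)
        assume "src \<zeta> \<noteq> rng \<zeta>"
        moreover have "\<zeta> \<in> Lam k" using Lam_star_in_Lam[OF yL xi(1)] z by simp
        ultimately obtain \<epsilon> where e: "\<epsilon> \<in> edges (src \<mu>)" "\<epsilon> \<preceq> \<zeta>" using edge_exists z(1) by metis
        then have "pcomp \<mu> \<epsilon> \<preceq> \<xi>" using z by (simp add: rng_edges)
        then have "pcomp \<mu> \<epsilon> \<in> y" using Lam_star_hereditary[OF yL xi(1)] by blast
        with y(3) e(1) show False by blast
      qed
      with z xi show ?thesis by (metis path_trivial pcomp_unit(1))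
    qed
    \<comment> \<open>Any edge at \<open>src \<mu>\<close> gives a proper extension of
      \<open>y\<close>; \<alpha> is available at every level.\<close>
    let ?\<epsilon> = "abs_path (src \<mu>, [Alpha])"
    have "{\<nu>. \<nu> \<preceq> pcomp \<mu> ?\<epsilon>} \<in> Lam_star k"
      using mL s1 by (intro down_in_Lam_star) (simp add: edge_path_def)
    moreover have "y \<subseteq> {\<nu>. \<nu> \<preceq> pcomp \<mu> ?\<epsilon>}"
      using y_sub divides_trans divides_pcomp by blast
    ultimately have "{\<nu>. \<nu> \<preceq> pcomp \<mu> ?\<epsilon>} = y" using y(1) by (auto simp: Lam_star_star_def)
    then have "pcomp \<mu> ?\<epsilon> \<in> y" by auto
    then have "src (pcomp \<mu> ?\<epsilon>) \<le> src \<mu>" using y_sub divides_src_le by blast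
    then show False by simp
  qed
  with xL show "x \<in> {x \<in> Lam_star k. unbounded x}" by blast
next
  fix x assume "x \<in> {x \<in> Lam_star k. unbounded x}"
  then have xL: "x \<in> Lam_star k" and ub: "unbounded x" by auto
  show "x \<in> bdry k"
    unfolding bdry_def in_closure_of topspace_Lam_star_top
  proof (intro conjI xL allI impI)
    fix U assume U: "x \<in> U \<and> openin (Lam_star_top k) U"
    then have nb: "nbhd (Lam_star k) U x" by (simp add: openin_Lam_star_top)
    obtain \<mu> F where F: "\<mu> \<in> x" "finite F" "F \<inter> x = {}"
      "\<And>y. y \<in> Lam_star k \<Longrightarrow> \<mu> \<in> y \<Longrightarrow> F \<inter> y = {} \<Longrightarrow> y \<in> U"
      by (rule nbhdE[OF nb]) (rule that)
    obtain N where N: "\<And>\<nu>. \<nu> \<in> F \<Longrightarrow> src \<nu> \<le> N"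
      using finite_nat_set_iff_bounded_le[of "src ` F"] F(2) by auto
    \<comment> \<open>The level lies beyond all of \<open>F\<close>, so that
      \<open>divides_below_gamma\<close> applies: a member of \<open>F\<close> compatible with
      \<open>?\<gamma>\<close> would divide \<open>\<kappa>\<close> and hence lie in
      \<open>x\<close>.\<close>
    obtain i where i: "i \<ge> max N (src \<mu>)" "0 < k i" using gammas_unbounded by blast
    then obtain \<kappa> where l: "\<kappa> \<in> x" "\<mu> \<preceq> \<kappa>" "src \<kappa> = i"
      using extension_at_level[OF xL ub F(1), of i] by auto
    let ?\<gamma> = "pcomp \<kappa> (abs_path (src \<kappa>, [Gam 1]))"
    have lL: "\<kappa> \<in> Lam k" using Lam_star_in_Lam xL l(1) .
    then have "1 \<le> src \<kappa>" using rng_Lam[OF lL] rng_le_src[of \<kappa>] by linarith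
    then have gL: "?\<gamma> \<in> Lam k" using lL i(2) l(3) by (simp add: edge_path_def)
    obtain y where y: "y \<in> Lam_star_star k" "{\<nu>. \<nu> \<preceq> ?\<gamma>} \<subseteq> y"
      by (rule maximal_extension[OF down_in_Lam_star[OF gL]])
    then have yL: "y \<in> Lam_star k" by (simp add: Lam_star_star_def)
    have "\<mu> \<preceq> ?\<gamma>" using l(2) divides_pcomp divides_trans by blast
    then have my: "\<mu> \<in> y" using y(2) by blast
    have gy: "?\<gamma> \<in> y" using y(2) by auto
    have "\<nu> \<notin> y" if "\<nu> \<in> F" for \<nu>
    proof
      assume "\<nu> \<in> y"
      then obtain \<xi> where "\<nu> \<preceq> \<xi>" "?\<gamma> \<preceq> \<xi>" using Lam_star_directed[OF yL _ gy] by blast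
      moreover have "src \<nu> \<le> src \<kappa>" using N[OF that] i(1) l(3) by simp
      ultimately have "\<nu> \<preceq> \<kappa>" using divides_below_gamma by blast
      then have "\<nu> \<in> x" using Lam_star_hereditary xL l(1) by blast
      with that F(3) show False by blast
    qed
    then have "y \<in> U" using F(4)[OF yL my] by blast
    with y(1) show "\<exists>y. y \<in> Lam_star_star k \<and> y \<in> U" by blast
  qed
qed

section \<open>The action of paths on the boundary\<close>

lemma bdry_at_iff: "x \<in> bdry_at k n \<longleftrightarrow> x \<in> Lam_star k \<and> unbounded x \<and> rng_of x = n"
  by (auto simp: bdry_at_def bdry_eq)

lemma bdry_at_Lam_star: "x \<in> bdry_at k n \<Longrightarrow> x \<in> Lam_star k"
  by (simp add: bdry_at_iff)

lemma bdry_at_rng: "x \<in> bdry_at k n \<Longrightarrow> \<mu> \<in> x \<Longrightarrow> rng \<mu> = n"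
  using rng_of_eq by (auto simp: bdry_at_iff)

lemma bdry_at_in_Lam: "x \<in> bdry_at k n \<Longrightarrow> \<mu> \<in> x \<Longrightarrow> \<mu> \<in> Lam k"
  using Lam_star_in_Lam bdry_at_Lam_star by blast

lemma unit_in_bdry_at: "x \<in> bdry_at k n \<Longrightarrow> unit_path n \<in> x"
  using unit_in_Lam_star by (auto simp: bdry_at_iff)

lemma openin_bdry_at_top:
  "openin (bdry_at_top k n) U \<longleftrightarrow> U \<subseteq> bdry_at k n \<and> (\<forall>x\<in>U. nbhd (bdry_at k n) U x)"
proof
  assume "openin (bdry_at_top k n) U"
  then obtain V where V: "openin (Lam_star_top k) V" "U = V \<inter> bdry_at k n"
    unfolding bdry_at_top_def openin_subtopology by (elim exE conjE)
  have "nbhd (bdry_at k n) U x" if "x \<in> U" for x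
  proof -
    have nb: "nbhd (Lam_star k) V x" using V that by (simp add: openin_Lam_star_top)
    show ?thesis
    proof (rule nbhdE[OF nb])
      fix \<mu> F assume F: "\<mu> \<in> x" "finite F" "F \<inter> x = {}"
        "\<And>y. y \<in> Lam_star k \<Longrightarrow> \<mu> \<in> y \<Longrightarrow> F \<inter> y = {} \<Longrightarrow> y \<in> V"
      then show ?thesis
        by (intro nbhdI[of \<mu> x F]) (simp_all add: V(2) bdry_at_Lam_star)
    qed
  qed
  with V show "U \<subseteq> bdry_at k n \<and> (\<forall>x\<in>U. nbhd (bdry_at k n) U x)" by simp
next
  assume U: "U \<subseteq> bdry_at k n \<and> (\<forall>x\<in>U. nbhd (bdry_at k n) U x)"
  \<comment> \<open>This is the largest open subset of \<open>Lam_star k\<close> whose trace on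
    \<open>bdry_at k n\<close> lies in \<open>U\<close>.\<close>
  define V where "V = {x \<in> Lam_star k. nbhd (bdry_at k n) U x}"
  have "nbhd (Lam_star k) V x" if "x \<in> V" for x
  proof -
    have nb: "nbhd (bdry_at k n) U x" using that by (simp add: V_def)
    show ?thesis
    proof (rule nbhdE[OF nb])
      fix \<mu> F assume F: "\<mu> \<in> x" "finite F" "F \<inter> x = {}"
        "\<And>y. y \<in> bdry_at k n \<Longrightarrow> \<mu> \<in> y \<Longrightarrow> F \<inter> y = {} \<Longrightarrow> y \<in> U"
      then have "y \<in> V" if "y \<in> Lam_star k" "\<mu> \<in> y" "F \<inter> y = {}" for y
        unfolding V_def using that by (intro CollectI conjI nbhdI[of \<mu> y F]) simp_all
      with F(1-3) show ?thesis by (intro nbhdI[of \<mu> x F])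
    qed
  qed
  then have "openin (Lam_star_top k) V" by (auto simp: openin_Lam_star_top V_def)
  moreover have "U = V \<inter> bdry_at k n"
  proof (intro equalityI subsetI)
    fix x assume "x \<in> V \<inter> bdry_at k n"
    then have x: "x \<in> bdry_at k n" and nb: "nbhd (bdry_at k n) U x" by (auto simp: V_def)
    show "x \<in> U" using x by (auto intro: nbhdE[OF nb])
  qed (use U in \<open>auto simp: V_def bdry_at_Lam_star\<close>)
  ultimately show "openin (bdry_at_top k n) U"
    unfolding bdry_at_top_def openin_subtopology by (intro exI[of _ V] conjI)
qed

lemma topspace_bdry_at_top: "topspace (bdry_at_top k n) = bdry_at k n"
  by (auto simp: bdry_at_top_def topspace_Lam_star_top bdry_at_Lam_star)

lemma act_eq:
  assumes "x \<in> Lam_star k" "rng_of x = src \<eta>" "\<eta> \<in> Lam k"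
  shows "act k \<eta> x = {\<mu>. \<exists>\<nu>\<in>x. \<mu> \<preceq> pcomp \<eta> \<nu>}"
proof -
  have "initial_segs k (pcomp \<eta> \<nu>) = {\<mu>. \<mu> \<preceq> pcomp \<eta> \<nu>}" if "\<nu> \<in> x" for \<nu>
  proof (rule initial_segs_eq)
    show "pcomp \<eta> \<nu> \<in> Lam k"
      using that assms rng_of_eq Lam_star_in_Lam by simp
  qed
  then show ?thesis by (auto simp: act_def)
qed

lemma pcomp_in_act_iff:
  assumes "x \<in> Lam_star k" "rng_of x = src \<eta>" "\<eta> \<in> Lam k" "rng \<nu> = src \<eta>"
  shows "pcomp \<eta> \<nu> \<in> act k \<eta> x \<longleftrightarrow> \<nu> \<in> x"
proof
  assume "pcomp \<eta> \<nu> \<in> act k \<eta> x"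
  then obtain \<zeta> where "\<zeta> \<in> x" "pcomp \<eta> \<nu> \<preceq> pcomp \<eta> \<zeta>" using assms by (auto simp: act_eq)
  moreover from this have "rng \<zeta> = rng \<nu>" using assms(1,2,4) rng_of_eq by simp
  ultimately show "\<nu> \<in> x" using Lam_star_hereditary assms(1) by simp
next
  assume "\<nu> \<in> x"
  then show "pcomp \<eta> \<nu> \<in> act k \<eta> x"
    by (auto simp: act_eq[OF assms(1-3)] intro: divides_refl)
qed

lemma act_Lam_star:
  assumes "x \<in> Lam_star k" "rng_of x = src \<eta>" "\<eta> \<in> Lam k"
  shows "act k \<eta> x \<in> Lam_star k"
proof -
  have r: "rng \<nu> = src \<eta>" if "\<nu> \<in> x" for \<nu> using rng_of_eq assms that by simp
  have L: "pcomp \<eta> \<nu> \<in> Lam k" if "\<nu> \<in> x" for \<nu>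
    using assms Lam_star_in_Lam that r by simp
  have "act k \<eta> x \<subseteq> Lam k"
    using L divides_in_Lam by (auto simp: act_eq[OF assms])
  moreover have "act k \<eta> x \<noteq> {}"
    using pcomp_in_act_iff[OF assms, of "unit_path (src \<eta>)"] unit_in_Lam_star[OF assms(1)] assms(2)
    by auto
  moreover have "\<exists>\<xi>\<in>act k \<eta> x. \<mu> \<preceq> \<xi> \<and> \<mu>' \<preceq> \<xi>" if mm: "\<mu> \<in> act k \<eta> x" "\<mu>' \<in> act k \<eta> x" for \<mu> \<mu>'
  proof -
    obtain \<nu> \<nu>' where n: "\<nu> \<in> x" "\<mu> \<preceq> pcomp \<eta> \<nu>" "\<nu>' \<in> x" "\<mu>' \<preceq> pcomp \<eta> \<nu>'"
      using mm by (auto simp: act_eq[OF assms])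
    obtain \<xi> where xi: "\<xi> \<in> x" "\<nu> \<preceq> \<xi>" "\<nu>' \<preceq> \<xi>" by (rule Lam_star_directed[OF assms(1) n(1,3)])
    then have "\<mu> \<preceq> pcomp \<eta> \<xi>" "\<mu>' \<preceq> pcomp \<eta> \<xi>"
      using n r by (auto intro: divides_trans)
    moreover have "pcomp \<eta> \<xi> \<in> act k \<eta> x" using pcomp_in_act_iff[OF assms] r xi(1) by simp
    ultimately show ?thesis by blast
  qed
  moreover have "\<mu>' \<in> act k \<eta> x" if "\<mu> \<in> act k \<eta> x" "\<mu>' \<preceq> \<mu>" for \<mu> \<mu>'
    using that by (auto simp: act_eq[OF assms] intro: divides_trans)
  ultimately show ?thesis by (auto simp: Lam_star_iff)
qed

lemma act_bdry_at:
  assumes "\<eta> \<in> Lam k" "x \<in> bdry_at k (src \<eta>)"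
  shows "act k \<eta> x \<in> bdry_at k (rng \<eta>)"
proof -
  have x: "x \<in> Lam_star k" "rng_of x = src \<eta>" "unbounded x" using assms by (auto simp: bdry_at_iff)
  note A = act_Lam_star[OF x(1,2) assms(1)]
  have mem: "pcomp \<eta> \<nu> \<in> act k \<eta> x \<and> rng \<nu> = src \<eta>" if "\<nu> \<in> x" for \<nu>
    using that x(2) rng_of_eq[OF x(1) that] pcomp_in_act_iff[OF x(1,2) assms(1)] by simp
  have "unbounded (act k \<eta> x)"
    unfolding unbounded_def
  proof
    fix N
    obtain \<nu> where "\<nu> \<in> x" "N \<le> src \<nu>" using x(3) unfolding unbounded_def by blast
    with mem show "\<exists>\<mu>\<in>act k \<eta> x. N \<le> src \<mu>" by (intro bexI[of _ "pcomp \<eta> \<nu>"]) auto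
  qed
  moreover have "rng_of (act k \<eta> x) = rng \<eta>"
    using rng_of_eq[OF A] mem Lam_star_nonempty[OF x(1)] by fastforce
  ultimately show ?thesis using A by (simp add: bdry_at_iff)
qed

lemma act_mem_iff:
  assumes "\<eta> \<in> Lam k" "x \<in> bdry_at k (src \<eta>)"
  shows "\<mu> \<in> act k \<eta> x \<longleftrightarrow> (\<exists>\<nu>\<in>x. \<mu> \<preceq> pcomp \<eta> \<nu>)"
  using assms by (simp add: act_eq bdry_at_iff)

lemma pcomp_in_act:
  assumes "\<eta> \<in> Lam k" "x \<in> bdry_at k (src \<eta>)" "rng \<nu> = src \<eta>"
  shows "pcomp \<eta> \<nu> \<in> act k \<eta> x \<longleftrightarrow> \<nu> \<in> x"
  using assms pcomp_in_act_iff by (simp add: bdry_at_iff)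

lemma self_in_act: "\<eta> \<in> Lam k \<Longrightarrow> x \<in> bdry_at k (src \<eta>) \<Longrightarrow> \<eta> \<in> act k \<eta> x"
  using pcomp_in_act[of \<eta> x "unit_path (src \<eta>)"] unit_in_bdry_at by simp

text \<open>By directedness every member lies below a member that extends \<open>\<eta>\<close>, so
  the extensions of \<open>\<eta>\<close> determine the whole set.\<close>

lemma Lam_star_eqI:
  assumes "x \<in> Lam_star k" "y \<in> Lam_star k" "\<eta> \<in> x" "\<eta> \<in> y"
    "\<And>\<nu>. rng \<nu> = src \<eta> \<Longrightarrow> pcomp \<eta> \<nu> \<in> x \<longleftrightarrow> pcomp \<eta> \<nu> \<in> y"
  shows "x = y"
proof -
  have "\<mu> \<in> y" if x: "x \<in> Lam_star k" "\<eta> \<in> x" and y: "y \<in> Lam_star k" and m: "\<mu> \<in> x"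
    and *: "\<And>\<nu>. rng \<nu> = src \<eta> \<Longrightarrow> pcomp \<eta> \<nu> \<in> x \<Longrightarrow> pcomp \<eta> \<nu> \<in> y" for x y \<mu>
  proof -
    obtain \<xi> where xi: "\<xi> \<in> x" "\<eta> \<preceq> \<xi>" "\<mu> \<preceq> \<xi>" by (rule Lam_star_directed[OF x m])
    then have "\<xi> \<in> y" using * by (auto simp: divides_iff)
    then show ?thesis using Lam_star_hereditary y xi(3) by simp
  qed
  from this[of x y] this[of y x] assms show ?thesis by auto
qed

lemma inj_on_act:
  assumes "\<eta> \<in> Lam k"
  shows "inj_on (act k \<eta>) (bdry_at k (src \<eta>))"
proof (rule inj_onI)
  fix x y assume xy: "x \<in> bdry_at k (src \<eta>)" "y \<in> bdry_at k (src \<eta>)" "act k \<eta> x = act k \<eta> y"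
  have "\<nu> \<in> x \<longleftrightarrow> \<nu> \<in> y" if "rng \<nu> = src \<eta>" for \<nu>
    using pcomp_in_act[OF assms xy(1) that] pcomp_in_act[OF assms xy(2) that] xy(3) by simp
  then show "x = y" using xy bdry_at_rng by blast
qed

text \<open>The preimage is obtained by cancelling \<open>\<eta>\<close> from the members that it
  divides. With \<open>inj_on_act\<close> and \<open>self_in_act\<close>, this makes
  \<open>act k \<eta>\<close> a bijection onto the boundary points containing
  \<open>\<eta>\<close>.\<close>

lemma act_surj:
  assumes "y \<in> bdry_at k n" "\<eta> \<in> y"
  obtains x where "x \<in> bdry_at k (src \<eta>)" "y = act k \<eta> x"
proof -
  define x where "x = {\<nu>. rng \<nu> = src \<eta> \<and> pcomp \<eta> \<nu> \<in> y}"
  have y: "y \<in> Lam_star k" "unbounded y" using assms by (auto simp: bdry_at_iff)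
  have etaL: "\<eta> \<in> Lam k" using assms bdry_at_in_Lam by blast
  have ux: "unit_path (src \<eta>) \<in> x" using assms(2) by (simp add: x_def)
  have "x \<subseteq> Lam k"
  proof
    fix \<nu> assume "\<nu> \<in> x"
    then have "rng \<nu> = src \<eta>" "pcomp \<eta> \<nu> \<in> Lam k"
      using Lam_star_in_Lam[OF y(1)] by (simp_all add: x_def)
    then show "\<nu> \<in> Lam k" by simp
  qed
  moreover have "\<exists>\<xi>\<in>x. \<mu> \<preceq> \<xi> \<and> \<nu> \<preceq> \<xi>" if mn: "\<mu> \<in> x" "\<nu> \<in> x" for \<mu> \<nu>
  proof -
    have m: "pcomp \<eta> \<mu> \<in> y" "rng \<mu> = src \<eta>" and n: "pcomp \<eta> \<nu> \<in> y" "rng \<nu> = src \<eta>"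
      using mn by (simp_all add: x_def)
    obtain \<xi> where xi: "\<xi> \<in> y" "pcomp \<eta> \<mu> \<preceq> \<xi>" "pcomp \<eta> \<nu> \<preceq> \<xi>"
      by (rule Lam_star_directed[OF y(1) m(1) n(1)])
    have "\<eta> \<preceq> \<xi>" by (rule divides_trans[OF divides_pcomp xi(2)])
    then obtain \<zeta> where z: "rng \<zeta> = src \<eta>" "\<xi> = pcomp \<eta> \<zeta>" by (auto simp: divides_iff)
    have "\<mu> \<preceq> \<zeta>" "\<nu> \<preceq> \<zeta>" using xi(2,3) z m(2) n(2) by simp_all
    moreover have "\<zeta> \<in> x" using xi(1) z by (simp add: x_def)
    ultimately show ?thesis by (intro bexI[of _ \<zeta>] conjI)
  qed
  moreover have "\<nu> \<in> x" if mn: "\<mu> \<in> x" "\<nu> \<preceq> \<mu>" for \<mu> \<nu>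
  proof -
    have r: "rng \<nu> = rng \<mu>" "rng \<mu> = src \<eta>" using mn by (simp_all add: x_def divides_def)
    have "pcomp \<eta> \<mu> \<in> y" using mn by (simp add: x_def)
    then have "pcomp \<eta> \<nu> \<in> y"
      using mn(2) r by (auto intro: Lam_star_hereditary[OF y(1) _])
    with r show ?thesis by (simp add: x_def)
  qed
  moreover have "x \<noteq> {}" using ux by blast
  ultimately have xL: "x \<in> Lam_star k" unfolding Lam_star_iff by (intro conjI ballI allI impI)
  have "unbounded x"
    unfolding unbounded_def
  proof
    fix N
    obtain \<kappa> where ka: "\<kappa> \<in> y" "\<eta> \<preceq> \<kappa>" "src \<kappa> = max N (src \<eta>)"
      by (rule extension_at_level[OF y assms(2) max.cobounded2])
    then obtain \<nu> where "rng \<nu> = src \<eta>" "\<kappa> = pcomp \<eta> \<nu>" by (auto simp: divides_iff)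
    with ka show "\<exists>\<mu>\<in>x. N \<le> src \<mu>" by (intro bexI[of _ \<nu>]) (auto simp: x_def)
  qed
  with xL ux have x: "x \<in> bdry_at k (src \<eta>)" using rng_of_eq by (simp add: bdry_at_iff)
  have "y = act k \<eta> x"
  proof (rule Lam_star_eqI[OF y(1) _ assms(2)])
    show "act k \<eta> x \<in> Lam_star k" using act_bdry_at[OF etaL x] by (rule bdry_at_Lam_star)
    show "\<eta> \<in> act k \<eta> x" using self_in_act etaL x by blast
    fix \<nu> assume "rng \<nu> = src \<eta>"
    then show "pcomp \<eta> \<nu> \<in> y \<longleftrightarrow> pcomp \<eta> \<nu> \<in> act k \<eta> x"
      using pcomp_in_act[OF etaL x] by (simp add: x_def)
  qed
  with x show ?thesis by (rule that)
qed

lemma act_pcomp: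
  assumes "\<mu> \<in> Lam k" "\<eta> \<in> Lam k" "rng \<eta> = src \<mu>" "x \<in> bdry_at k (src \<eta>)"
  shows "act k (pcomp \<mu> \<eta>) x = act k \<mu> (act k \<eta> x)"
proof -
  have e: "act k \<eta> x \<in> bdry_at k (src \<mu>)" using act_bdry_at assms by metis
  have x: "x \<in> bdry_at k (src (pcomp \<mu> \<eta>))" using assms by simp
  have L: "pcomp \<mu> \<eta> \<in> Lam k" using assms by simp
  show ?thesis
  proof (rule Lam_star_eqI[of _ _ "pcomp \<mu> \<eta>"])
    show "act k (pcomp \<mu> \<eta>) x \<in> Lam_star k" using act_bdry_at[OF L x] by (rule bdry_at_Lam_star)
    show "act k \<mu> (act k \<eta> x) \<in> Lam_star k" using act_bdry_at[OF assms(1) e] by (rule bdry_at_Lam_star)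
    show "pcomp \<mu> \<eta> \<in> act k (pcomp \<mu> \<eta>) x" using self_in_act L x by blast
    show "pcomp \<mu> \<eta> \<in> act k \<mu> (act k \<eta> x)"
      using pcomp_in_act[OF assms(1) e assms(3)] self_in_act[OF assms(2,4)] by simp
    fix \<nu> assume r: "rng \<nu> = src (pcomp \<mu> \<eta>)"
    have "pcomp (pcomp \<mu> \<eta>) \<nu> \<in> act k \<mu> (act k \<eta> x) \<longleftrightarrow> \<nu> \<in> x"
      using r assms pcomp_in_act[OF assms(1) e, of "pcomp \<eta> \<nu>"] pcomp_in_act[OF assms(2,4), of \<nu>]
      by (simp add: pcomp_assoc)
    then show "pcomp (pcomp \<mu> \<eta>) \<nu> \<in> act k (pcomp \<mu> \<eta>) x \<longleftrightarrow>
               pcomp (pcomp \<mu> \<eta>) \<nu> \<in> act k \<mu> (act k \<eta> x)"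
      using pcomp_in_act[OF L x r] by simp
  qed
qed

text \<open>The cases are whether \<open>\<mu>\<close> and \<open>\<eta>\<close> have a common
  multiple; if so, \<open>\<theta>\<close> comes from \<open>quotient_exists\<close>. Each case
  describes both the preimage of a cylinder under \<open>act k \<eta>\<close> and its intersection
  with the image, so that their masses can be compared.\<close>

lemma act_vimage_cases:
  assumes "\<eta> \<in> Lam k"
  shows "(\<forall>x\<in>bdry_at k (src \<eta>). \<mu> \<notin> act k \<eta> x) \<and> (\<forall>y\<in>Lam_star k. \<mu> \<in> y \<longrightarrow> \<eta> \<notin> y) \<or>
    (\<exists>\<theta>. rng \<theta> = src \<eta> \<and> (\<forall>x\<in>bdry_at k (src \<eta>). \<mu> \<in> act k \<eta> x \<longleftrightarrow> \<theta> \<in> x) \<and>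
         (\<forall>y\<in>Lam_star k. \<mu> \<in> y \<and> \<eta> \<in> y \<longleftrightarrow> pcomp \<eta> \<theta> \<in> y))"
proof (cases "\<exists>\<zeta>. rng \<zeta> = src \<eta> \<and> \<mu> \<preceq> pcomp \<eta> \<zeta>")
  case True
  then obtain \<zeta> where "\<mu> \<preceq> pcomp \<eta> \<zeta>" "rng \<zeta> = src \<eta>" by blast
  then obtain \<theta> where t: "rng \<theta> = src \<eta>"
    "\<And>\<nu>. rng \<nu> = src \<eta> \<Longrightarrow> \<mu> \<preceq> pcomp \<eta> \<nu> \<longleftrightarrow> \<theta> \<preceq> \<nu>"
    "\<And>\<xi>. \<mu> \<preceq> \<xi> \<and> \<eta> \<preceq> \<xi> \<longleftrightarrow> pcomp \<eta> \<theta> \<preceq> \<xi>"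
    using quotient_exists by metis
  have "\<mu> \<in> act k \<eta> x \<longleftrightarrow> \<theta> \<in> x" if x: "x \<in> bdry_at k (src \<eta>)" for x
  proof -
    have "\<mu> \<in> act k \<eta> x \<longleftrightarrow> (\<exists>\<nu>\<in>x. \<theta> \<preceq> \<nu>)"
      using act_mem_iff[OF assms x] t(2) bdry_at_rng[OF x] by simp
    also have "\<dots> \<longleftrightarrow> \<theta> \<in> x"
      using Lam_star_hereditary[OF bdry_at_Lam_star[OF x]] divides_refl by metis
    finally show ?thesis .
  qed
  moreover have "\<mu> \<in> y \<and> \<eta> \<in> y \<longleftrightarrow> pcomp \<eta> \<theta> \<in> y" if y: "y \<in> Lam_star k" for y
  proof
    assume "\<mu> \<in> y \<and> \<eta> \<in> y"
    then obtain \<xi> where "\<xi> \<in> y" "\<mu> \<preceq> \<xi>" "\<eta> \<preceq> \<xi>" using Lam_star_directed[OF y] by blast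
    then show "pcomp \<eta> \<theta> \<in> y" using t(3) Lam_star_hereditary[OF y] by blast
  next
    assume "pcomp \<eta> \<theta> \<in> y"
    then show "\<mu> \<in> y \<and> \<eta> \<in> y" using t(3)[of "pcomp \<eta> \<theta>"] Lam_star_hereditary[OF y] by auto
  qed
  ultimately show ?thesis using t(1) by blast
next
  case False
  have "\<mu> \<notin> act k \<eta> x" if x: "x \<in> bdry_at k (src \<eta>)" for x
    using False act_mem_iff[OF assms x] bdry_at_rng[OF x] by blast
  moreover have "\<eta> \<notin> y" if y: "y \<in> Lam_star k" "\<mu> \<in> y" for y
  proof
    assume "\<eta> \<in> y"
    then obtain \<xi> where "\<mu> \<preceq> \<xi>" "\<eta> \<preceq> \<xi>" using Lam_star_directed[OF y] by blast
    with False show False by (auto simp: divides_iff[of \<eta>])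
  qed
  ultimately show ?thesis by blast
qed

lemma open_act:
  assumes "\<eta> \<in> Lam k" "openin (bdry_at_top k (src \<eta>)) U"
  shows "openin (bdry_at_top k (rng \<eta>)) (act k \<eta> ` U)"
proof -
  have U: "U \<subseteq> bdry_at k (src \<eta>)" "\<And>x. x \<in> U \<Longrightarrow> nbhd (bdry_at k (src \<eta>)) U x"
    using assms(2) by (auto simp: openin_bdry_at_top)
  have "nbhd (bdry_at k (rng \<eta>)) (act k \<eta> ` U) (act k \<eta> x)" if xU: "x \<in> U" for x
  proof (rule nbhdE[OF U(2)[OF xU]])
    fix \<mu> F assume F: "\<mu> \<in> x" "finite F" "F \<inter> x = {}"
      "\<And>y. y \<in> bdry_at k (src \<eta>) \<Longrightarrow> \<mu> \<in> y \<Longrightarrow> F \<inter> y = {} \<Longrightarrow> y \<in> U"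
    have x: "x \<in> bdry_at k (src \<eta>)" using U(1) xU by blast
    \<comment> \<open>A path whose range differs from \<open>src \<eta>\<close> belongs to no point
      of \<open>bdry_at k (src \<eta>)\<close>, so it excludes nothing and has no composite to be
      formed.\<close>
    let ?F = "pcomp \<eta> ` {\<nu> \<in> F. rng \<nu> = src \<eta>}"
    have rm: "rng \<mu> = src \<eta>" using bdry_at_rng x F(1) .
    show ?thesis
    proof (rule nbhdI[of "pcomp \<eta> \<mu>" _ ?F])
      show "pcomp \<eta> \<mu> \<in> act k \<eta> x" using pcomp_in_act[OF assms(1) x rm] F(1) by simp
      show "?F \<inter> act k \<eta> x = {}" using pcomp_in_act[OF assms(1) x] F(3) by auto
      show "finite ?F" using F(2) by simp
      fix y assume y: "y \<in> bdry_at k (rng \<eta>)" "pcomp \<eta> \<mu> \<in> y" "?F \<inter> y = {}"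
      have "\<eta> \<in> y" using Lam_star_hereditary[OF bdry_at_Lam_star[OF y(1)] y(2)] divides_pcomp by blast
      then obtain z where z: "z \<in> bdry_at k (src \<eta>)" "y = act k \<eta> z" using act_surj[OF y(1)] by blast
      have "\<mu> \<in> z" using y(2) pcomp_in_act[OF assms(1) z(1) rm] z(2) by simp
      moreover have "\<nu> \<notin> z" if nF: "\<nu> \<in> F" for \<nu>
      proof
        assume nz: "\<nu> \<in> z"
        then have r: "rng \<nu> = src \<eta>" using bdry_at_rng z(1) by blast
        with nz have "pcomp \<eta> \<nu> \<in> y" using pcomp_in_act[OF assms(1) z(1)] z(2) by simp
        with r y(3) nF show False by blast
      qed
      ultimately have "z \<in> U" using F(4) z(1) by blast
      then show "y \<in> act k \<eta> ` U" using z(2) by blast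
    qed
  qed
  moreover have "act k \<eta> ` U \<subseteq> bdry_at k (rng \<eta>)" using U(1) act_bdry_at[OF assms(1)] by blast
  ultimately show ?thesis by (auto simp: openin_bdry_at_top)
qed

lemma continuous_act:
  assumes "\<eta> \<in> Lam k" "openin (bdry_at_top k (rng \<eta>)) V"
  shows "openin (bdry_at_top k (src \<eta>)) {x \<in> bdry_at k (src \<eta>). act k \<eta> x \<in> V}" (is "openin _ ?U")
proof -
  have V: "\<And>x. x \<in> V \<Longrightarrow> nbhd (bdry_at k (rng \<eta>)) V x"
    using assms(2) by (auto simp: openin_bdry_at_top)
  have "nbhd (bdry_at k (src \<eta>)) ?U x" if x: "x \<in> bdry_at k (src \<eta>)" "act k \<eta> x \<in> V" for x
  proof (rule nbhdE[OF V[OF x(2)]])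
    fix \<mu> F assume F: "\<mu> \<in> act k \<eta> x" "finite F" "F \<inter> act k \<eta> x = {}"
      "\<And>y. y \<in> bdry_at k (rng \<eta>) \<Longrightarrow> \<mu> \<in> y \<Longrightarrow> F \<inter> y = {} \<Longrightarrow> y \<in> V"
    obtain \<nu> where nu: "\<nu> \<in> x" "\<mu> \<preceq> pcomp \<eta> \<nu>" using F(1) act_mem_iff[OF assms(1) x(1)] by blast
    \<comment> \<open>\<open>H\<close> is empty or a singleton, according to the two cases of
      \<open>act_vimage_cases\<close>; excluding \<open>\<phi>\<close> after the action amounts to
      excluding \<open>H\<close> before it.\<close>
    have "\<exists>H. finite H \<and> (\<forall>y\<in>bdry_at k (src \<eta>). \<phi> \<in> act k \<eta> y \<longleftrightarrow> H \<inter> y \<noteq> {})" for \<phi>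
      using act_vimage_cases[OF assms(1), of \<phi>]
    proof (elim disjE exE conjE)
      assume "\<forall>x\<in>bdry_at k (src \<eta>). \<phi> \<notin> act k \<eta> x"
      then show ?thesis by (intro exI[of _ "{}"]) simp
    next
      fix \<theta> assume "\<forall>x\<in>bdry_at k (src \<eta>). \<phi> \<in> act k \<eta> x \<longleftrightarrow> \<theta> \<in> x"
      then show ?thesis by (intro exI[of _ "{\<theta>}"]) simp
    qed
    then obtain H where H: "\<And>\<phi>. finite (H \<phi>)"
      "\<And>\<phi> y. y \<in> bdry_at k (src \<eta>) \<Longrightarrow> \<phi> \<in> act k \<eta> y \<longleftrightarrow> H \<phi> \<inter> y \<noteq> {}"
      by metis
    show ?thesis
    proof (rule nbhdI[of \<nu> _ "\<Union>(H ` F)"])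
      show "\<nu> \<in> x" by (rule nu)
      show "finite (\<Union>(H ` F))" using F(2) H(1) by blast
      show "\<Union>(H ` F) \<inter> x = {}" using F(3) H(2)[OF x(1)] by blast
      fix y assume y: "y \<in> bdry_at k (src \<eta>)" "\<nu> \<in> y" "\<Union>(H ` F) \<inter> y = {}"
      then have "F \<inter> act k \<eta> y = {}" using H(2)[OF y(1)] by blast
      moreover have "\<mu> \<in> act k \<eta> y" using nu(2) y(2) act_mem_iff[OF assms(1) y(1)] by blast
      ultimately have "act k \<eta> y \<in> V" using F(4) act_bdry_at[OF assms(1) y(1)] by blast
      with y(1) show "y \<in> ?U" by blast
    qed
  qed
  then show ?thesis by (auto simp: openin_bdry_at_top)
qed

section \<open>Weights\<close>

text \<open>
  The \<open>N\<close>-th convergent of the continued fraction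
  \<open>1 / (2 + k n - 1 / (2 + k (n + 1) - \<dots>))\<close>; its value is the ratio of consecutive weights.
\<close>

fun ratio_approx :: "nat \<Rightarrow> nat \<Rightarrow> real" where
  "ratio_approx 0 n = 1"
| "ratio_approx (Suc N) n = 1 / (2 + real (k n) - ratio_approx N (Suc n))"

text \<open>A value between 0 and 1 at the next level keeps the denominator between 1 and
  \<open>2 + k n\<close>.\<close>

lemma ratio_approx_bounds: "1 / (2 + real (k n)) \<le> ratio_approx N n \<and> ratio_approx N n \<le> 1"
proof (induction N arbitrary: n)
  case (Suc N)
  have "0 \<le> 1 / (2 + real (k (Suc n)))" by simp
  with Suc[of "Suc n"] have "0 \<le> ratio_approx N (Suc n)" "ratio_approx N (Suc n) \<le> 1" by linarith+
  then show ?case by (auto simp: field_simps)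
qed (simp add: field_simps)

text \<open>The map sending \<open>r\<close> to \<open>1 / (2 + k n - r)\<close> is increasing for
  \<open>r\<close> at most 1, and the iteration starts at the upper bound 1.\<close>

lemma ratio_approx_decreasing: "ratio_approx (Suc N) n \<le> ratio_approx N n"
proof (induction N arbitrary: n)
  case 0
  then show ?case by simp
next
  case (Suc N)
  have "ratio_approx N (Suc n) \<le> 1" using ratio_approx_bounds by blast
  with Suc[of "Suc n"] show ?case
    by (simp only: ratio_approx.simps(2)[of _ n]) (intro divide_left_mono mult_pos_pos; linarith)
qed

definition ratio :: "nat \<Rightarrow> real" where
  "ratio n = lim (\<lambda>N. ratio_approx N n)"

lemma ratio_approx_tendsto: "(\<lambda>N. ratio_approx N n) \<longlonglongrightarrow> ratio n"
proof -
  have "decseq (\<lambda>N. ratio_approx N n)" using ratio_approx_decreasing by (intro decseq_SucI)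
  then have "convergent (\<lambda>N. ratio_approx N n)"
    using decseq_convergent[of "\<lambda>N. ratio_approx N n" "1 / (2 + real (k n))"] ratio_approx_bounds
    by (metis convergentI)
  then show ?thesis by (simp add: ratio_def convergent_LIMSEQ_iff)
qed

lemma ratio_bounds: "1 / (2 + real (k n)) \<le> ratio n" "ratio n \<le> 1"
  using ratio_approx_bounds
  by (auto intro: LIMSEQ_le_const[OF ratio_approx_tendsto] LIMSEQ_le_const2[OF ratio_approx_tendsto])

lemma ratio_pos: "0 < ratio n"
  using ratio_bounds(1)[of n] by (smt (verit) divide_pos_pos of_nat_0_le_iff)

lemma ratio_rec: "ratio n * (2 + real (k n) - ratio (Suc n)) = 1"
proof -
  have "2 + real (k n) - ratio (Suc n) \<noteq> 0" using ratio_bounds(2)[of "Suc n"] by linarith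
  then have "(\<lambda>N. 1 / (2 + real (k n) - ratio_approx N (Suc n))) \<longlonglongrightarrow> 1 / (2 + real (k n) - ratio (Suc n))"
    by (intro tendsto_intros ratio_approx_tendsto)
  moreover have "(\<lambda>N. ratio_approx (Suc N) n) \<longlonglongrightarrow> ratio n"
    using ratio_approx_tendsto by (rule LIMSEQ_Suc)
  ultimately have "ratio n = 1 / (2 + real (k n) - ratio (Suc n))"
    using LIMSEQ_unique by simp
  with \<open>2 + real (k n) - ratio (Suc n) \<noteq> 0\<close> show ?thesis by simp
qed

definition weight :: "nat \<Rightarrow> real" where
  "weight n = (\<Prod>i\<in>{1..<n}. ratio i)"

lemma weight_1: "weight 1 = 1"
  by (simp add: weight_def)

lemma weight_pos: "0 < weight n"
  by (simp add: weight_def prod_pos ratio_pos)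

lemma weight_Suc: "1 \<le> n \<Longrightarrow> weight (Suc n) = ratio n * weight n"
  by (simp add: weight_def mult.commute)

lemma weight_rec:
  assumes "1 \<le> n"
  shows "weight n = (2 + real (k n)) * weight (Suc n) - weight (Suc (Suc n))"
proof -
  have "(2 + real (k n)) * weight (Suc n) - weight (Suc (Suc n)) =
    (ratio n * (2 + real (k n) - ratio (Suc n))) * weight n"
    using assms by (simp add: weight_Suc algebra_simps)
  then show ?thesis by (simp add: ratio_rec)
qed

text \<open>The mass that the points at \<open>v\<^sub>n\<close> not containing \<alpha> should
  have. They begin with a \<gamma>, or with a \<beta> whose continuation again does not contain
  \<alpha>; this is the content of \<open>drop_weight_rec\<close>.\<close>

definition drop_weight :: "nat \<Rightarrow> real" where
  "drop_weight n = weight n - weight (Suc n)"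

lemma drop_weight_rec:
  "1 \<le> n \<Longrightarrow> drop_weight n = drop_weight (Suc n) + real (k n) * weight (Suc n)"
  using weight_rec[of n] by (simp add: drop_weight_def algebra_simps)

lemma drop_weight_nonneg: "1 \<le> n \<Longrightarrow> 0 \<le> drop_weight n"
  using ratio_bounds(2)[of n] weight_pos[of n]
  by (simp add: drop_weight_def weight_Suc)

lemma drop_weight_le: "drop_weight n \<le> weight n"
  using weight_pos[of "Suc n"] by (simp add: drop_weight_def)

lemma weight_decreasing: "1 \<le> m \<Longrightarrow> m \<le> n \<Longrightarrow> weight n \<le> weight m"
proof (induction n)
  case (Suc n)
  then show ?case using drop_weight_nonneg[of n] by (cases "m = Suc n") (simp_all add: drop_weight_def)
qed simp

text \<open>With a positive limit \<open>L\<close>, every level with \<open>k i > 0\<close> would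
  lower \<open>drop_weight\<close> by at least \<open>L\<close>. As \<open>drop_weight\<close> stays
  nonnegative, there could be only finitely many such levels.\<close>

lemma weight_tendsto_0: "weight \<longlonglongrightarrow> 0"
proof -
  have dec: "decseq (\<lambda>n. weight (Suc n))"
    using weight_decreasing by (intro decseq_SucI) simp
  obtain L where L: "(\<lambda>n. weight (Suc n)) \<longlonglongrightarrow> L" "\<And>n. L \<le> weight (Suc n)"
    using decseq_convergent[OF dec, of 0] weight_pos by (metis less_imp_le)
  have "0 \<le> L" using L(1) weight_pos by (intro LIMSEQ_le_const[OF L(1)]) (auto intro: less_imp_le)
  have "L = 0"
  proof (rule ccontr)
    assume "L \<noteq> 0"
    with \<open>0 \<le> L\<close> have "0 < L" by simp
    have unroll: "real (card {i\<in>{1..n}. 0 < k i}) * L \<le> drop_weight 1 - drop_weight (Suc n)" for n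
    proof (induction n)
      case (Suc n)
      have "{i\<in>{1..Suc n}. 0 < k i} =
        (if 0 < k (Suc n) then insert (Suc n) {i\<in>{1..n}. 0 < k i} else {i\<in>{1..n}. 0 < k i})"
        by (auto simp: le_Suc_eq)
      then have "real (card {i\<in>{1..Suc n}. 0 < k i}) =
        real (card {i\<in>{1..n}. 0 < k i}) + (if 0 < k (Suc n) then 1 else 0)"
        by simp
      moreover have "(if 0 < k (Suc n) then 1 else 0) * L \<le> real (k (Suc n)) * weight (Suc (Suc n))"
        using mult_mono[of 1 "real (k (Suc n))" L "weight (Suc (Suc n))"] L(2)[of "Suc n"] \<open>0 < L\<close> by auto
      ultimately show ?case
        using Suc drop_weight_rec[of "Suc n"] by (simp add: algebra_simps)
    qed simp
    have fin: "card S \<le> nat \<lceil>weight 1 / L\<rceil>" if "finite S" "S \<subseteq> {i. 1 \<le> i \<and> 0 < k i}" for S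
    proof -
      obtain n where n: "S \<subseteq> {..n}" using finite_nat_set_iff_bounded_le[of S] \<open>finite S\<close> by auto
      have "card S \<le> card {i\<in>{1..n}. 0 < k i}" using n that(2) by (intro card_mono) auto
      then have "real (card S) * L \<le> real (card {i\<in>{1..n}. 0 < k i}) * L"
        using \<open>0 < L\<close> by (intro mult_right_mono) auto
      also have "\<dots> \<le> weight 1"
        using unroll[of n] drop_weight_nonneg[of "Suc n"] drop_weight_le[of 1] by linarith
      finally have "real (card S) \<le> weight 1 / L" using \<open>0 < L\<close> by (simp add: field_simps)
      then show ?thesis by linarith
    qed
    have "infinite {i. 1 \<le> i \<and> 0 < k i}"
      unfolding infinite_nat_iff_unbounded_le
    proof
      fix m
      obtain i where "i \<ge> max m 1" "0 < k i" using gammas_unbounded by blast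
      then show "\<exists>n\<ge>m. n \<in> {i. 1 \<le> i \<and> 0 < k i}" by auto
    qed
    then obtain S where "finite S" "card S = Suc (nat \<lceil>weight 1 / L\<rceil>)" "S \<subseteq> {i. 1 \<le> i \<and> 0 < k i}"
      using infinite_arbitrarily_large by blast
    with fin[of S] show False by simp
  qed
  with L(1) show ?thesis using LIMSEQ_imp_Suc by blast
qed

section \<open>Coding by an interval\<close>

text \<open>
  The interval \<open>[0, weight n)\<close> is cut into one block for every letter at level \<open>n\<close>. Reading off the
  blocks successively yields exactly the words in which no \<open>\<beta>\<close> is directly followed by an \<open>\<alpha>\<close>:
  the block of \<open>\<beta>\<close> has length \<open>drop_weight (Suc n)\<close> and thus avoids the block of \<open>\<alpha>\<close> at the next level.
\<close>

definition interval :: "nat \<Rightarrow> real set" where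
  "interval n = {0..<weight n}"

text \<open>The blocks are ordered \<beta>, \<gamma>'s, \<alpha> from left to right. With \<beta> at
  offset 0, reading \<beta> leaves the number unchanged, and the \<beta>-block is exactly the part
  to the left of the \<alpha>-block of the next level.\<close>

definition offset :: "nat \<Rightarrow> letter \<Rightarrow> real" where
  "offset n l = (case l of Beta \<Rightarrow> 0 | Gam j \<Rightarrow> drop_weight (Suc n) + (real j - 1) * weight (Suc n) | Alpha \<Rightarrow> drop_weight n)"

definition block_length :: "nat \<Rightarrow> letter \<Rightarrow> real" where
  "block_length n l = (if l = Beta then drop_weight (Suc n) else weight (Suc n))"

definition digit :: "nat \<Rightarrow> real \<Rightarrow> letter" where
  "digit n u = (if u < drop_weight (Suc n) then Beta
     else if u < drop_weight n then Gam (nat \<lfloor>(u - drop_weight (Suc n)) / weight (Suc n)\<rfloor> + 1) else Alpha)"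

definition residue :: "nat \<Rightarrow> real \<Rightarrow> real" where
  "residue n u = u - offset n (digit n u)"

text \<open>Together with \<open>digit_offset\<close> this identifies \<open>interval n\<close> with
  the disjoint union of the intervals from 0 to \<open>block_length n l\<close>, over the letters
  \<open>l\<close> of level \<open>n\<close>.\<close>

lemma digit_residue:
  assumes "1 \<le> n" "u \<in> interval n"
  shows "digit n u \<in> letters n" "residue n u \<in> {0..<block_length n (digit n u)}"
proof -
  let ?q = "(u - drop_weight (Suc n)) / weight (Suc n)"
  have w: "0 < weight (Suc n)" by (rule weight_pos)
  have *: "0 \<le> \<lfloor>?q\<rfloor> \<and> \<lfloor>?q\<rfloor> < int (k n) \<and> of_int \<lfloor>?q\<rfloor> * weight (Suc n) \<le> u - drop_weight (Suc n) \<and>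
    u - drop_weight (Suc n) < (of_int \<lfloor>?q\<rfloor> + 1) * weight (Suc n)"
    if u: "\<not> u < drop_weight (Suc n)" "u < drop_weight n"
  proof (intro conjI)
    show "0 \<le> \<lfloor>?q\<rfloor>" using u(1) w by simp
    have "?q < real (k n)"
      using u(2) w drop_weight_rec[OF assms(1)] by (simp add: pos_divide_less_eq)
    then show "\<lfloor>?q\<rfloor> < int (k n)" by (simp add: floor_less_iff)
    have "of_int \<lfloor>?q\<rfloor> \<le> ?q" "?q < of_int \<lfloor>?q\<rfloor> + 1" by linarith+
    then show "of_int \<lfloor>?q\<rfloor> * weight (Suc n) \<le> u - drop_weight (Suc n)"
      "u - drop_weight (Suc n) < (of_int \<lfloor>?q\<rfloor> + 1) * weight (Suc n)"
      using w by (simp_all only: pos_le_divide_eq pos_divide_less_eq)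
  qed
  have "nat \<lfloor>?q\<rfloor> + 1 \<in> {1..k n}" if "\<not> u < drop_weight (Suc n)" "u < drop_weight n"
    using *[OF that] by (simp add: Suc_le_eq nat_less_iff)
  then show "digit n u \<in> letters n"
    unfolding digit_def letters_def by auto
  show "residue n u \<in> {0..<block_length n (digit n u)}"
    using * assms(2)
    by (auto simp: residue_def digit_def offset_def block_length_def interval_def drop_weight_def algebra_simps)
qed

lemma digit_offset:
  assumes "1 \<le> n" "l \<in> letters n" "v \<in> {0..<block_length n l}"
  shows "digit n (offset n l + v) = l" "offset n l + v \<in> interval n"
proof -
  have w: "0 < weight (Suc n)" by (rule weight_pos)
  have d: "0 \<le> drop_weight (Suc n)" using drop_weight_nonneg by simp
  have dd: "drop_weight (Suc n) \<le> drop_weight n" using drop_weight_rec[OF assms(1)] w by simp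
  have "digit n (offset n l + v) = l \<and> offset n l + v \<in> interval n"
  proof (cases l)
    case Alpha
    then show ?thesis
      using assms(3) d dd by (auto simp: digit_def offset_def block_length_def interval_def drop_weight_def)
  next
    case Beta
    then show ?thesis
      using assms(3) d dd drop_weight_le[of n]
      by (auto simp: digit_def offset_def block_length_def interval_def)
  next
    case (Gam j)
    then have j: "1 \<le> j" "j \<le> k n" using assms(2) by (auto simp: letters_def)
    let ?u = "offset n l + v"
    have u: "?u = drop_weight (Suc n) + (real j - 1) * weight (Suc n) + v" by (simp add: Gam offset_def)
    have v: "0 \<le> v" "v < weight (Suc n)" using assms(3) by (simp_all add: Gam block_length_def)
    have j1: "0 \<le> (real j - 1) * weight (Suc n)" using j(1) w by simp
    have "real j * weight (Suc n) \<le> real (k n) * weight (Suc n)" using j(2) w by simp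
    then have lt: "?u < drop_weight n"
      using drop_weight_rec[OF assms(1)] v unfolding u left_diff_distrib by linarith
    have "(?u - drop_weight (Suc n)) / weight (Suc n) = real (j - 1) + v / weight (Suc n)"
      unfolding u using w j(1) by (simp add: of_nat_diff field_simps)
    moreover have "0 \<le> v / weight (Suc n)" "v / weight (Suc n) < 1" using v w by simp_all
    ultimately have fl: "\<lfloor>(?u - drop_weight (Suc n)) / weight (Suc n)\<rfloor> = int (j - 1)"
      by (simp add: floor_eq_iff)
    have "\<not> ?u < drop_weight (Suc n)" unfolding u using j1 v(1) by linarith
    then have "digit n ?u = l"
      using lt j(1) unfolding digit_def fl by (simp add: Gam)
    moreover have "0 \<le> ?u" unfolding u using j1 v(1) d by linarith
    ultimately show ?thesis using lt drop_weight_le[of n] by (simp add: interval_def)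
  qed
  then show "digit n (offset n l + v) = l" "offset n l + v \<in> interval n" by auto
qed

lemma block_subset: "block_length n l \<le> weight (Suc n)"
  by (simp add: block_length_def drop_weight_le)

lemma residue_in_interval: "1 \<le> n \<Longrightarrow> u \<in> interval n \<Longrightarrow> residue n u \<in> interval (Suc n)"
  using digit_residue(2)[of n u] block_subset[of n "digit n u"] by (simp add: interval_def)

fun word :: "nat \<Rightarrow> nat \<Rightarrow> real \<Rightarrow> letter list" where
  "word 0 n u = []"
| "word (Suc N) n u = digit n u # word N (Suc n) (residue n u)"

lemma length_word [simp]: "length (word N n u) = N"
  by (induction N arbitrary: n u) auto

lemma word_add: "\<exists>v. word (N + M) n u = word N n u @ v"
  by (induction N arbitrary: n u) auto

lemma edge_in_Lam: "l \<in> letters n \<Longrightarrow> 1 \<le> n \<Longrightarrow> abs_path (n, [l]) \<in> Lam k"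
  using edges_subset[of n] unfolding edges_def by blast

lemma word_in_Lam: "1 \<le> n \<Longrightarrow> u \<in> interval n \<Longrightarrow> abs_path (n, word N n u) \<in> Lam k"
proof (induction N arbitrary: n u)
  case 0
  then show ?case by (simp add: edge_path_def)
next
  case (Suc N)
  have "abs_path (n, [digit n u]) \<in> Lam k" using edge_in_Lam digit_residue(1) Suc.prems by blast
  moreover have "abs_path (Suc n, word N (Suc n) (residue n u)) \<in> Lam k"
    using Suc residue_in_interval by simp
  ultimately show ?case
    using edge_path_append[of k n "[digit n u]" "word N (Suc n) (residue n u)"] by simp
qed

definition itinerary :: "nat \<Rightarrow> real \<Rightarrow> path set" where
  "itinerary n u = {\<mu>. \<exists>N. \<mu> \<preceq> abs_path (n, word N n u)}"

lemma word_mono: "N \<le> M \<Longrightarrow> abs_path (n, word N n u) \<preceq> abs_path (n, word M n u)"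
  using word_add[of N "M - N" n u] by (auto simp: divides_def)

lemma itinerary_bdry_at:
  assumes "1 \<le> n" "u \<in> interval n"
  shows "itinerary n u \<in> bdry_at k n"
proof -
  have mem: "abs_path (n, word N n u) \<in> itinerary n u" for N
    unfolding itinerary_def using divides_refl by blast
  have "itinerary n u \<subseteq> Lam k"
    unfolding itinerary_def using word_in_Lam[OF assms] divides_in_Lam by blast
  moreover have "itinerary n u \<noteq> {}" using mem by blast
  moreover have "\<exists>\<xi>\<in>itinerary n u. \<mu> \<preceq> \<xi> \<and> \<nu> \<preceq> \<xi>" if mn: "\<mu> \<in> itinerary n u" "\<nu> \<in> itinerary n u" for \<mu> \<nu>
  proof -
    obtain N M where "\<mu> \<preceq> abs_path (n, word N n u)" "\<nu> \<preceq> abs_path (n, word M n u)"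
      using mn by (auto simp: itinerary_def)
    then have "\<mu> \<preceq> abs_path (n, word (max N M) n u)" "\<nu> \<preceq> abs_path (n, word (max N M) n u)"
      using word_mono divides_trans by (meson max.cobounded1 max.cobounded2)+
    with mem show ?thesis by blast
  qed
  moreover have "\<nu> \<in> itinerary n u" if "\<mu> \<in> itinerary n u" "\<nu> \<preceq> \<mu>" for \<mu> \<nu>
    using that divides_trans unfolding itinerary_def mem_Collect_eq by meson
  ultimately have L: "itinerary n u \<in> Lam_star k"
    unfolding Lam_star_iff by (intro conjI ballI allI impI)
  moreover have "rng_of (itinerary n u) = n" using rng_of_eq[OF L mem[of 0]] by simp
  moreover have "unbounded (itinerary n u)"
    unfolding unbounded_def
  proof
    fix N
    show "\<exists>\<mu>\<in>itinerary n u. N \<le> src \<mu>" by (rule bexI[OF _ mem[of N]]) simp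
  qed
  ultimately show ?thesis by (simp add: bdry_at_iff)
qed

lemma itinerary_step:
  assumes "1 \<le> n" "u \<in> interval n"
  shows "itinerary n u = act k (abs_path (n, [digit n u])) (itinerary (Suc n) (residue n u))"
proof -
  let ?e = "abs_path (n, [digit n u])" and ?x = "itinerary (Suc n) (residue n u)"
  have e: "?e \<in> Lam k" using edge_in_Lam digit_residue(1) assms by blast
  have x: "?x \<in> bdry_at k (src ?e)"
    using itinerary_bdry_at residue_in_interval assms by simp
  have "\<mu> \<in> itinerary n u \<longleftrightarrow> (\<exists>\<nu>\<in>?x. \<mu> \<preceq> pcomp ?e \<nu>)" for \<mu>
  proof
    assume "\<mu> \<in> itinerary n u"
    then obtain N where "\<mu> \<preceq> abs_path (n, word N n u)" by (auto simp: itinerary_def)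
    moreover have "abs_path (n, word N n u) \<preceq> abs_path (n, word (Suc N) n u)" by (rule word_mono) simp
    ultimately have "\<mu> \<preceq> pcomp ?e (abs_path (Suc n, word N (Suc n) (residue n u)))"
      using divides_trans by simp
    moreover have "abs_path (Suc n, word N (Suc n) (residue n u)) \<in> ?x"
      unfolding itinerary_def using divides_refl by blast
    ultimately show "\<exists>\<nu>\<in>?x. \<mu> \<preceq> pcomp ?e \<nu>" by blast
  next
    assume "\<exists>\<nu>\<in>?x. \<mu> \<preceq> pcomp ?e \<nu>"
    then obtain \<nu> N where nu: "\<mu> \<preceq> pcomp ?e \<nu>" "\<nu> \<preceq> abs_path (Suc n, word N (Suc n) (residue n u))"
      by (auto simp: itinerary_def)
    have "pcomp ?e \<nu> \<preceq> pcomp ?e (abs_path (Suc n, word N (Suc n) (residue n u)))"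
      using nu(2) by (subst divides_pcomp_cancel) (auto simp: divides_def)
    then have "pcomp ?e \<nu> \<preceq> abs_path (n, word (Suc N) n u)" by simp
    with nu(1) have "\<mu> \<preceq> abs_path (n, word (Suc N) n u)" by (rule divides_trans)
    then show "\<mu> \<in> itinerary n u" unfolding itinerary_def by blast
  qed
  then show ?thesis using act_mem_iff[OF e x] by blast
qed

text \<open>Below \<open>drop_weight n\<close>, reading \<beta> keeps the number and leaves it below
  \<open>drop_weight\<close> at the next level. Hence the word is a run of \<beta>'s that only a
  \<gamma> can end, and no \<alpha> can be commuted to the front.\<close>

lemma alpha_in_itinerary_iff:
  assumes "1 \<le> n" "u \<in> interval n"
  shows "abs_path (n, [Alpha]) \<in> itinerary n u \<longleftrightarrow> drop_weight n \<le> u"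
proof
  have no_alpha: "\<not> prefix [Alpha] (removeAll Beta (word N n u))" if "u < drop_weight n" for N n u
    using that
  proof (induction N arbitrary: n u)
    case (Suc N)
    show ?case
    proof (cases "u < drop_weight (Suc n)")
      case True
      then have "digit n u = Beta" "residue n u = u" by (simp_all add: digit_def residue_def offset_def)
      with True Suc.IH[of u "Suc n"] show ?thesis by simp
    qed (use Suc.prems in \<open>simp add: digit_def\<close>)
  qed simp
  assume "abs_path (n, [Alpha]) \<in> itinerary n u"
  then obtain N where "prefix [Alpha] (removeAll Beta (word N n u))"
    by (auto simp: itinerary_def divides_def)
  then show "drop_weight n \<le> u" using no_alpha not_le by blast
next
  assume u: "drop_weight n \<le> u"
  have "drop_weight (Suc n) \<le> drop_weight n"
    using drop_weight_rec[OF assms(1)] weight_pos[of "Suc n"] by simp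
  with u have "digit n u = Alpha" by (simp add: digit_def)
  then have "abs_path (n, [Alpha]) \<preceq> abs_path (n, word 1 n u)" by simp
  then show "abs_path (n, [Alpha]) \<in> itinerary n u" unfolding itinerary_def by blast
qed

section \<open>Measurability of the coding\<close>

lemma measurable_digit [measurable]: "digit n \<in> measurable borel (count_space UNIV)"
  unfolding digit_def[abs_def] by measurable

lemma measurable_residue [measurable]: "residue n \<in> borel_measurable borel"
proof -
  have "(\<lambda>u. offset n (digit n u)) \<in> borel_measurable borel"
    by (rule measurable_compose[OF measurable_digit]) simp
  then show ?thesis unfolding residue_def[abs_def] by measurable
qed

lemma measurable_word: "word N n \<in> measurable borel (count_space UNIV)"
proof (induction N arbitrary: n)
  case 0
  then show ?case by (simp add: fun_eq_iff[of "word 0 n"])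
next
  case (Suc N)
  have "(\<lambda>u. l # word N (Suc n) (residue n u)) \<in> measurable borel (count_space UNIV)" for l
    using measurable_compose[OF measurable_compose[OF measurable_residue Suc.IH], of "\<lambda>w. l # w"] by simp
  from measurable_compose_countable[OF this measurable_digit[of n]]
  show ?case by (simp add: fun_eq_iff cong: measurable_cong)
qed

lemma measurable_itinerary: "{u. \<mu> \<in> itinerary n u} \<in> sets borel"
proof -
  have "{u. \<mu> \<in> itinerary n u} = (\<Union>N. word N n -` {w. \<mu> \<preceq> abs_path (n, w)} \<inter> space borel)"
    by (auto simp: itinerary_def)
  also have "\<dots> \<in> sets borel"
    by (intro sets.countable_UN image_subsetI measurable_sets[OF measurable_word]) simp
  finally show ?thesis .
qed

section \<open>Germs and invariance\<close>

lemma triples_iff: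
  "(\<mu>, \<nu>, x) \<in> triples k \<longleftrightarrow> \<mu> \<in> Lam k \<and> \<nu> \<in> Lam k \<and> rng \<mu> = 1 \<and> rng \<nu> = 1 \<and> src \<mu> = src \<nu> \<and>
     x \<in> bdry_at k (src \<mu>)"
  by (simp add: triples_def)

lemma shift_invariants:
  assumes "shift k (\<mu>, \<nu>, x) (\<mu>', \<nu>', x')"
  shows "act k \<mu> x = act k \<mu>' x' \<and> act k \<nu> x = act k \<nu>' x' \<and>
    (\<mu>, \<nu>, x) \<in> triples k \<and> (\<mu>', \<nu>', x') \<in> triples k"
  using assms
proof (cases rule: shift.cases)
  case (1 \<eta>)
  then have x': "x' \<in> bdry_at k (src \<eta>)" "\<mu> \<in> Lam k" "\<nu> \<in> Lam k" "src \<mu> = src \<nu>"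
    by (simp_all add: triples_iff)
  with 1 have "act k \<mu>' x' = act k \<mu> x" "act k \<nu>' x' = act k \<nu> x" using act_pcomp by simp_all
  with 1 show ?thesis by simp
qed

text \<open>Makes source and range independent of the representative, so that the \<open>THE\<close>
  in \<open>germ_source\<close> and \<open>germ_range\<close> can be evaluated.\<close>

lemma germ_equiv_invariants:
  assumes "equivclp (shift k) (\<mu>, \<nu>, x) t"
  shows "case t of (\<mu>', \<nu>', x') \<Rightarrow> act k \<mu> x = act k \<mu>' x' \<and> act k \<nu> x = act k \<nu>' x'"
  using assms
proof (induction rule: equivclp_induct)
  case (step y z)
  then show ?case
    by (cases y; cases z) (auto dest: shift_invariants)
qed simp

lemma germ_eq_iff:
  "germ k \<mu> \<nu> x = germ k \<mu>' \<nu>' x' \<longleftrightarrow> equivclp (shift k) (\<mu>, \<nu>, x) (\<mu>', \<nu>', x')"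
proof
  assume "germ k \<mu> \<nu> x = germ k \<mu>' \<nu>' x'"
  then have "(\<mu>', \<nu>', x') \<in> germ k \<mu> \<nu> x" by (simp add: germ_def equivclp_refl)
  then show "equivclp (shift k) (\<mu>, \<nu>, x) (\<mu>', \<nu>', x')" by (simp add: germ_def)
next
  assume *: "equivclp (shift k) (\<mu>, \<nu>, x) (\<mu>', \<nu>', x')"
  show "germ k \<mu> \<nu> x = germ k \<mu>' \<nu>' x'"
    unfolding germ_def
    using equivclp_trans[OF *] equivclp_trans[OF equivclp_sym[OF *]] by auto
qed

lemma germ_source:
  assumes "(\<mu>, \<nu>, x) \<in> triples k"
  shows "germ_source k (germ k \<mu> \<nu> x) = act k \<nu> x"
  unfolding germ_source_def
proof (rule the_equality)
  fix y assume "\<exists>\<mu>' \<nu>' x'. (\<mu>', \<nu>', x') \<in> triples k \<and> germ k \<mu> \<nu> x = germ k \<mu>' \<nu>' x' \<and> y = act k \<nu>' x'"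
  then show "y = act k \<nu> x"
    using germ_equiv_invariants by (fastforce simp: germ_eq_iff)
qed (use assms in blast)

lemma germ_range:
  assumes "(\<mu>, \<nu>, x) \<in> triples k"
  shows "germ_range k (germ k \<mu> \<nu> x) = act k \<mu> x"
  unfolding germ_range_def
proof (rule the_equality)
  fix y assume "\<exists>\<mu>' \<nu>' x'. (\<mu>', \<nu>', x') \<in> triples k \<and> germ k \<mu> \<nu> x = germ k \<mu>' \<nu>' x' \<and> y = act k \<mu>' x'"
  then show "y = act k \<mu> x"
    using germ_equiv_invariants by (fastforce simp: germ_eq_iff)
qed (use assms in blast)

text \<open>
  Each generating step of the equivalence relation extends to a neighbourhood, because \<open>act\<close> is
  continuous and open.
\<close>

lemma germ_equiv_nearby:
  assumes "(\<mu>, \<nu>, x) \<in> triples k" "equivclp (shift k) (\<mu>, \<nu>, x) t"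
    and "t = (\<mu>', \<nu>', y)" "openin (bdry_at_top k (src \<mu>')) V" "y \<in> V"
  shows "\<exists>U. openin (bdry_at_top k (src \<mu>)) U \<and> x \<in> U \<and>
    (\<forall>x'\<in>U. \<exists>y'\<in>V. equivclp (shift k) (\<mu>, \<nu>, x') (\<mu>', \<nu>', y'))"
  using assms(2-5)
proof (induction arbitrary: \<mu>' \<nu>' y V rule: equivclp_induct)
  case base
  from base.prems(1) have eq: "\<mu>' = \<mu>" "\<nu>' = \<nu>" "y = x" by blast+
  show ?case
    using base.prems(2,3) unfolding eq
    by (intro exI[of _ V] conjI ballI) (assumption, assumption, erule bexI[rotated], rule equivclp_refl)
next
  case (step s t)
  obtain \<alpha> \<beta> z where s: "s = (\<alpha>, \<beta>, z)" by (cases s)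
  have "\<exists>W. openin (bdry_at_top k (src \<alpha>)) W \<and> z \<in> W \<and>
    (\<forall>z'\<in>W. \<exists>y'\<in>V. equivclp (shift k) (\<alpha>, \<beta>, z') (\<mu>', \<nu>', y'))"
    using step.hyps(2)
  proof
    assume "shift k s t"
    then have sh: "shift k (\<alpha>, \<beta>, z) (\<mu>', \<nu>', y)" by (simp add: s step.prems)
    then show ?thesis
    proof (cases rule: shift.cases)
      case (1 \<eta>)
      have sm: "src \<mu>' = src \<eta>" using 1(2,7) by simp
      have "(\<alpha>, \<beta>, z) \<in> triples k" "(\<mu>', \<nu>', y) \<in> triples k"
        using shift_invariants[OF sh] by blast+
      then have tr: "\<alpha> \<in> Lam k" "\<beta> \<in> Lam k" "rng \<alpha> = 1" "rng \<beta> = 1" "src \<alpha> = src \<beta>"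
        "y \<in> bdry_at k (src \<eta>)" unfolding triples_iff sm by blast+
      have V: "openin (bdry_at_top k (src \<eta>)) V" using step.prems(2) sm by simp
      then have VX: "V \<subseteq> bdry_at k (src \<eta>)" using openin_subset topspace_bdry_at_top by metis
      have "equivclp (shift k) (\<alpha>, \<beta>, act k \<eta> y') (\<mu>', \<nu>', y')" if y': "y' \<in> V" for y'
      proof -
        have y'X: "y' \<in> bdry_at k (src \<eta>)" using VX y' by blast
        then have "act k \<eta> y' \<in> bdry_at k (src \<alpha>)" using act_bdry_at[OF 1(6)] 1(7) by simp
        then have "shift k (\<alpha>, \<beta>, act k \<eta> y') (pcomp \<alpha> \<eta>, pcomp \<beta> \<eta>, y')"
          using tr(1-5) y'X 1(6,7) by (intro shift.intros) (simp_all add: triples_iff)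
        then show ?thesis unfolding 1(2,3) by (rule r_into_equivclp)
      qed
      moreover have "openin (bdry_at_top k (src \<alpha>)) (act k \<eta> ` V)"
        using open_act[OF 1(6) V] 1(7) by simp
      moreover have "z \<in> act k \<eta> ` V" using 1(1) step.prems(3) by blast
      ultimately show ?thesis by (intro exI[of _ "act k \<eta> ` V"]) blast
    qed
  next
    assume "shift k t s"
    then have sh: "shift k (\<mu>', \<nu>', y) (\<alpha>, \<beta>, z)" by (simp add: s step.prems)
    then show ?thesis
    proof (cases rule: shift.cases)
      case (1 \<eta>)
      have sm: "src \<alpha> = src \<eta>" using 1(2,7) by simp
      have "(\<mu>', \<nu>', y) \<in> triples k" "(\<alpha>, \<beta>, z) \<in> triples k"
        using shift_invariants[OF sh] by blast+
      then have tr: "\<mu>' \<in> Lam k" "\<nu>' \<in> Lam k" "rng \<mu>' = 1" "rng \<nu>' = 1" "src \<mu>' = src \<nu>'"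
        "z \<in> bdry_at k (src \<eta>)" unfolding triples_iff sm by blast+
      let ?W = "{z' \<in> bdry_at k (src \<eta>). act k \<eta> z' \<in> V}"
      have "equivclp (shift k) (\<alpha>, \<beta>, z') (\<mu>', \<nu>', act k \<eta> z')" if z': "z' \<in> bdry_at k (src \<eta>)" for z'
      proof -
        have "act k \<eta> z' \<in> bdry_at k (src \<mu>')" using act_bdry_at[OF 1(6) z'] 1(7) by simp
        then have "shift k (\<mu>', \<nu>', act k \<eta> z') (pcomp \<mu>' \<eta>, pcomp \<nu>' \<eta>, z')"
          using tr(1-5) z' 1(6,7) by (intro shift.intros) (simp_all add: triples_iff)
        then show ?thesis unfolding 1(2,3) by (rule equivclp_sym[OF r_into_equivclp])
      qed
      moreover have "openin (bdry_at_top k (src \<alpha>)) ?W"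
        using continuous_act[OF 1(6)] step.prems(2) 1(7) sm by simp
      moreover have "z \<in> ?W" using 1(1) step.prems(3) tr(6) by simp
      ultimately show ?thesis by (intro exI[of _ ?W]) blast
    qed
  qed
  then obtain W where W: "openin (bdry_at_top k (src \<alpha>)) W" "z \<in> W"
    "\<And>z'. z' \<in> W \<Longrightarrow> \<exists>y'\<in>V. equivclp (shift k) (\<alpha>, \<beta>, z') (\<mu>', \<nu>', y')" by blast
  obtain U where U: "openin (bdry_at_top k (src \<mu>)) U" "x \<in> U"
    "\<And>x'. x' \<in> U \<Longrightarrow> \<exists>z'\<in>W. equivclp (shift k) (\<mu>, \<nu>, x') (\<alpha>, \<beta>, z')"
    using step.IH[OF s W(1,2)] by blast
  have "\<exists>y'\<in>V. equivclp (shift k) (\<mu>, \<nu>, x') (\<mu>', \<nu>', y')" if x': "x' \<in> U" for x'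
  proof -
    obtain z' where z': "z' \<in> W" "equivclp (shift k) (\<mu>, \<nu>, x') (\<alpha>, \<beta>, z')" using U(3)[OF x'] by blast
    obtain y' where "y' \<in> V" "equivclp (shift k) (\<alpha>, \<beta>, z') (\<mu>', \<nu>', y')" using W(3)[OF z'(1)] by blast
    with equivclp_trans[OF z'(2)] show ?thesis by blast
  qed
  with U(1,2) show ?case by blast
qed

definition parallel_pairs :: "(path \<times> path) set" where
  "parallel_pairs = {(\<mu>, \<nu>). \<mu> \<in> Lam k \<and> \<nu> \<in> Lam k \<and> rng \<mu> = 1 \<and> rng \<nu> = 1 \<and> src \<mu> = src \<nu>}"

text \<open>Besides being the basic case of continuity of \<open>germ k \<mu> \<nu>\<close>, this
  shows with \<open>V\<close> the whole boundary that the overlap of two pairs is open, which is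
  needed to make the pieces of a bisection disjoint.\<close>

lemma openin_germ_vimage_image:
  assumes "(\<mu>, \<nu>) \<in> parallel_pairs" "openin (bdry_at_top k (src \<mu>')) V"
  shows "openin (bdry_at_top k (src \<mu>)) {x \<in> bdry_at k (src \<mu>). germ k \<mu> \<nu> x \<in> germ k \<mu>' \<nu>' ` V}"
    (is "openin _ ?W")
proof (subst openin_subopen, rule ballI)
  fix x assume x: "x \<in> ?W"
  then obtain y where y: "y \<in> V" "equivclp (shift k) (\<mu>, \<nu>, x) (\<mu>', \<nu>', y)" by (auto simp: germ_eq_iff)
  have "(\<mu>, \<nu>, x) \<in> triples k" using assms(1) x by (simp add: parallel_pairs_def triples_iff)
  from germ_equiv_nearby[OF this y(2) refl assms(2) y(1)]
  obtain U where U: "openin (bdry_at_top k (src \<mu>)) U" "x \<in> U"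
    "\<And>x'. x' \<in> U \<Longrightarrow> \<exists>y'\<in>V. equivclp (shift k) (\<mu>, \<nu>, x') (\<mu>', \<nu>', y')" by blast
  have "U \<subseteq> bdry_at k (src \<mu>)" using openin_subset[OF U(1)] by (simp add: topspace_bdry_at_top)
  moreover have "germ k \<mu> \<nu> x' \<in> germ k \<mu>' \<nu>' ` V" if x': "x' \<in> U" for x'
    using U(3)[OF x'] by (auto simp: germ_eq_iff)
  ultimately have "U \<subseteq> ?W" by blast
  with U(1,2) show "\<exists>T. openin (bdry_at_top k (src \<mu>)) T \<and> x \<in> T \<and> T \<subseteq> ?W" by blast
qed

lemma openin_germ_vimage:
  assumes "(\<mu>, \<nu>) \<in> parallel_pairs" "openin (germ_top k) E"
  shows "openin (bdry_at_top k (src \<mu>)) {x \<in> bdry_at k (src \<mu>). germ k \<mu> \<nu> x \<in> E}"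
  using assms(2) unfolding germ_top_def openin_topology_generated_by_iff
proof (induction rule: generate_topology_on.induct)
  case (Int a b)
  from openin_Int[OF Int.IH] show ?case by (rule back_subst) blast
next
  case (UN K)
  have "openin (bdry_at_top k (src \<mu>)) (\<Union>((\<lambda>E. {x \<in> bdry_at k (src \<mu>). germ k \<mu> \<nu> x \<in> E}) ` K))"
    using UN.IH by blast
  then show ?case by (rule back_subst) blast
next
  case (Basis s)
  then obtain \<mu>' \<nu>' V where "s = germ k \<mu>' \<nu>' ` V" "openin (bdry_at_top k (src \<mu>')) V" by blast
  then show ?case using openin_germ_vimage_image[OF assms(1)] by simp
qed simp

lemma germ_top_covered:
  assumes "openin (germ_top k) E" "g \<in> E"
  shows "\<exists>\<mu> \<nu> x. (\<mu>, \<nu>) \<in> parallel_pairs \<and> x \<in> bdry_at k (src \<mu>) \<and> g = germ k \<mu> \<nu> x"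
  using assms unfolding germ_top_def openin_topology_generated_by_iff
proof (induction rule: generate_topology_on.induct)
  case (Basis s)
  then obtain \<mu> \<nu> V where *: "s = germ k \<mu> \<nu> ` V" "openin (bdry_at_top k (src \<mu>)) V"
    "(\<mu>, \<nu>) \<in> parallel_pairs" by (auto simp: parallel_pairs_def)
  have "V \<subseteq> bdry_at k (src \<mu>)" using openin_subset[OF *(2)] by (simp add: topspace_bdry_at_top)
  with * Basis.prems show ?case by blast
qed auto

lemma borel_algebra_sets: "openin T U \<Longrightarrow> U \<in> sets (borel_algebra T)"
  unfolding borel_algebra_def
  by (subst sets_measure_of) (auto dest: openin_subset)

text \<open>Differences of open sets are the pieces left after overlaps are removed. Since
  \<open>act k \<eta>\<close> is injective and open, their images are again differences of open
  sets.\<close>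

lemma act_diff_measurable:
  assumes "\<eta> \<in> Lam k" "rng \<eta> = n" "openin (bdry_at_top k (src \<eta>)) U" "openin (bdry_at_top k (src \<eta>)) V"
    and "sets M = sets (borel_algebra (bdry_at_top k n))"
  shows "act k \<eta> ` (U - V) \<in> sets M"
proof -
  have "act k \<eta> ` (U - V) = act k \<eta> ` U - act k \<eta> ` V"
    using assms(3,4)[THEN openin_subset] inj_on_act[OF assms(1)]
    by (intro inj_on_image_set_diff[of _ "bdry_at k (src \<eta>)"]) (auto simp: topspace_bdry_at_top)
  moreover have "act k \<eta> ` U \<in> sets M" "act k \<eta> ` V \<in> sets M"
    unfolding assms(5) using open_act[OF assms(1)] assms(2-4) by (auto intro!: borel_algebra_sets)
  ultimately show ?thesis by simp
qed

text \<open>\<open>E\<close> is cut into countably many disjoint sets of germs, each represented by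
  one pair of paths. Source and range are injective on \<open>E\<close>, so the images stay
  disjoint, and the hypothesis compares them piece by piece.\<close>

lemma invariant_measureI:
  assumes sets: "sets M = sets (borel_algebra (bdry_at_top k 1))"
    and inv: "\<And>\<mu> \<nu> U V. (\<mu>, \<nu>) \<in> parallel_pairs \<Longrightarrow> openin (bdry_at_top k (src \<mu>)) U \<Longrightarrow>
      openin (bdry_at_top k (src \<mu>)) V \<Longrightarrow>
      emeasure M (act k \<mu> ` (U - V)) = emeasure M (act k \<nu> ` (U - V))"
  shows "invariant_measure (path_groupoid k) M"
  unfolding invariant_measure_def
proof (intro conjI allI impI)
  show "sets M = sets (borel_algebra (unit_space (path_groupoid k)))"
    by (simp add: path_groupoid_def sets)
next
  fix E assume "open_bisection (path_groupoid k) E"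
  then have E: "openin (germ_top k) E" and injr: "inj_on (germ_range k) E" and injs: "inj_on (germ_source k) E"
    by (simp_all add: open_bisection_def path_groupoid_def)
  define p where "p = from_nat_into parallel_pairs"
  define \<mu> where "\<mu> i = fst (p i)" for i
  define \<nu> where "\<nu> i = snd (p i)" for i
  have "(unit_path 1, unit_path 1) \<in> parallel_pairs" by (simp add: parallel_pairs_def)
  then have ne: "parallel_pairs \<noteq> {}" by blast
  have "countable parallel_pairs" by (rule countableI_type)
  then have rp: "range p = parallel_pairs" unfolding p_def using ne by (intro range_from_nat_into)
  then have pp: "(\<mu> i, \<nu> i) \<in> parallel_pairs" for i by (auto simp: \<mu>_def \<nu>_def)
  define W where "W i = {x \<in> bdry_at k (src (\<mu> i)). germ k (\<mu> i) (\<nu> i) x \<in> E}" for i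
  \<comment> \<open>Points whose \<open>i\<close>-th germ is also represented by the
    \<open>j\<close>-th pair, whether or not it lies in \<open>E\<close>. Removing these for
    \<open>j < i\<close> assigns every germ of \<open>E\<close> to the first pair that represents
    it.\<close>
  define C where "C i j = {x \<in> bdry_at k (src (\<mu> i)).
      germ k (\<mu> i) (\<nu> i) x \<in> germ k (\<mu> j) (\<nu> j) ` bdry_at k (src (\<mu> j))}" for i j
  define A where "A i = W i - (\<Union>j<i. C i j)" for i
  define G where "G i = germ k (\<mu> i) (\<nu> i) ` A i" for i
  have W_open: "openin (bdry_at_top k (src (\<mu> i))) (W i)" for i
    unfolding W_def by (rule openin_germ_vimage[OF pp E])
  have C_open: "openin (bdry_at_top k (src (\<mu> i))) (\<Union>j<i. C i j)" for i
    unfolding C_def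
    using openin_germ_vimage_image[OF pp] openin_topspace[of "bdry_at_top k _"]
    by (intro openin_Union) (auto simp: topspace_bdry_at_top)
  have AX: "A i \<subseteq> bdry_at k (src (\<mu> i))" for i by (auto simp: A_def W_def)
  have tr: "(\<mu> i, \<nu> i, x) \<in> triples k" if "x \<in> A i" for i x
    using pp[of i] subsetD[OF AX that] by (simp add: triples_iff parallel_pairs_def)
  have G_disj: "G i \<inter> G j = {}" if "j < i" for i j
  proof (rule ccontr)
    assume "G i \<inter> G j \<noteq> {}"
    then obtain x y where xy: "x \<in> A i" "y \<in> A j" "germ k (\<mu> i) (\<nu> i) x = germ k (\<mu> j) (\<nu> j) y"
      by (auto simp: G_def)
    have "x \<in> C i j" unfolding C_def using subsetD[OF AX xy(1)] subsetD[OF AX xy(2)] xy(3) by blast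
    moreover have "x \<notin> C i j" using xy(1) that by (simp add: A_def)
    ultimately show False by blast
  qed
  then have G_disjoint: "disjoint_family G"
    unfolding disjoint_family_on_def by (metis inf_commute nat_neq_iff)
  have GE: "G i \<subseteq> E" for i by (auto simp: G_def A_def W_def)
  have E_eq: "E = (\<Union>i. G i)"
  proof (intro equalityI subsetI)
    fix g assume g: "g \<in> E"
    let ?P = "\<lambda>i. g \<in> germ k (\<mu> i) (\<nu> i) ` bdry_at k (src (\<mu> i))"
    obtain \<alpha> \<beta> x where "(\<alpha>, \<beta>) \<in> parallel_pairs" "x \<in> bdry_at k (src \<alpha>)" "g = germ k \<alpha> \<beta> x"
      using germ_top_covered[OF E g] by blast
    moreover obtain n where "p n = (\<alpha>, \<beta>)" using rp calculation(1) by (metis rangeE)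
    ultimately have "?P n" by (simp add: \<mu>_def \<nu>_def)
    then have "\<exists>i. ?P i \<and> (\<forall>j<i. \<not> ?P j)" using exists_least_iff[of ?P] by blast
    then obtain i where i: "?P i" "\<forall>j<i. \<not> ?P j" by (elim exE conjE)
    from i(1) obtain y where y: "g = germ k (\<mu> i) (\<nu> i) y" "y \<in> bdry_at k (src (\<mu> i))" by (rule imageE)
    have "y \<notin> C i j" if "j < i" for j
      using i(2) that y(1) by (simp add: C_def)
    with y g have "y \<in> A i" by (auto simp: A_def W_def)
    with y(1) show "g \<in> (\<Union>i. G i)" unfolding G_def by blast
  qed (use GE in blast)
  have src_G: "germ_source k ` G i = act k (\<nu> i) ` A i" and rng_G: "germ_range k ` G i = act k (\<mu> i) ` A i" for i
    using germ_source[OF tr] germ_range[OF tr] by (auto simp: G_def image_image)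
  have "emeasure M (germ_source k ` E) = (\<Sum>i. emeasure M (germ_source k ` G i))"
  proof -
    have "germ_source k ` E = (\<Union>i. germ_source k ` G i)" unfolding E_eq by blast
    moreover have "range (\<lambda>i. germ_source k ` G i) \<subseteq> sets M"
      unfolding src_G A_def using W_open C_open pp act_diff_measurable[OF _ _ _ _ sets] by (auto simp: parallel_pairs_def)
    moreover have "disjoint_family (\<lambda>i. germ_source k ` G i)"
      using G_disjoint GE inj_on_image_Int[OF injs]
      unfolding disjoint_family_on_def by (metis image_empty)
    ultimately show ?thesis by (simp add: suminf_emeasure)
  qed
  also have "\<dots> = (\<Sum>i. emeasure M (germ_range k ` G i))"
    unfolding src_G rng_G A_def using inv[OF pp W_open C_open] by simp
  also have "\<dots> = emeasure M (germ_range k ` E)"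
  proof -
    have "germ_range k ` E = (\<Union>i. germ_range k ` G i)" unfolding E_eq by blast
    moreover have "range (\<lambda>i. germ_range k ` G i) \<subseteq> sets M"
      unfolding rng_G A_def using W_open C_open pp act_diff_measurable[OF _ _ _ _ sets] by (auto simp: parallel_pairs_def)
    moreover have "disjoint_family (\<lambda>i. germ_range k ` G i)"
      using G_disjoint GE inj_on_image_Int[OF injr]
      unfolding disjoint_family_on_def by (metis image_empty)
    ultimately show ?thesis by (simp add: suminf_emeasure)
  qed
  finally show "emeasure M (source_map (path_groupoid k) ` E) = emeasure M (range_map (path_groupoid k) ` E)"
    by (simp add: path_groupoid_def)
qed

section \<open>The masses of cylinders\<close>

definition fibre :: "nat \<Rightarrow> path \<Rightarrow> real set" where
  "fibre n \<mu> = {u \<in> interval n. \<mu> \<in> itinerary n u}"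

definition mass :: "nat \<Rightarrow> path \<Rightarrow> real" where
  "mass n \<mu> = measure lborel (fibre n \<mu>)"

lemma sets_interval [simp, measurable]: "interval n \<in> sets borel"
  by (simp add: interval_def)

lemma sets_fibre [simp, measurable]: "fibre n \<mu> \<in> sets borel"
proof -
  have "fibre n \<mu> = interval n \<inter> {u. \<mu> \<in> itinerary n u}" by (auto simp: fibre_def)
  then show ?thesis using measurable_itinerary[of \<mu> n] by (simp add: sets.Int)
qed

lemma fibre_subset: "fibre n \<mu> \<subseteq> interval n"
  by (auto simp: fibre_def)

lemma emeasure_interval_subset_finite:
  assumes "A \<subseteq> interval n"
  shows "emeasure lborel A \<noteq> \<infinity>"
proof -
  have "emeasure lborel A \<le> emeasure lborel (interval n)"
    using assms by (intro emeasure_mono) simp_all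
  also have "\<dots> = ennreal (weight n)" using weight_pos[of n] by (simp add: interval_def)
  finally show ?thesis by (metis ennreal_neq_top infinity_ennreal_def neq_top_trans)
qed

lemma measure_interval: "measure lborel (interval n) = weight n"
  using weight_pos[of n] by (simp add: interval_def)

lemma mass_bounds: "0 \<le> mass n \<mu>" "mass n \<mu> \<le> weight n"
proof -
  show "mass n \<mu> \<le> weight n"
    unfolding mass_def measure_interval[symmetric]
  proof (rule measure_mono_fmeasurable)
    show "interval n \<in> fmeasurable lborel"
      using emeasure_interval_subset_finite[of "interval n" n] by (simp add: fmeasurable_def less_top)
  qed (simp_all add: fibre_subset)
qed (simp add: mass_def)

lemma measure_translate:
  fixes A :: "real set"
  assumes "A \<in> sets borel"
  shows "measure lborel {u. u - c \<in> A} = measure lborel A"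
proof -
  have "emeasure lborel A = emeasure (distr lborel borel ((+) (- c))) A"
    using lborel_distr_plus[of "- c"] by simp
  also have "\<dots> = emeasure lborel ((+) (- c) -` A \<inter> space lborel)"
    using assms by (intro emeasure_distr) simp_all
  also have "(+) (- c) -` A \<inter> space lborel = {u. u - c \<in> A}" by auto
  finally show ?thesis by (simp add: measure_def)
qed

lemma measure_block:
  assumes "1 \<le> n" "l \<in> letters n" "A \<in> sets borel"
  shows "measure lborel {u \<in> interval n. digit n u = l \<and> residue n u \<in> A} =
    measure lborel (A \<inter> {0..<block_length n l})"
proof -
  have "{u \<in> interval n. digit n u = l \<and> residue n u \<in> A} =
    {u. u - offset n l \<in> A \<inter> {0..<block_length n l}}" (is "?L = ?R")
  proof (intro equalityI subsetI)
    fix u assume "u \<in> ?L"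
    then show "u \<in> ?R" using digit_residue(2)[OF assms(1), of u] by (auto simp: residue_def)
  next
    fix u assume u: "u \<in> ?R"
    then have v: "u - offset n l \<in> {0..<block_length n l}" by blast
    have "digit n u = l" "u \<in> interval n" using digit_offset[OF assms(1,2) v] by simp_all
    with u show "u \<in> ?L" by (simp add: residue_def)
  qed
  moreover have "A \<inter> {0..<block_length n l} \<in> sets borel" using assms(3) by simp
  ultimately show ?thesis by (simp only: measure_translate)
qed

lemma divides_edge_iff:
  "abs_path (n, [l]) \<preceq> abs_path (n, l' # w) \<longleftrightarrow>
    (l = l' \<or> l = Alpha \<and> l' = Beta \<and> prefix [Alpha] (removeAll Beta w) \<or>
     l = Beta \<and> l' = Alpha \<and> prefix [Beta] (removeAll Alpha w))"
  by (cases l; cases l') (auto simp: divides_def)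

text \<open>The letter \<open>\<alpha>\<close> never occurs after \<open>\<beta>\<close> without a \<open>\<gamma>\<close> in between, so only \<open>\<beta>\<close> can be hidden.\<close>

lemma edge_in_itinerary:
  assumes "1 \<le> n" "u \<in> interval n" "abs_path (n, [l]) \<in> itinerary n u"
  shows "digit n u = l \<or> l = Beta \<and> digit n u = Alpha"
proof -
  obtain N where N: "abs_path (n, [l]) \<preceq> abs_path (n, word N n u)" using assms(3) by (auto simp: itinerary_def)
  from divides_src_le[OF this] obtain M where M: "N = Suc M" by (cases N) auto
  have dd: "drop_weight (Suc n) \<le> drop_weight n"
    using drop_weight_rec[OF assms(1)] weight_pos[of "Suc n"] by simp
  show ?thesis
  proof (cases "l = Alpha")
    case True
    then have "drop_weight n \<le> u" using alpha_in_itinerary_iff assms by blast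
    with dd True show ?thesis by (simp add: digit_def)
  next
    case False
    with N M show ?thesis by (auto simp: divides_edge_iff)
  qed
qed

text \<open>If \<open>l\<close> is not the digit read, then by \<open>edge_in_itinerary\<close> it
  is a \<beta> hidden behind an \<alpha>; otherwise it cancels against the first step of the
  itinerary.\<close>

lemma pcomp_edge_in_itinerary_iff:
  assumes "1 \<le> n" "u \<in> interval n" "rng \<mu> = Suc n" "l \<in> letters n"
  shows "pcomp (abs_path (n, [l])) \<mu> \<in> itinerary n u \<longleftrightarrow>
    digit n u = l \<and> \<mu> \<in> itinerary (Suc n) (residue n u) \<or>
    l = Beta \<and> digit n u = Alpha \<and>
      pcomp (abs_path (n, [Beta])) \<mu> \<in> act k (abs_path (n, [Alpha])) (itinerary (Suc n) (residue n u))"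
proof -
  let ?x = "itinerary (Suc n) (residue n u)"
  have x: "?x \<in> bdry_at k (Suc n)" using itinerary_bdry_at residue_in_interval assms by simp
  show ?thesis
  proof (cases "digit n u = l")
    case True
    have "pcomp (abs_path (n, [l])) \<mu> \<in> itinerary n u \<longleftrightarrow> \<mu> \<in> ?x"
      unfolding itinerary_step[OF assms(1,2)] True
      using pcomp_in_act[OF edge_in_Lam[OF assms(4,1)], of ?x \<mu>] x assms(3) by simp
    with True show ?thesis by auto
  next
    case False
    have "abs_path (n, [l]) \<in> itinerary n u" if "pcomp (abs_path (n, [l])) \<mu> \<in> itinerary n u"
      using Lam_star_hereditary[OF bdry_at_Lam_star[OF itinerary_bdry_at[OF assms(1,2)]] that divides_pcomp] .
    then have "pcomp (abs_path (n, [l])) \<mu> \<in> itinerary n u \<Longrightarrow> l = Beta \<and> digit n u = Alpha"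
      using edge_in_itinerary[OF assms(1,2)] False by blast
    moreover have "itinerary n u = act k (abs_path (n, [Alpha])) ?x" if "digit n u = Alpha"
      using itinerary_step[OF assms(1,2)] that by simp
    ultimately show ?thesis using False by auto
  qed
qed

lemma fibre_Int_interval: "fibre n \<mu> \<inter> {0..<weight n} = fibre n \<mu>"
  by (auto simp: fibre_def interval_def)

text \<open>Such a letter cannot be hidden, and its block has the full length
  \<open>weight (Suc n)\<close>, so the whole fibre of \<open>\<mu>\<close> is translated into
  it.\<close>

lemma mass_edge_not_beta:
  assumes "1 \<le> n" "rng \<mu> = Suc n" "l \<in> letters n" "l \<noteq> Beta"
  shows "mass n (pcomp (abs_path (n, [l])) \<mu>) = mass (Suc n) \<mu>"
proof -
  have "fibre n (pcomp (abs_path (n, [l])) \<mu>) = {u \<in> interval n. digit n u = l \<and> residue n u \<in> fibre (Suc n) \<mu>}"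
    using pcomp_edge_in_itinerary_iff[OF assms(1) _ assms(2,3)] assms(4) residue_in_interval[OF assms(1)]
    by (auto simp: fibre_def)
  then show ?thesis
    using assms by (simp add: mass_def measure_block block_length_def fibre_Int_interval)
qed

text \<open>The \<beta>-block has length \<open>weight (Suc n) - weight (Suc (Suc n))\<close>, too
  short for a full fibre; the gap is the balance after the \<beta>'s hidden behind \<alpha> are
  added.\<close>

definition gap :: "nat \<Rightarrow> path \<Rightarrow> real" where
  "gap n \<mu> = mass n (pcomp (abs_path (n, [Beta])) \<mu>) - mass (Suc n) \<mu>"

lemma gap_bound: "\<bar>gap n \<mu>\<bar> \<le> weight n" if "1 \<le> n"
  using mass_bounds[of n "pcomp (abs_path (n, [Beta])) \<mu>"] mass_bounds[of "Suc n" \<mu>]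
    weight_decreasing[OF that, of "Suc n"]
  by (simp add: gap_def abs_le_iff)

text \<open>A \<beta> can come to the front of \<open>\<alpha>x\<close> only if \<open>x\<close>
  starts with \<beta>, say \<open>x = \<beta>z\<close>; then
  \<open>\<alpha>x = \<alpha>\<beta>z = \<beta>\<alpha>z\<close>, and the \<beta> cancels.\<close>

lemma beta_in_act_alpha_iff:
  assumes "1 \<le> n" "x \<in> bdry_at k (Suc n)" "rng \<mu> = Suc n"
  shows "pcomp (abs_path (n, [Beta])) \<mu> \<in> act k (abs_path (n, [Alpha])) x \<longleftrightarrow>
    (\<exists>z\<in>bdry_at k (Suc (Suc n)). x = act k (abs_path (Suc n, [Beta])) z \<and> \<mu> \<in> act k (abs_path (Suc n, [Alpha])) z)"
proof -
  let ?a = "abs_path (n, [Alpha])" and ?b = "abs_path (n, [Beta])"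
  let ?a' = "abs_path (Suc n, [Alpha])" and ?b' = "abs_path (Suc n, [Beta])"
  have L: "?a \<in> Lam k" "?b \<in> Lam k" "?a' \<in> Lam k" "?b' \<in> Lam k"
    using assms(1) by (auto simp: edge_path_def)
  have com: "pcomp ?a ?b' = pcomp ?b ?a'"
    using equivclp_commute_swap(1)[of n "[]"] by (simp add: abs_path_eq_iff)
  have iff: "pcomp ?b \<mu> \<in> act k ?a (act k ?b' z) \<longleftrightarrow> \<mu> \<in> act k ?a' z" if z: "z \<in> bdry_at k (Suc (Suc n))" for z
  proof -
    have "act k ?a (act k ?b' z) = act k (pcomp ?a ?b') z"
      using act_pcomp[OF L(1,4)] z by simp
    also have "\<dots> = act k ?b (act k ?a' z)"
      unfolding com using act_pcomp[OF L(2,3)] z by simp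
    finally show ?thesis
      using pcomp_in_act[OF L(2), of "act k ?a' z" \<mu>] act_bdry_at[OF L(3), of z] z assms(3) by simp
  qed
  have "\<exists>z\<in>bdry_at k (Suc (Suc n)). x = act k ?b' z" if mem: "pcomp ?b \<mu> \<in> act k ?a x"
  proof -
    obtain \<nu> where nu: "\<nu> \<in> x" "pcomp ?b \<mu> \<preceq> pcomp ?a \<nu>"
      using mem act_mem_iff[OF L(1)] assms(2) by auto
    have "rng \<nu> = Suc n" using bdry_at_rng assms(2) nu(1) .
    \<comment> \<open>Since \<alpha> does not appear in \<open>betas\<close>, the leading \<beta>
      must come from \<open>\<nu>\<close>; dividing by a single \<beta> is a condition on
      \<open>betas\<close> only.\<close>
    with nu(2) have "?b' \<preceq> \<nu>" by (auto simp: divides_def prefix_def)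
    then have "?b' \<in> x" using Lam_star_hereditary[OF bdry_at_Lam_star[OF assms(2)] nu(1)] by blast
    then obtain z where "z \<in> bdry_at k (src ?b')" "x = act k ?b' z" by (rule act_surj[OF assms(2)])
    then show ?thesis by auto
  qed
  with iff show ?thesis by blast
qed

text \<open>\<open>\<theta>\<close> is the least common multiple of \<open>\<mu>\<close> and the
  \<alpha> of level \<open>Suc n\<close>, with that \<alpha> cancelled. If there is no common
  multiple, nothing is lost or gained and the gap vanishes.\<close>

lemma gap_step:
  assumes "1 \<le> n" "rng \<mu> = Suc n"
  shows "gap n \<mu> = 0 \<or> (\<exists>\<theta>. rng \<theta> = Suc (Suc n) \<and> gap n \<mu> = gap (Suc n) \<theta>)"
proof -
  let ?a = "abs_path (n, [Alpha])" and ?b = "abs_path (n, [Beta])"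
  let ?a' = "abs_path (Suc n, [Alpha])" and ?b' = "abs_path (Suc n, [Beta])"
  have L: "?a' \<in> Lam k" "?b' \<in> Lam k"
    using assms(1) by (auto simp: edge_path_def)
  have lt: "Alpha \<in> letters n" "Beta \<in> letters n" "Alpha \<in> letters (Suc n)" by (simp_all add: letters_def)
  have itin: "itinerary (Suc n) v \<in> bdry_at k (Suc n)" if "v \<in> interval (Suc n)" for v
    using itinerary_bdry_at that by simp
  \<comment> \<open>\<open>T\<close> holds the residues gained through the \<alpha>-block, and
    \<open>R\<close> the part of the fibre of \<open>\<mu>\<close> that does not fit into the
    \<beta>-block.\<close>
  define T where "T = {v \<in> interval (Suc n). pcomp ?b \<mu> \<in> act k ?a (itinerary (Suc n) v)}"
  define R where "R = {v \<in> interval (Suc n). \<mu> \<in> itinerary (Suc n) v \<and> ?a' \<in> itinerary (Suc n) v}"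
  have T_R: "T = {} \<and> R = {} \<or>
    (\<exists>\<theta>. rng \<theta> = Suc (Suc n) \<and> T = fibre (Suc n) (pcomp ?b' \<theta>) \<and> R = fibre (Suc n) (pcomp ?a' \<theta>))"
    using act_vimage_cases[OF L(1), of \<mu>]
  proof (elim disjE exE conjE)
    assume *: "\<forall>x\<in>bdry_at k (src ?a'). \<mu> \<notin> act k ?a' x" "\<forall>y\<in>Lam_star k. \<mu> \<in> y \<longrightarrow> ?a' \<notin> y"
    have "T = {}"
      using *(1) beta_in_act_alpha_iff[OF assms(1) itin assms(2)] by (auto simp: T_def)
    moreover have "R = {}" using *(2) itin bdry_at_Lam_star by (auto simp: R_def)
    ultimately show ?thesis by blast
  next
    fix \<theta> assume t: "rng \<theta> = src ?a'" "\<forall>x\<in>bdry_at k (src ?a'). \<mu> \<in> act k ?a' x \<longleftrightarrow> \<theta> \<in> x"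
      "\<forall>y\<in>Lam_star k. \<mu> \<in> y \<and> ?a' \<in> y \<longleftrightarrow> pcomp ?a' \<theta> \<in> y"
    have "pcomp ?b \<mu> \<in> act k ?a x \<longleftrightarrow> pcomp ?b' \<theta> \<in> x" if x: "x \<in> bdry_at k (Suc n)" for x
    proof
      assume "pcomp ?b \<mu> \<in> act k ?a x"
      then obtain z where z: "z \<in> bdry_at k (Suc (Suc n))" "x = act k ?b' z" "\<mu> \<in> act k ?a' z"
        using beta_in_act_alpha_iff[OF assms(1) x assms(2)] by blast
      then have "\<theta> \<in> z" using t(2) by simp
      then show "pcomp ?b' \<theta> \<in> x" using pcomp_in_act[OF L(2)] z t(1) by simp
    next
      assume m: "pcomp ?b' \<theta> \<in> x"
      then have "?b' \<in> x" using Lam_star_hereditary[OF bdry_at_Lam_star[OF x] m divides_pcomp] by blast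
      then obtain z where z: "z \<in> bdry_at k (src ?b')" "x = act k ?b' z" by (rule act_surj[OF x])
      then have "\<theta> \<in> z" using pcomp_in_act[OF L(2) z(1), of \<theta>] m t(1) by simp
      then have "\<mu> \<in> act k ?a' z" using t(2) z(1) by simp
      then show "pcomp ?b \<mu> \<in> act k ?a x"
        using beta_in_act_alpha_iff[OF assms(1) x assms(2)] z by auto
    qed
    then have "T = fibre (Suc n) (pcomp ?b' \<theta>)" using itin by (auto simp: T_def fibre_def)
    moreover have "R = fibre (Suc n) (pcomp ?a' \<theta>)"
      using t(3) itin bdry_at_Lam_star by (auto simp: R_def fibre_def)
    ultimately show ?thesis using t(1) by (intro disjI2 exI[of _ \<theta>]) simp
  qed
  then have sets: "T \<in> sets borel" "R \<in> sets borel" by auto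
  have TI: "T \<inter> {0..<weight (Suc n)} = T" by (auto simp: T_def interval_def)
  let ?S = "fibre (Suc n) \<mu>"
  let ?B = "{u \<in> interval n. digit n u = Beta \<and> residue n u \<in> ?S}"
  let ?A = "{u \<in> interval n. digit n u = Alpha \<and> residue n u \<in> T}"
  have mset: "{u \<in> interval n. digit n u = l \<and> residue n u \<in> X} \<in> sets borel" if "X \<in> sets borel" for l X
    using that by measurable
  have eq: "fibre n (pcomp ?b \<mu>) = ?B \<union> ?A"
    using pcomp_edge_in_itinerary_iff[OF assms(1) _ assms(2) lt(2)] residue_in_interval[OF assms(1)]
    by (auto simp: fibre_def T_def)
  have "mass n (pcomp ?b \<mu>) = measure lborel ?B + measure lborel ?A"
    unfolding mass_def eq
  proof (rule measure_Union)
    show "emeasure lborel ?B \<noteq> \<infinity>" "emeasure lborel ?A \<noteq> \<infinity>"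
      by (rule emeasure_interval_subset_finite[of _ n]; blast)+
    show "?B \<in> sets lborel" "?A \<in> sets lborel" using mset sets by simp_all
    show "?B \<inter> ?A = {}" by auto
  qed
  also have "measure lborel ?A = measure lborel T"
    using measure_block[OF assms(1) lt(1) sets(1)] TI by (simp add: block_length_def)
  also have "measure lborel ?B = measure lborel (?S \<inter> {0..<drop_weight (Suc n)})"
    using measure_block[OF assms(1) lt(2), of ?S] by (simp add: block_length_def)
  \<comment> \<open>The right end of the \<beta>-block is the threshold above which the next
    itinerary contains \<alpha>.\<close>
  also have "?S \<inter> {0..<drop_weight (Suc n)} = ?S - R"
    using alpha_in_itinerary_iff[of "Suc n"] by (auto simp: fibre_def R_def interval_def)
  also have "measure lborel (?S - R) = mass (Suc n) \<mu> - measure lborel R"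
    unfolding mass_def
  proof (rule measure_Diff)
    show "emeasure lborel ?S \<noteq> \<infinity>" by (rule emeasure_interval_subset_finite[OF fibre_subset])
    show "R \<subseteq> ?S" by (auto simp: R_def fibre_def)
  qed (use sets in simp_all)
  finally have gap: "gap n \<mu> = measure lborel T - measure lborel R" by (simp add: gap_def)
  from T_R show ?thesis
  proof (elim disjE exE conjE)
    fix \<theta> assume t: "rng \<theta> = Suc (Suc n)" "T = fibre (Suc n) (pcomp ?b' \<theta>)" "R = fibre (Suc n) (pcomp ?a' \<theta>)"
    \<comment> \<open>As \<alpha>-cylinders have no error, the measure of \<open>R\<close> is the
      mass of \<open>\<theta>\<close>, which is the term subtracted in
      \<open>gap (Suc n) \<theta>\<close>.\<close>
    have "mass (Suc n) (pcomp ?a' \<theta>) = mass (Suc (Suc n)) \<theta>"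
      using mass_edge_not_beta[OF _ t(1) lt(3)] by simp
    then have "gap n \<mu> = gap (Suc n) \<theta>"
      unfolding gap t(2,3) by (simp add: gap_def mass_def)
    with t(1) show ?thesis by blast
  qed (simp add: gap)
qed

lemma gap_eq_0:
  assumes "1 \<le> n" "rng \<mu> = Suc n"
  shows "gap n \<mu> = 0"
proof -
  have "\<bar>gap n \<mu>\<bar> \<le> weight (r + n)" if "1 \<le> n" "rng \<mu> = Suc n" for r n \<mu>
    using that
  proof (induction r arbitrary: n \<mu>)
    case 0
    then show ?case using gap_bound by simp
  next
    case (Suc r)
    from gap_step[OF Suc.prems] show ?case
    proof (elim disjE exE conjE)
      assume "gap n \<mu> = 0"
      then show ?thesis using weight_pos[of "Suc r + n"] by simp
    next
      fix \<theta> assume "rng \<theta> = Suc (Suc n)" "gap n \<mu> = gap (Suc n) \<theta>"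
      with Suc.IH[of "Suc n" \<theta>] show ?thesis by simp
    qed
  qed
  from this[OF assms] have "\<bar>gap n \<mu>\<bar> \<le> 0"
    using LIMSEQ_le_const[OF LIMSEQ_ignore_initial_segment[OF weight_tendsto_0, of n]] by blast
  then show ?thesis by simp
qed

lemma mass_edge:
  assumes "1 \<le> n" "rng \<mu> = Suc n" "l \<in> letters n"
  shows "mass n (pcomp (abs_path (n, [l])) \<mu>) = mass (Suc n) \<mu>"
  using mass_edge_not_beta[OF assms] gap_eq_0[OF assms(1,2)] by (cases "l = Beta") (auto simp: gap_def)

lemma mass_eq_weight: "\<mu> \<in> Lam k \<Longrightarrow> mass (rng \<mu>) \<mu> = weight (src \<mu>)"
proof (induction "src \<mu> - rng \<mu>" arbitrary: \<mu>)
  case 0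
  then have "src \<mu> = rng \<mu>" using rng_le_src[of \<mu>] by simp
  moreover from this obtain n where n: "\<mu> = unit_path n" using path_trivial by blast
  ultimately have "1 \<le> n" using 0(2) by simp
  then have "fibre n \<mu> = interval n"
    using unit_in_bdry_at[OF itinerary_bdry_at] n by (auto simp: fibre_def)
  then show ?case using n measure_interval by (simp add: mass_def)
next
  case (Suc m)
  obtain n w where w: "\<mu> = abs_path (n, w)" by (cases \<mu>)
  with Suc.hyps(2) obtain l v where v: "w = l # v" by (cases w) auto
  have n: "1 \<le> n" using rng_Lam[OF Suc.prems] w by simp
  have eq: "\<mu> = pcomp (abs_path (n, [l])) (abs_path (Suc n, v))" by (simp add: w v)
  then have L: "abs_path (n, [l]) \<in> Lam k" "abs_path (Suc n, v) \<in> Lam k"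
    using Suc.prems pcomp_in_Lam[of "abs_path (Suc n, v)" "abs_path (n, [l])" k] by simp_all
  then have "l \<in> letters n" by (cases l) (auto simp: letters_def edge_path_def)
  then have "mass n \<mu> = mass (Suc n) (abs_path (Suc n, v))" unfolding eq using n by (intro mass_edge) simp_all
  also have "\<dots> = weight (src (abs_path (Suc n, v)))"
    using Suc.hyps(1)[of "abs_path (Suc n, v)"] Suc.hyps(2) L(2) by (simp add: w v)
  finally show ?case by (simp add: w v)
qed

section \<open>The invariant measure\<close>

definition cylinder :: "nat \<Rightarrow> path \<Rightarrow> path set set" where
  "cylinder n \<mu> = {x \<in> bdry_at k n. \<mu> \<in> x}"

lemma openin_cylinder: "openin (bdry_at_top k n) (cylinder n \<mu>)"
  unfolding openin_bdry_at_top by (auto simp: cylinder_def intro!: nbhdI[of \<mu> _ "{}"])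

lemma space_borel_algebra: "space (borel_algebra (bdry_at_top k n)) = bdry_at k n"
  unfolding borel_algebra_def topspace_bdry_at_top
  by (rule space_measure_of) (auto simp: openin_bdry_at_top)

text \<open>There are countably many paths, hence countably many basic sets, so every open set is a
  countable union of finite Boolean combinations of cylinders.\<close>

lemma sets_borel_algebra:
  "sets (borel_algebra (bdry_at_top k n)) = sigma_sets (bdry_at k n) (range (cylinder n))"
proof
  have "range (cylinder n) \<subseteq> sets (borel_algebra (bdry_at_top k n))"
    using openin_cylinder borel_algebra_sets by blast
  then show "sigma_sets (bdry_at k n) (range (cylinder n)) \<subseteq> sets (borel_algebra (bdry_at_top k n))"
    using sets.sigma_sets_subset[of _ "borel_algebra (bdry_at_top k n)"] by (simp add: space_borel_algebra)
next
  interpret sigma_algebra "bdry_at k n" "sigma_sets (bdry_at k n) (range (cylinder n))"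
    by (rule sigma_algebra_sigma_sets) (auto simp: cylinder_def)
  have cyl: "cylinder n \<mu> \<in> sigma_sets (bdry_at k n) (range (cylinder n))" for \<mu>
    by (rule sigma_sets.Basic) simp
  have "U \<in> sigma_sets (bdry_at k n) (range (cylinder n))" if "openin (bdry_at_top k n) U" for U
  proof -
    let ?B = "\<lambda>(\<mu>, F). cylinder n \<mu> - (\<Union>\<nu>\<in>F. cylinder n \<nu>)"
    let ?I = "{(\<mu>, F). finite F \<and> ?B (\<mu>, F) \<subseteq> U}"
    have U: "U \<subseteq> bdry_at k n" "\<And>x. x \<in> U \<Longrightarrow> nbhd (bdry_at k n) U x"
      using that by (auto simp: openin_bdry_at_top)
    have "countable ((UNIV :: path set) \<times> Collect (finite :: path set \<Rightarrow> bool))"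
      by (intro countable_SIGMA countableI_type countable_Collect_finite)
    then have "countable ?I" by (rule countable_subset[rotated]) auto
    moreover have "?B p \<in> sigma_sets (bdry_at k n) (range (cylinder n))" if "p \<in> ?I" for p
      using that cyl by (auto intro!: finite_UN)
    ultimately have "(\<Union>p\<in>?I. ?B p) \<in> sigma_sets (bdry_at k n) (range (cylinder n))"
      by (intro countable_UN') auto
    moreover have "(\<Union>p\<in>?I. ?B p) = U"
    proof
      show "U \<subseteq> (\<Union>p\<in>?I. ?B p)"
      proof
        fix x assume x: "x \<in> U"
        show "x \<in> (\<Union>p\<in>?I. ?B p)"
        proof (rule nbhdE[OF U(2)[OF x]])
          fix \<mu> F assume F: "\<mu> \<in> x" "finite F" "F \<inter> x = {}"
            "\<And>y. y \<in> bdry_at k n \<Longrightarrow> \<mu> \<in> y \<Longrightarrow> F \<inter> y = {} \<Longrightarrow> y \<in> U"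
          have "?B (\<mu>, F) \<subseteq> U" using F(4) by (auto simp: cylinder_def)
          with F(2) have "(\<mu>, F) \<in> ?I" by simp
          moreover have "x \<in> ?B (\<mu>, F)" using F(1,3) U(1) x by (auto simp: cylinder_def)
          ultimately show ?thesis by blast
        qed
      qed
    qed auto
    ultimately show ?thesis by simp
  qed
  then have "sigma_sets (bdry_at k n) {U. openin (bdry_at_top k n) U} \<subseteq> sigma_sets (bdry_at k n) (range (cylinder n))"
    by (intro sigma_sets_subset) auto
  moreover have "{U. openin (bdry_at_top k n) U} \<subseteq> Pow (bdry_at k n)"
    by (auto simp: openin_bdry_at_top)
  ultimately show "sets (borel_algebra (bdry_at_top k n)) \<subseteq> sigma_sets (bdry_at k n) (range (cylinder n))"
    by (simp add: borel_algebra_def topspace_bdry_at_top)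
qed

text \<open>For \<open>n\<close> at least 1 the total mass is \<open>weight n\<close>. Leaving it
  unnormalised makes the action of every path measure preserving onto its image.\<close>

definition boundary_measure :: "nat \<Rightarrow> path set measure" where
  "boundary_measure n = distr (restrict_space lborel (interval n)) (borel_algebra (bdry_at_top k n)) (itinerary n)"

lemma sets_boundary_measure: "sets (boundary_measure n) = sets (borel_algebra (bdry_at_top k n))"
  by (simp add: boundary_measure_def)

lemma space_boundary_measure: "space (boundary_measure n) = bdry_at k n"
  by (simp add: boundary_measure_def space_borel_algebra)

lemma measurable_itinerary_bdry:
  assumes "1 \<le> n"
  shows "itinerary n \<in> measurable (restrict_space lborel (interval n)) (borel_algebra (bdry_at_top k n))"
proof (rule measurable_sigma_sets[OF sets_borel_algebra])
  show "range (cylinder n) \<subseteq> Pow (bdry_at k n)" by (auto simp: cylinder_def)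
  show "itinerary n \<in> space (restrict_space lborel (interval n)) \<rightarrow> bdry_at k n"
    using itinerary_bdry_at[OF assms] by (auto simp: space_restrict_space)
  fix C assume "C \<in> range (cylinder n)"
  then obtain \<mu> where "C = cylinder n \<mu>" by blast
  then have "itinerary n -` C \<inter> space (restrict_space lborel (interval n)) = fibre n \<mu>"
    using itinerary_bdry_at[OF assms] by (auto simp: space_restrict_space fibre_def cylinder_def)
  then show "itinerary n -` C \<inter> space (restrict_space lborel (interval n)) \<in> sets (restrict_space lborel (interval n))"
    by (simp add: sets_restrict_space_iff fibre_subset)
qed

lemma emeasure_cylinder:
  assumes "1 \<le> n"
  shows "emeasure (boundary_measure n) (cylinder n \<mu>) = (if \<mu> \<in> Lam k \<and> rng \<mu> = n then ennreal (weight (src \<mu>)) else 0)"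
proof (cases "\<mu> \<in> Lam k \<and> rng \<mu> = n")
  case True
  have "emeasure (boundary_measure n) (cylinder n \<mu>) =
    emeasure (restrict_space lborel (interval n)) (itinerary n -` cylinder n \<mu> \<inter> space (restrict_space lborel (interval n)))"
    unfolding boundary_measure_def
    by (rule emeasure_distr[OF measurable_itinerary_bdry[OF assms] borel_algebra_sets[OF openin_cylinder]])
  also have "itinerary n -` cylinder n \<mu> \<inter> space (restrict_space lborel (interval n)) = fibre n \<mu>"
    using itinerary_bdry_at[OF assms] by (auto simp: space_restrict_space fibre_def cylinder_def)
  also have "emeasure (restrict_space lborel (interval n)) (fibre n \<mu>) = emeasure lborel (fibre n \<mu>)"
    by (rule emeasure_restrict_space) (simp_all add: fibre_subset)
  also have "\<dots> = ennreal (mass n \<mu>)"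
    unfolding mass_def using emeasure_interval_subset_finite[OF fibre_subset, of n \<mu>]
    by (intro emeasure_eq_ennreal_measure) simp
  finally show ?thesis using True mass_eq_weight by auto
next
  case False
  then have "cylinder n \<mu> = {}" using bdry_at_rng bdry_at_in_Lam by (auto simp: cylinder_def)
  with False show ?thesis by auto
qed

lemma cylinder_unit: "cylinder n (unit_path n) = bdry_at k n"
  using unit_in_bdry_at by (auto simp: cylinder_def)

lemma prob_space_boundary_measure: "prob_space (boundary_measure 1)"
proof
  show "emeasure (boundary_measure 1) (space (boundary_measure 1)) = 1"
    using emeasure_cylinder[of 1 "unit_path 1"] by (simp add: space_boundary_measure cylinder_unit weight_1[simplified])
qed

lemma Int_stable_cylinders: "Int_stable (range (cylinder n))"
  unfolding Int_stable_def
proof (intro ballI)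
  fix A B assume "A \<in> range (cylinder n)" "B \<in> range (cylinder n)"
  then obtain \<mu> \<nu> where AB: "A = cylinder n \<mu>" "B = cylinder n \<nu>" by blast
  show "A \<inter> B \<in> range (cylinder n)"
  proof (cases "\<exists>\<xi>. \<mu> \<preceq> \<xi> \<and> \<nu> \<preceq> \<xi>")
    case True
    then obtain \<kappa> where ka: "\<mu> \<preceq> \<kappa>" "\<nu> \<preceq> \<kappa>" "\<And>\<zeta>. \<mu> \<preceq> \<zeta> \<Longrightarrow> \<nu> \<preceq> \<zeta> \<Longrightarrow> \<kappa> \<preceq> \<zeta>"
      using lcm_exists by metis
    have "\<mu> \<in> x \<and> \<nu> \<in> x \<longleftrightarrow> \<kappa> \<in> x" if x: "x \<in> bdry_at k n" for x
    proof
      assume "\<mu> \<in> x \<and> \<nu> \<in> x"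
      then obtain \<xi> where "\<xi> \<in> x" "\<mu> \<preceq> \<xi>" "\<nu> \<preceq> \<xi>" using Lam_star_directed[OF bdry_at_Lam_star[OF x]] by blast
      then show "\<kappa> \<in> x" using ka(3) Lam_star_hereditary[OF bdry_at_Lam_star[OF x]] by blast
    next
      assume "\<kappa> \<in> x"
      then show "\<mu> \<in> x \<and> \<nu> \<in> x" using ka(1,2) Lam_star_hereditary[OF bdry_at_Lam_star[OF x]] by blast
    qed
    then have "A \<inter> B = cylinder n \<kappa>" unfolding AB cylinder_def by blast
    then show ?thesis by blast
  next
    case False
    have "\<not> (\<mu> \<in> x \<and> \<nu> \<in> x)" if x: "x \<in> bdry_at k n" for x
    proof
      assume "\<mu> \<in> x \<and> \<nu> \<in> x"
      then obtain \<xi> where "\<mu> \<preceq> \<xi>" "\<nu> \<preceq> \<xi>" using Lam_star_directed[OF bdry_at_Lam_star[OF x]] by blast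
      with False show False by blast
    qed
    then have "A \<inter> B = {}" unfolding AB cylinder_def by blast
    \<comment> \<open>The empty set is a cylinder too: that of any path with the wrong
      range.\<close>
    moreover have "cylinder n (unit_path (Suc n)) = {}" using bdry_at_rng by (fastforce simp: cylinder_def)
    ultimately show ?thesis by (metis rangeI)
  qed
qed

lemma measurable_act:
  assumes "\<eta> \<in> Lam k"
  shows "act k \<eta> \<in> measurable (boundary_measure (src \<eta>)) (borel_algebra (bdry_at_top k (rng \<eta>)))"
proof (rule measurable_sigma_sets[OF sets_borel_algebra])
  show "range (cylinder (rng \<eta>)) \<subseteq> Pow (bdry_at k (rng \<eta>))" by (auto simp: cylinder_def)
  show "act k \<eta> \<in> space (boundary_measure (src \<eta>)) \<rightarrow> bdry_at k (rng \<eta>)"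
    using act_bdry_at[OF assms] by (auto simp: space_boundary_measure)
  fix C assume "C \<in> range (cylinder (rng \<eta>))"
  then have "openin (bdry_at_top k (rng \<eta>)) C" using openin_cylinder by blast
  from continuous_act[OF assms this]
  have "{x \<in> bdry_at k (src \<eta>). act k \<eta> x \<in> C} \<in> sets (boundary_measure (src \<eta>))"
    unfolding sets_boundary_measure by (rule borel_algebra_sets)
  moreover have "{x \<in> bdry_at k (src \<eta>). act k \<eta> x \<in> C} = act k \<eta> -` C \<inter> space (boundary_measure (src \<eta>))"
    by (auto simp: space_boundary_measure)
  ultimately show "act k \<eta> -` C \<inter> space (boundary_measure (src \<eta>)) \<in> sets (boundary_measure (src \<eta>))" by simp
qed

text \<open>Both measures are compared on the intersection-stable family of cylinders. There they
  reduce to the cylinders of \<open>\<theta>\<close> and \<open>\<eta>\<theta>\<close>, which have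
  equal mass because the two paths have the same source.\<close>

lemma distr_act:
  assumes "\<eta> \<in> Lam k"
  shows "distr (boundary_measure (src \<eta>)) (borel_algebra (bdry_at_top k (rng \<eta>))) (act k \<eta>) =
    density (boundary_measure (rng \<eta>)) (indicator (cylinder (rng \<eta>) \<eta>))" (is "?N1 = ?N2")
proof (rule measure_eqI_generator_eq[OF Int_stable_cylinders])
  have r1: "1 \<le> rng \<eta>" using rng_Lam[OF assms] .
  then have s1: "1 \<le> src \<eta>" using rng_le_src[of \<eta>] by simp
  have cyl_sets: "cylinder n \<mu> \<in> sets (boundary_measure n)" for n \<mu>
    unfolding sets_boundary_measure by (rule borel_algebra_sets[OF openin_cylinder])
  have N1: "emeasure ?N1 (cylinder (rng \<eta>) \<mu>) = emeasure (boundary_measure (src \<eta>)) {x \<in> bdry_at k (src \<eta>). \<mu> \<in> act k \<eta> x}" for \<mu>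
  proof -
    have "emeasure ?N1 (cylinder (rng \<eta>) \<mu>) =
        emeasure (boundary_measure (src \<eta>)) (act k \<eta> -` cylinder (rng \<eta>) \<mu> \<inter> space (boundary_measure (src \<eta>)))"
      by (rule emeasure_distr[OF measurable_act[OF assms] borel_algebra_sets[OF openin_cylinder]])
    also have "act k \<eta> -` cylinder (rng \<eta>) \<mu> \<inter> space (boundary_measure (src \<eta>)) = {x \<in> bdry_at k (src \<eta>). \<mu> \<in> act k \<eta> x}"
      using act_bdry_at[OF assms] by (auto simp: space_boundary_measure cylinder_def)
    finally show ?thesis .
  qed
  have N2: "emeasure ?N2 (cylinder (rng \<eta>) \<mu>) = emeasure (boundary_measure (rng \<eta>)) {y \<in> bdry_at k (rng \<eta>). \<mu> \<in> y \<and> \<eta> \<in> y}" for \<mu>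
  proof -
    have "emeasure ?N2 (cylinder (rng \<eta>) \<mu>) = emeasure (boundary_measure (rng \<eta>)) (cylinder (rng \<eta>) \<eta> \<inter> cylinder (rng \<eta>) \<mu>)"
      by (rule emeasure_restricted[OF cyl_sets cyl_sets])
    also have "cylinder (rng \<eta>) \<eta> \<inter> cylinder (rng \<eta>) \<mu> = {y \<in> bdry_at k (rng \<eta>). \<mu> \<in> y \<and> \<eta> \<in> y}"
      by (auto simp: cylinder_def)
    finally show ?thesis .
  qed
  fix C assume "C \<in> range (cylinder (rng \<eta>))"
  then obtain \<mu> where C: "C = cylinder (rng \<eta>) \<mu>" by blast
  show "emeasure ?N1 C = emeasure ?N2 C"
    unfolding C N1 N2 using act_vimage_cases[OF assms, of \<mu>]
  proof (elim disjE exE conjE)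
    assume "\<forall>x\<in>bdry_at k (src \<eta>). \<mu> \<notin> act k \<eta> x" "\<forall>y\<in>Lam_star k. \<mu> \<in> y \<longrightarrow> \<eta> \<notin> y"
    then have "{x \<in> bdry_at k (src \<eta>). \<mu> \<in> act k \<eta> x} = {}" "{y \<in> bdry_at k (rng \<eta>). \<mu> \<in> y \<and> \<eta> \<in> y} = {}"
      using bdry_at_Lam_star by blast+
    then show "emeasure (boundary_measure (src \<eta>)) {x \<in> bdry_at k (src \<eta>). \<mu> \<in> act k \<eta> x} =
      emeasure (boundary_measure (rng \<eta>)) {y \<in> bdry_at k (rng \<eta>). \<mu> \<in> y \<and> \<eta> \<in> y}"
      by (simp only: emeasure_empty)
  next
    fix \<theta> assume t: "rng \<theta> = src \<eta>" "\<forall>x\<in>bdry_at k (src \<eta>). \<mu> \<in> act k \<eta> x \<longleftrightarrow> \<theta> \<in> x"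
      "\<forall>y\<in>Lam_star k. \<mu> \<in> y \<and> \<eta> \<in> y \<longleftrightarrow> pcomp \<eta> \<theta> \<in> y"
    have "{x \<in> bdry_at k (src \<eta>). \<mu> \<in> act k \<eta> x} = cylinder (src \<eta>) \<theta>"
      using t(2) by (auto simp: cylinder_def)
    moreover have "{y \<in> bdry_at k (rng \<eta>). \<mu> \<in> y \<and> \<eta> \<in> y} = cylinder (rng \<eta>) (pcomp \<eta> \<theta>)"
      using t(3) bdry_at_Lam_star by (auto simp: cylinder_def)
    ultimately show "emeasure (boundary_measure (src \<eta>)) {x \<in> bdry_at k (src \<eta>). \<mu> \<in> act k \<eta> x} =
      emeasure (boundary_measure (rng \<eta>)) {y \<in> bdry_at k (rng \<eta>). \<mu> \<in> y \<and> \<eta> \<in> y}"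
      using emeasure_cylinder r1 s1 t(1) assms by simp
  qed
next
  show "range (cylinder (rng \<eta>)) \<subseteq> Pow (bdry_at k (rng \<eta>))" by (auto simp: cylinder_def)
  show "sets ?N1 = sigma_sets (bdry_at k (rng \<eta>)) (range (cylinder (rng \<eta>)))"
    by (simp add: sets_borel_algebra)
  show "sets ?N2 = sigma_sets (bdry_at k (rng \<eta>)) (range (cylinder (rng \<eta>)))"
    by (simp add: sets_boundary_measure sets_borel_algebra)
  \<comment> \<open>The whole space is the cylinder of a unit and has finite mass, so a constant
    sequence exhausts it.\<close>
  show "range (\<lambda>i::nat. bdry_at k (rng \<eta>)) \<subseteq> range (cylinder (rng \<eta>))"
    using cylinder_unit[of "rng \<eta>"] by (metis image_subsetI rangeI)
  show "(\<Union>i::nat. bdry_at k (rng \<eta>)) = bdry_at k (rng \<eta>)" by simp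
  show "emeasure ?N1 (bdry_at k (rng \<eta>)) \<noteq> \<infinity>" for i :: nat
  proof -
    have s1: "1 \<le> src \<eta>" using rng_Lam[OF assms] rng_le_src[of \<eta>] by simp
    have "emeasure ?N1 (bdry_at k (rng \<eta>)) = emeasure (boundary_measure (src \<eta>)) (bdry_at k (src \<eta>))"
      using act_bdry_at[OF assms] borel_algebra_sets[OF openin_cylinder, of "rng \<eta>" "unit_path (rng \<eta>)"]
      by (subst emeasure_distr[OF measurable_act[OF assms]])
         (auto simp: cylinder_unit space_boundary_measure intro!: arg_cong[of _ _ "emeasure _"])
    also have "\<dots> = ennreal (weight (src \<eta>))"
      using emeasure_cylinder[OF s1, of "unit_path (src \<eta>)"] s1 by (simp add: cylinder_unit)
    finally show ?thesis by simp
  qed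
qed

lemma emeasure_act_image:
  assumes "\<eta> \<in> Lam k" "openin (bdry_at_top k (src \<eta>)) U" "openin (bdry_at_top k (src \<eta>)) V"
  shows "emeasure (boundary_measure (rng \<eta>)) (act k \<eta> ` (U - V)) = emeasure (boundary_measure (src \<eta>)) (U - V)"
proof -
  let ?B = "act k \<eta> ` (U - V)"
  have UX: "U - V \<subseteq> bdry_at k (src \<eta>)"
    using openin_subset[OF assms(2)] by (auto simp: topspace_bdry_at_top)
  have B: "?B \<in> sets (borel_algebra (bdry_at_top k (rng \<eta>)))"
    by (rule act_diff_measurable[OF assms(1) refl assms(2,3) refl])
  have "?B \<subseteq> cylinder (rng \<eta>) \<eta>"
    using UX act_bdry_at[OF assms(1)] self_in_act[OF assms(1)] by (auto simp: cylinder_def)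
  then have "emeasure (boundary_measure (rng \<eta>)) ?B = emeasure (boundary_measure (rng \<eta>)) (cylinder (rng \<eta>) \<eta> \<inter> ?B)"
    by (simp add: Int_absorb1)
  also have "\<dots> = emeasure (density (boundary_measure (rng \<eta>)) (indicator (cylinder (rng \<eta>) \<eta>))) ?B"
    using B borel_algebra_sets[OF openin_cylinder]
    by (intro emeasure_restricted[symmetric]) (simp_all add: sets_boundary_measure)
  also have "\<dots> = emeasure (boundary_measure (src \<eta>)) (act k \<eta> -` ?B \<inter> space (boundary_measure (src \<eta>)))"
    unfolding distr_act[OF assms(1), symmetric]
    by (rule emeasure_distr[OF measurable_act[OF assms(1)] B])
  also have "act k \<eta> -` ?B \<inter> space (boundary_measure (src \<eta>)) = U - V"
    using UX inj_on_act[OF assms(1)] by (auto simp: space_boundary_measure dest: inj_onD)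
  finally show ?thesis .
qed

theorem invariant_measure_exists: "\<exists>M. prob_space M \<and> invariant_measure (path_groupoid k) M"
proof (intro exI conjI)
  show "prob_space (boundary_measure 1)" by (rule prob_space_boundary_measure)
  show "invariant_measure (path_groupoid k) (boundary_measure 1)"
  proof (rule invariant_measureI[OF sets_boundary_measure])
    fix \<mu> \<nu> U V
    assume *: "(\<mu>, \<nu>) \<in> parallel_pairs" "openin (bdry_at_top k (src \<mu>)) U" "openin (bdry_at_top k (src \<mu>)) V"
    then have "\<mu> \<in> Lam k" "\<nu> \<in> Lam k" "rng \<mu> = 1" "rng \<nu> = 1" "src \<mu> = src \<nu>"
      by (simp_all add: parallel_pairs_def)
    with * show "emeasure (boundary_measure 1) (act k \<mu> ` (U - V)) = emeasure (boundary_measure 1) (act k \<nu> ` (U - V))"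
      using emeasure_act_image[of \<mu> U V] emeasure_act_image[of \<nu> U V] by simp
  qed
qed

end

lemma path_category_kseq:
  assumes "\<forall>i\<ge>1. 0 < c i"
  shows "path_category (kseq k1 c)"
proof
  fix n
  \<comment> \<open>Block \<open>?m\<close> starts with \<open>c (2 * ?m)\<close>, whose index is at
    least 2, so the entry is positive; \<open>c 0\<close> carries no such guarantee.\<close>
  let ?m = "Suc n"
  define p where "p = concat (map (kblock c) [0..<?m])"
  have len: "m \<le> length (concat (map (kblock c) [0..<m]))" for m
    by (induction m) (simp_all add: kblock_def)
  \<comment> \<open>In the list, \<open>k1\<close> has position 0 and \<open>p\<close> the positions
    1 to \<open>length p\<close>, so block \<open>?m\<close> starts at position
    \<open>length p + 1\<close>; indices of \<open>kseq\<close> are one larger.\<close>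
  let ?i = "Suc (Suc (length p))"
  have "[0..<?i] = [0..<?m] @ [?m..<?i]"
    using upt_add_eq_append[of 0 ?m "?i - ?m"] len[of ?m] by (simp add: p_def del: upt_Suc)
  moreover have "[?m..<?i] = ?m # [Suc ?m..<?i]"
    using len[of ?m] by (intro upt_conv_Cons) (simp add: p_def)
  ultimately have "concat (map (kblock c) [0..<?i]) = p @ nat (c (2 * ?m)) #
      (replicate (nat (c (2 * ?m + 1) - 1)) 0 @ concat (map (kblock c) [Suc ?m..<?i]))"
    by (simp only: p_def map_append concat_append list.map concat.simps kblock_def append_Cons)
  then have "kseq k1 c ?i = nat (c (2 * ?m))"
    by (simp add: kseq_def nth_append)
  moreover have "0 < c (2 * ?m)" using assms by simp
  ultimately have "0 < kseq k1 c ?i" by simp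
  moreover have "n \<le> ?i" using len[of ?m] by (simp add: p_def)
  ultimately show "\<exists>i\<ge>n. 0 < kseq k1 c i" by blast
qed

theorem theorem6p10:
  fixes \<sigma> :: real and c :: "nat \<Rightarrow> int" and k1 :: nat
  assumes "\<sigma> > 0" and "\<sigma> \<notin> \<rat>"
    and "simple_cfrac_expansion c \<sigma>"
  shows "\<exists>M. prob_space M \<and> invariant_measure (path_groupoid (kseq k1 c)) M"
proof -
  interpret path_category "kseq k1 c"
    by (rule path_category_kseq) (use assms(3) in \<open>simp add: simple_cfrac_expansion_def\<close>)
  show ?thesis by (rule invariant_measure_exists)
qed

end
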